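(* Let $\mu,\mu_1,\mu_2,\ldots$ be Borel measures on $S$. Suppose there exists an increasing sequence $(V_k)_{k\ge1}$ of relatively compact open subsets of $S$ with $\bigcup_{k\ge1}V_k=S$ such that, for every $k\ge1$, $\mu^{V_k}\in\mathcal S_{00}$, $\mu_n^{V_k}\in\mathcal S_{00}$ for all $n\ge1$, and $$\lim_{n\to\infty}\|R_1\mu_n^{V_k}-R_1\mu^{V_k}\|_{L^\infty(S,\,\mu_n^{V_k}+\mu^{V_k})}=0 .$$ (Then $\mu$ and all $\mu_n$ are smooth measures.) Suppose moreover that $X$ is conservative, i.e. $P_x(X_t\in S,\ \forall t\in[0,\infty))=1$ for all $x\in S$. Let $A_n$ and $A$ be the PCAFs of $X$ associated with $\mu_n$ and $\mu$, respectively, by the Revuz correspondence. Then, for any $\varepsilon,T>0$ and $x\in S$, $$\lim_{n\to\infty}P_x\Big(\sup_{0\le t\le T}|A_n(t)-A(t)|>\varepsilon\Big)=0 .$$ As a consequence, $A_n\to A$ in probability in the local uniform topology (uniform convergence on compact time intervals) under $P_x$ for any $x\in S$.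
   Context: Setting. $S$ is a locally compact separable metrizable space; $S_\Delta=S\cup\{\Delta\}$ is its one-point compactification ($\Delta$ isolated if $S$ is compact). Functions $f$ on $S$ are extended by $f(\Delta)=0$; $\inf\emptyset=\infty$. $X=(\Omega,\mathscr M,(X_t)_{t\in[0,\infty]},(P_x)_{x\in S_\Delta},(\theta_t)_{t\in[0,\infty]})$ is a standard process on $S$ (a normal, right-continuous strong Markov process with cemetery $\Delta$, having left limits and quasi-left-continuous on $[0,\zeta)$, where $\zeta=\inf\{t: X_t=\Delta\}$ is the lifetime; $X_\infty=\Delta$; $\theta_t$ are shift operators, $X_s\circ\theta_t=X_{s+t}$). $(\mathscr F_t)_{t\in[0,\infty]}$ is the minimum augmented admissible filtration. Standing assumption (duality and absolute continuity): there exist another standard process $\hat X$ on $S$ with laws $\hat P_x$, a $\sigma$-finite Borel measure $m$ on $S$ and a Borel measurable function $p:(0,\infty)\times S\times S\to[0,\infty]$ such that for all $s,t>0$, $x,y\in S$: $P_x(X_t\in dy)=p_t(x,y)\,m(dy)$; $\hat P_y(\hat X_t\in dx)=p_t(x,y)\,m(dx)$; $p_{t+s}(x,y)=\int_S p_t(x,z)p_s(z,y)\,m(dz)$. Notation. For $\alpha\ge0$: $r_\alpha(x,y)=\int_0^\infty e^{-\alpha t}p_t(x,y)\,dt$ and, for a Borel measure $\mu$, $R_\alpha\mu(x)=\int_S r_\alpha(x,y)\,\mu(dy)$ (the $\alpha$-potential). $\mu^E(dx)=1_E(x)\mu(dx)$. $\|f\|_\infty=\sup_{x\in S}|f(x)|$;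 $\|f\|_{L^\infty(S,\nu)}=\inf\{C>0:|f|\le C\ \nu\text{-a.e.}\}$. For Borel $E\subseteq S$: $\sigma_E=\inf\{t\in(0,\infty):X_t\in E\}$, $\tau_E=\inf\{t\in[0,\infty):X_t\notin E\}$. A set is thin if it is contained in a nearly Borel set $B$ with $P_x(\sigma_B=0)=0$ for all $x$; a set is semipolar if it is contained in a countable union of thin sets. $\mathcal S_{00}$: finite Borel measures $\mu$ on $S$ charging no semipolar set with $\|R_1\mu\|_\infty<\infty$. A Borel measure $\mu$ is smooth ($\mu\in\mathcal S_1$) if it charges no semipolar set and there is an increasing sequence of Borel sets $E_n$ with $\bigcup_nE_n=S$, $\mu(E_n)<\infty$, $\|R_1\mu^{E_n}\|_\infty<\infty$ for all $n$, and $P_x(\lim_n\tau_{E_n}\ge\zeta)=1$ for all $x\in S$. One has $\mathcal S_{00}\subseteq\mathcal S_1$. PCAF: an $(\mathscr F_t)$-adapted non-negative process $A=(A_t)_{t\ge0}$ for which there is $\Lambda\in\mathscr F_\infty$ (a defining set) with $P_x(\Lambda)=1$ for all $x\in S$, $\theta_t(\Lambda)\subseteq\Lambda$ for all $t\ge0$, and for every $\omega\in\Lambda$: $A_0(\omega)=0$, $t\mapsto A_t(\omega)\in[0,\infty]$ is continuous on $[0,\infty)$, $A_t(\omega)<\infty$ for $t<\zeta(\omega)$, $A_t(\omega)=A_{\zeta(\omega)}(\omega)$ for $t\ge\zeta(\omega)$, and $A_{t+s}(\omega)=A_t(\omega)+A_s(\theta_t\omega)$ for all $s,t\ge0$. Two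 PCAFs are equivalent if they coincide for all $t$ on a common defining set. Revuz correspondence (known): equivalence classes of PCAFs $A$ and smooth measures $\mu$ are in one-to-one correspondence, characterized by $E_x[\int_0^\infty e^{-\alpha t}f(X_t)\,dA_t]=\int_S r_\alpha(x,y)f(y)\,\mu(dy)$ for all $\alpha>0$, $x\in S$ and non-negative Borel $f$. *)

theory Defs
  imports "HOL-Probability.Probability"
begin

section \<open>State space\<close>

text \<open>
  The state space \<open>S\<close> is a type of class \<open>{metric_space, second_countable_topology}\<close> (for metric
  spaces, second countability is separability); local compactness is a hypothesis where it is
  needed.  The metric enters only through its topology.  The space with the cemetery adjoined is
  the type \<open>'s option\<close>, with \<open>None\<close> as the cemetery and the one-point compactification topology,
  in which \<open>None\<close> is isolated if \<open>S\<close> is compact.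
\<close>

definition cem_top :: "'s::topological_space option topology" where
  "cem_top = Alexandroff_compactification euclidean"

definition cem_borel :: "'s::topological_space option measure" where
  "cem_borel = sigma UNIV {U. openin cem_top U}"

text \<open>Extension of a function on \<open>S\<close> by the value 0 at the cemetery.\<close>

definition ext0 :: "('s \<Rightarrow> ennreal) \<Rightarrow> 's option \<Rightarrow> ennreal" where
  "ext0 f z = (case z of None \<Rightarrow> 0 | Some x \<Rightarrow> f x)"

section \<open>Standard processes\<close>

text \<open>
  The time set \<open>[0,\<infinity>]\<close> is the type \<open>ennreal\<close>.  Of the field \<open>pr_space\<close> only the sample space and
  the \<open>\<sigma>\<close>-algebra on it are used.
\<close>

record ('w, 's) process =
  pr_space :: "'w measure"
  pr_at :: "ennreal \<Rightarrow> 'w \<Rightarrow> 's option"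
  pr_law :: "'s option \<Rightarrow> 'w measure"
  pr_shift :: "ennreal \<Rightarrow> 'w \<Rightarrow> 'w"

definition lifetime :: "('w, 's) process \<Rightarrow> 'w \<Rightarrow> ennreal" where
  "lifetime X \<omega> = Inf {t. pr_at X t \<omega> = None}"

definition raw_filt :: "('w, 's::topological_space) process \<Rightarrow> ennreal \<Rightarrow> 'w measure" where
  "raw_filt X t = sigma (space (pr_space X))
     {pr_at X s -` B \<inter> space (pr_space X) |s B. s \<le> t \<and> B \<in> sets cem_borel}"

text \<open>
  The null sets of the completion of \<open>raw_filt X \<infinity>\<close> with respect to
  \<open>P\<^sub>\<nu> = \<integral> P\<^sub>x \<nu>(dx)\<close>, for an initial distribution \<open>\<nu>\<close>.
\<close>

definition init_null :: "('w, 's::topological_space) process \<Rightarrow> 's option measure \<Rightarrow> 'w set set" where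
  "init_null X \<nu> = {N. N \<subseteq> space (pr_space X) \<and>
     (\<exists>B\<in>sets (raw_filt X \<infinity>). N \<subseteq> B \<and> (\<integral>\<^sup>+x. emeasure (pr_law X x) B \<partial>\<nu>) = 0)}"

definition init_dists :: "'s::topological_space option measure set" where
  "init_dists = {\<nu>. prob_space \<nu> \<and> sets \<nu> = sets cem_borel}"

text \<open>The minimum augmented admissible filtration.\<close>

definition aug_filt :: "('w, 's::topological_space) process \<Rightarrow> ennreal \<Rightarrow> 'w measure" where
  "aug_filt X t = sigma (space (pr_space X))
     (\<Inter>\<nu>\<in>init_dists. sigma_sets (space (pr_space X)) (sets (raw_filt X t) \<union> init_null X \<nu>))"

text \<open>
  Events of the augmented filtration need not lie in the given \<open>\<sigma>\<close>-algebra, but they lie in its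
  completion with respect to each \<open>P\<^sub>x\<close>.  Probabilities and expectations of them are therefore
  taken under \<open>completion (pr_law X x)\<close>; quantification \<open>AE\<close> is insensitive to completion.
\<close>

definition strong_markov :: "('w, 's::topological_space) process \<Rightarrow> bool" where
  "strong_markov X \<longleftrightarrow>
     (\<forall>t<\<infinity>. \<forall>B\<in>sets cem_borel.
        (\<lambda>x. emeasure (pr_law X x) {\<omega>\<in>space (pr_space X). pr_at X t \<omega> \<in> B})
          \<in> borel_measurable cem_borel) \<and>
     (\<forall>t<\<infinity>. sets (aug_filt X t) = (\<Inter>s\<in>{t<..}. sets (aug_filt X s))) \<and>
     (\<forall>T. stopping_time (aug_filt X) T \<longrightarrow>
        (\<forall>x. \<forall>t<\<infinity>. \<forall>B\<in>sets cem_borel.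
          \<forall>\<Lambda>\<in>sets (filtration.pre_sigma (space (pr_space X)) (aug_filt X) T).
            emeasure (completion (pr_law X x))
              {\<omega>\<in>\<Lambda>. T \<omega> < \<infinity> \<and> pr_at X (T \<omega> + t) \<omega> \<in> B} =
            (\<integral>\<^sup>+\<omega>. emeasure (pr_law X (pr_at X (T \<omega>) \<omega>))
                    {\<omega>'\<in>space (pr_space X). pr_at X t \<omega>' \<in> B}
                  * indicator {\<omega>\<in>\<Lambda>. T \<omega> < \<infinity>} \<omega> \<partial>completion (pr_law X x))))"

definition quasi_left_cont :: "('w, 's::topological_space) process \<Rightarrow> bool" where
  "quasi_left_cont X \<longleftrightarrow>
     (\<forall>T. (\<forall>n. stopping_time (aug_filt X) (T n)) \<and>
          (\<forall>\<omega>\<in>space (pr_space X). incseq (\<lambda>n. T n \<omega>)) \<longrightarrow>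
        (\<forall>x. AE \<omega> in pr_law X x. (SUP n. T n \<omega>) < lifetime X \<omega> \<longrightarrow>
           limitin cem_top (\<lambda>n. pr_at X (T n \<omega>) \<omega>) (pr_at X (SUP n. T n \<omega>) \<omega>) sequentially))"

definition standard_process :: "('w, 's::topological_space) process \<Rightarrow> bool" where
  "standard_process X \<longleftrightarrow>
     (\<forall>t. pr_at X t \<in> measurable (pr_space X) cem_borel) \<and>
     (\<forall>x. prob_space (pr_law X x) \<and> sets (pr_law X x) = sets (pr_space X)) \<and>
     (\<forall>x. AE \<omega> in pr_law X x. pr_at X 0 \<omega> = x) \<and>
     (\<forall>\<omega>\<in>space (pr_space X). pr_at X \<infinity> \<omega> = None \<and>
        (\<forall>t\<ge>lifetime X \<omega>. pr_at X t \<omega> = None)) \<and>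
     (\<forall>t. \<forall>\<omega>\<in>space (pr_space X). pr_shift X t \<omega> \<in> space (pr_space X) \<and>
        (\<forall>s. pr_at X s (pr_shift X t \<omega>) = pr_at X (s + t) \<omega>)) \<and>
     (\<forall>\<omega>\<in>space (pr_space X). \<forall>t<\<infinity>.
        limitin cem_top (\<lambda>s. pr_at X s \<omega>) (pr_at X t \<omega>) (at_right t)) \<and>
     (\<forall>x. AE \<omega> in pr_law X x. \<forall>t. 0 < t \<and> t < lifetime X \<omega> \<longrightarrow>
        (\<exists>l. limitin cem_top (\<lambda>s. pr_at X s \<omega>) l (at_left t))) \<and>
     strong_markov X \<and> quasi_left_cont X"

definition conservative :: "('w, 's) process \<Rightarrow> bool" where
  "conservative X \<longleftrightarrow> (\<forall>x. AE \<omega> in pr_law X (Some x). \<forall>t<\<infinity>. pr_at X t \<omega> \<in> range Some)"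

section \<open>Duality, absolute continuity and potentials\<close>

text \<open>\<open>p\<close> is only relevant at positive times.\<close>

definition dual_density ::
  "('w, 's::topological_space) process \<Rightarrow> ('v, 's) process \<Rightarrow> 's measure
     \<Rightarrow> (real \<Rightarrow> 's \<Rightarrow> 's \<Rightarrow> ennreal) \<Rightarrow> bool" where
  "dual_density X Xh m p \<longleftrightarrow>
     sets m = sets borel \<and> sigma_finite_measure m \<and>
     (\<lambda>(t, x, y). p t x y) \<in>
        borel_measurable (restrict_space borel {0<..} \<Otimes>\<^sub>M (borel \<Otimes>\<^sub>M borel)) \<and>
     (\<forall>t>0. \<forall>x. \<forall>B\<in>sets borel.
        emeasure (pr_law X (Some x)) {\<omega>\<in>space (pr_space X). pr_at X (ennreal t) \<omega> \<in> Some ` B}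
          = (\<integral>\<^sup>+y\<in>B. p t x y \<partial>m)) \<and>
     (\<forall>t>0. \<forall>y. \<forall>B\<in>sets borel.
        emeasure (pr_law Xh (Some y)) {\<omega>\<in>space (pr_space Xh). pr_at Xh (ennreal t) \<omega> \<in> Some ` B}
          = (\<integral>\<^sup>+x\<in>B. p t x y \<partial>m)) \<and>
     (\<forall>s>0. \<forall>t>0. \<forall>x y. p (t + s) x y = (\<integral>\<^sup>+z. p t x z * p s z y \<partial>m))"

definition res_dens :: "(real \<Rightarrow> 's \<Rightarrow> 's \<Rightarrow> ennreal) \<Rightarrow> real \<Rightarrow> 's \<Rightarrow> 's \<Rightarrow> ennreal" where
  "res_dens p \<alpha> x y = (\<integral>\<^sup>+t\<in>{0<..}. ennreal (exp (- \<alpha> * t)) * p t x y \<partial>lborel)"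

definition potential :: "(real \<Rightarrow> 's \<Rightarrow> 's \<Rightarrow> ennreal) \<Rightarrow> real \<Rightarrow> 's measure \<Rightarrow> 's \<Rightarrow> ennreal" where
  "potential p \<alpha> \<mu> x = (\<integral>\<^sup>+y. res_dens p \<alpha> x y \<partial>\<mu>)"

definition restr :: "'s measure \<Rightarrow> 's set \<Rightarrow> 's measure" where
  "restr \<mu> E = density \<mu> (indicator E)"

definition add_measure :: "'s::topological_space measure \<Rightarrow> 's measure \<Rightarrow> 's measure" where
  "add_measure \<mu> \<nu> = measure_of UNIV (sets borel) (\<lambda>B. emeasure \<mu> B + emeasure \<nu> B)"

definition Linf_norm :: "'s measure \<Rightarrow> ('s \<Rightarrow> real) \<Rightarrow> ennreal" where
  "Linf_norm \<nu> f = Inf {ennreal C |C. 0 < C \<and> (AE x in \<nu>. \<bar>f x\<bar> \<le> C)}"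

section \<open>Semipolar sets and smooth measures\<close>

definition hit_time :: "('w, 's) process \<Rightarrow> 's set \<Rightarrow> 'w \<Rightarrow> ennreal" where
  "hit_time X E \<omega> = Inf {t. 0 < t \<and> t < \<infinity> \<and> pr_at X t \<omega> \<in> Some ` E}"

definition exit_time :: "('w, 's) process \<Rightarrow> 's set \<Rightarrow> 'w \<Rightarrow> ennreal" where
  "exit_time X E \<omega> = Inf {t. t < \<infinity> \<and> pr_at X t \<omega> \<notin> Some ` E}"

definition nearly_borel :: "('w, 's::topological_space) process \<Rightarrow> 's set \<Rightarrow> bool" where
  "nearly_borel X B \<longleftrightarrow> (\<forall>\<nu>\<in>init_dists. \<exists>B1\<in>sets borel. \<exists>B2\<in>sets borel. B1 \<subseteq> B \<and> B \<subseteq> B2 \<and>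
     {\<omega>\<in>space (pr_space X). \<exists>t<\<infinity>. pr_at X t \<omega> \<in> Some ` (B2 - B1)} \<in> init_null X \<nu>)"

definition thin :: "('w, 's::topological_space) process \<Rightarrow> 's set \<Rightarrow> bool" where
  "thin X E \<longleftrightarrow> (\<exists>B. E \<subseteq> B \<and> nearly_borel X B \<and>
     (\<forall>x. AE \<omega> in pr_law X (Some x). hit_time X B \<omega> \<noteq> 0))"

definition semipolar :: "('w, 's::topological_space) process \<Rightarrow> 's set \<Rightarrow> bool" where
  "semipolar X E \<longleftrightarrow> (\<exists>F :: nat \<Rightarrow> 's set. (\<forall>n. thin X (F n)) \<and> E \<subseteq> (\<Union>n. F n))"

text \<open>A semipolar set need not be Borel, hence the completion.\<close>

definition charges_no_semipolar :: "('w, 's::topological_space) process \<Rightarrow> 's measure \<Rightarrow> bool" where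
  "charges_no_semipolar X \<mu> \<longleftrightarrow> (\<forall>E. semipolar X E \<longrightarrow> E \<in> null_sets (completion \<mu>))"

definition S00 ::
  "('w, 's::topological_space) process \<Rightarrow> (real \<Rightarrow> 's \<Rightarrow> 's \<Rightarrow> ennreal) \<Rightarrow> 's measure set" where
  "S00 X p = {\<mu>. sets \<mu> = sets borel \<and> finite_measure \<mu> \<and> charges_no_semipolar X \<mu> \<and>
     (SUP x. potential p 1 \<mu> x) < \<infinity>}"

definition smooth_measures ::
  "('w, 's::topological_space) process \<Rightarrow> (real \<Rightarrow> 's \<Rightarrow> 's \<Rightarrow> ennreal) \<Rightarrow> 's measure set" where
  "smooth_measures X p = {\<mu>. sets \<mu> = sets borel \<and> charges_no_semipolar X \<mu> \<and>
     (\<exists>E :: nat \<Rightarrow> 's set. (\<forall>n. E n \<in> sets borel) \<and> incseq E \<and> (\<Union>n. E n) = UNIV \<and>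
        (\<forall>n. emeasure \<mu> (E n) < \<infinity> \<and> (SUP x. potential p 1 (restr \<mu> (E n)) x) < \<infinity>) \<and>
        (\<forall>x. AE \<omega> in pr_law X (Some x).
           (SUP n. exit_time X (E n) \<omega>) \<ge> lifetime X \<omega>))}"

section \<open>Positive continuous additive functionals\<close>

definition pcaf_defining_set ::
  "('w, 's::topological_space) process \<Rightarrow> (ennreal \<Rightarrow> 'w \<Rightarrow> ennreal) \<Rightarrow> 'w set \<Rightarrow> bool" where
  "pcaf_defining_set X A \<Lambda> \<longleftrightarrow>
     \<Lambda> \<in> sets (aug_filt X \<infinity>) \<and>
     (\<forall>x. AE \<omega> in pr_law X (Some x). \<omega> \<in> \<Lambda>) \<and>
     (\<forall>t<\<infinity>. pr_shift X t ` \<Lambda> \<subseteq> \<Lambda>) \<and>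
     (\<forall>\<omega>\<in>\<Lambda>. A 0 \<omega> = 0 \<and>
        continuous_on {..<\<infinity>} (\<lambda>t. A t \<omega>) \<and>
        (\<forall>t<lifetime X \<omega>. A t \<omega> < \<infinity>) \<and>
        (\<forall>t<\<infinity>. lifetime X \<omega> \<le> t \<longrightarrow> A t \<omega> = A (lifetime X \<omega>) \<omega>) \<and>
        (\<forall>s<\<infinity>. \<forall>t<\<infinity>. A (t + s) \<omega> = A t \<omega> + A s (pr_shift X t \<omega>)))"

text \<open>The value \<open>A \<infinity>\<close> is irrelevant.\<close>

definition pcaf ::
  "('w, 's::topological_space) process \<Rightarrow> (ennreal \<Rightarrow> 'w \<Rightarrow> ennreal) \<Rightarrow> bool" where
  "pcaf X A \<longleftrightarrow> (\<forall>t<\<infinity>. A t \<in> borel_measurable (aug_filt X t)) \<and>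
     (\<exists>\<Lambda>. pcaf_defining_set X A \<Lambda>)"

text \<open>
  The Lebesgue--Stieltjes measure \<open>da\<close> on \<open>[0,\<infinity>)\<close> of a continuous nondecreasing function
  \<open>a : [0,\<infinity>) \<rightarrow> [0,\<infinity>]\<close> with \<open>a 0 = 0\<close>, as a measure on the real line carried by \<open>(0,\<infinity>)\<close>
  (\<open>ennreal t = 0\<close> for \<open>t < 0\<close>).  Since \<open>a\<close> may become infinite at a finite time (the lifetime),
  it is the increasing limit of the measures of the truncations \<open>min n a\<close>; it has no mass on
  \<open>{t. a t = \<infinity>}\<close>.
\<close>

definition stieltjes :: "(ennreal \<Rightarrow> ennreal) \<Rightarrow> real measure" where
  "stieltjes a = measure_of UNIV (sets borel)
     (\<lambda>B. SUP n::nat. emeasure (interval_measure (\<lambda>t. enn2real (min (of_nat n) (a (ennreal t))))) B)"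

definition revuz_corr ::
  "('w, 's::topological_space) process \<Rightarrow> (real \<Rightarrow> 's \<Rightarrow> 's \<Rightarrow> ennreal)
     \<Rightarrow> (ennreal \<Rightarrow> 'w \<Rightarrow> ennreal) \<Rightarrow> 's measure \<Rightarrow> bool" where
  "revuz_corr X p A \<mu> \<longleftrightarrow> (\<forall>\<alpha>>0. \<forall>x. \<forall>f\<in>borel_measurable borel.
     (\<integral>\<^sup>+\<omega>. (\<integral>\<^sup>+t\<in>{0..}. ennreal (exp (- \<alpha> * t)) * ext0 f (pr_at X (ennreal t) \<omega>)
             \<partial>stieltjes (\<lambda>t. A t \<omega>)) \<partial>completion (pr_law X (Some x)))
       = (\<integral>\<^sup>+y. res_dens p \<alpha> x y * f y \<partial>\<mu>))"

section \<open>Local uniform convergence\<close>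

text \<open>
  \<open>sup_diff T a b\<close> is the supremum of \<open>\<bar>a t - b t\<bar>\<close> over \<open>0 \<le> t \<le> T\<close>, computed in the extended
  reals (where \<open>\<infinity> - \<infinity> = \<infinity>\<close>; for conservative processes this occurs only on null sets).
\<close>

definition sup_diff :: "real \<Rightarrow> (ennreal \<Rightarrow> ennreal) \<Rightarrow> (ennreal \<Rightarrow> ennreal) \<Rightarrow> ereal" where
  "sup_diff T a b = (SUP t\<in>{..ennreal T}. \<bar>enn2ereal (a t) - enn2ereal (b t)\<bar>)"

text \<open>The usual metric of the topology of uniform convergence on compact time intervals.\<close>

definition loc_unif_dist :: "(ennreal \<Rightarrow> ennreal) \<Rightarrow> (ennreal \<Rightarrow> ennreal) \<Rightarrow> real" where
  "loc_unif_dist a b = (\<Sum>k. (1/2) ^ Suc k * real_of_ereal (min 1 (sup_diff (real (Suc k)) a b)))"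

text \<open>
  \<open>P(E n) \<rightarrow> 0\<close>, for events of the completion; measurability is part of the definition because
  \<open>measure\<close> is 0 on nonmeasurable sets.
\<close>

definition prob_vanishes :: "'w measure \<Rightarrow> (nat \<Rightarrow> 'w set) \<Rightarrow> bool" where
  "prob_vanishes P E \<longleftrightarrow> (\<forall>n. E n \<in> sets (completion P)) \<and>
     (\<lambda>n. measure (completion P) (E n)) \<longlonglongrightarrow> 0"

end

theory Submission
  imports Defs
begin

text \<open>
  For an open set \<open>V\<close> let \<open>C\<close> and \<open>C'\<close> be the total masses of \<open>e\<^sup>-\<^sup>t 1\<^sub>V(X\<^sub>t) dA\<^sub>t\<close> and
  \<open>e\<^sup>-\<^sup>t 1\<^sub>V(X\<^sub>t) dA'\<^sub>t\<close>, and \<open>u\<close>, \<open>u'\<close> the 1-potentials of \<open>\<mu>\<^sup>V\<close>, \<open>\<mu>'\<^sup>V\<close>, so that \<open>E\<^sub>xC = u(x)\<close>.  The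
  strong Markov property at the times of the inverse of \<open>A\<close> gives
  \<open>E\<^sub>x[C C'] = R\<^sub>2(u' \<mu>\<^sup>V)(x) + R\<^sub>2(u \<mu>'\<^sup>V)(x)\<close>.  If \<open>\<bar>u - u'\<bar> \<le> \<delta>\<close> almost everywhere for
  \<open>\<mu>\<^sup>V + \<mu>'\<^sup>V\<close>, expanding the square yields \<open>E\<^sub>x(C - C')\<^sup>2 \<le> 2\<delta>(u + u')(x)\<close>, which is small
  uniformly in \<open>x\<close>.  By the Markov property at a fixed time \<open>t\<close> the same holds for the masses of
  \<open>[0,t)\<close>.  Along a subsequence these masses converge almost surely for countably many \<open>t\<close>, and
  increasing functions that converge pointwise to a continuous limit converge locally uniformly;
  undoing the discount gives locally uniform convergence of the functionals as long as the path
  stays in \<open>V\<close>.  By quasi-left-continuity the times at which the path leaves the sets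
  \<open>closure (V k)\<close> increase to the lifetime, which is infinite for a conservative process.
\<close>

text \<open>Closeness of the potentials is assumed only almost everywhere for the restricted
  measures, and no bound on \<open>R_1 \<mu>_n^V\<close> uniform in n is given. The second moment,
  however, sees u - u' only through integrals against \<mu>^V and \<mu>'^V, and it yields an
  estimate at every starting point. Only such an estimate can be carried through the Markov
  property, since the law of the position at time t need not be absolutely continuous with respect
  to these measures. A bound on \<open>R_1 \<mu>_n^V\<close> is then recovered from the one on
  \<open>R_1 \<mu>^V\<close>. The other obstacle is measurability: \<open>strong_markov\<close>
  speaks of a single position after a stopping time, while the mass still to come depends on the
  whole path and is measurable only for the augmented filtration. So the property has to be extended
  from positions to cylinders, to raw path functionals and to augmented ones. Conservativeness
  enters in three ways: the functionals are finite at finite times, a path restarted at a fixed time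
  starts in S, and the lifetime is infinite.\<close>

section \<open>Clocks and their inverses\<close>

text \<open>
  For the clocks below this is the usual right-continuous inverse; the infimum over rational times
  makes it measurable jointly with a parameter without any assumption on the paths.
\<close>

definition path_inv :: "(ennreal \<Rightarrow> ennreal) \<Rightarrow> real \<Rightarrow> ennreal" where
  "path_inv a s = (INF q\<in>{q\<in>\<rat>. 0 \<le> q}. if ennreal s < a (ennreal q) then ennreal q else \<top>)"

text \<open>Models a path of a PCAF of a conservative process. The value at infinity is left
  free.\<close>

definition clock :: "(ennreal \<Rightarrow> ennreal) \<Rightarrow> bool" where
  "clock a \<longleftrightarrow> a 0 = 0 \<and> (\<forall>s t. s \<le> t \<longrightarrow> t < \<infinity> \<longrightarrow> a s \<le> a t) \<and> continuous_on {..<\<infinity>} a \<and>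
     (\<forall>t<\<infinity>. a t < \<infinity>)"

lemma clock_0: "clock a \<Longrightarrow> a 0 = 0"
  and clock_mono: "clock a \<Longrightarrow> s \<le> t \<Longrightarrow> t < \<infinity> \<Longrightarrow> a s \<le> a t"
  and clock_finite: "clock a \<Longrightarrow> t < \<infinity> \<Longrightarrow> a t < \<infinity>"
  and clock_continuous_on: "clock a \<Longrightarrow> continuous_on {..<\<infinity>} a"
  by (auto simp: clock_def)

lemma clock_isCont:
  assumes "clock a" "t < \<infinity>"
  shows "isCont a t"
  using clock_continuous_on[OF assms(1)] assms(2) continuous_on_eq_continuous_at[of "{..<\<infinity>::ennreal}" a]
  by auto

lemma ennreal_rat_between:
  fixes r t :: ennreal
  assumes "r < t"
  obtains q where "q \<in> \<rat>" "0 \<le> q" "r < ennreal q" "ennreal q < t"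
proof -
  obtain s where s: "r < s" "s < t" using dense[OF assms] by auto
  have "r < \<top>" "s < \<top>" using s by (auto simp: less_top[symmetric])
  then obtain r' s' where r': "r = ennreal r'" "0 \<le> r'" and s': "s = ennreal s'" "0 \<le> s'"
    by (cases r; cases s) auto
  then have "r' < s'" using s by (simp add: ennreal_less_iff)
  then obtain q where q: "q \<in> \<rat>" "r' < q" "q < s'" using Rats_dense_in_real by blast
  moreover then have "ennreal q < s" "0 \<le> q" using r' s' by (auto simp: ennreal_less_iff)
  ultimately show thesis using that[of q] r' s by (auto simp: ennreal_less_iff)
qed

text \<open>By left-continuity, \<open>ennreal s < a r\<close> already holds at some rational time
  before \<open>r\<close>. All further facts about the inverse rest on this equivalence.\<close>

lemma path_inv_less_iff:
  assumes a: "clock a" and r: "r < \<infinity>"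
  shows "path_inv a s < r \<longleftrightarrow> ennreal s < a r"
proof
  assume "path_inv a s < r"
  then obtain q where q: "q \<in> \<rat>" "0 \<le> q" "(if ennreal s < a (ennreal q) then ennreal q else \<top>) < r"
    unfolding path_inv_def INF_less_iff by auto
  with r have "ennreal s < a (ennreal q)" "ennreal q < r" by (auto split: if_splits)
  then show "ennreal s < a r" using clock_mono[OF a, of "ennreal q" r] r
    by (auto intro: order.strict_trans2)
next
  assume s: "ennreal s < a r"
  then have "r \<noteq> 0" using clock_0[OF a] by auto
  then have r0: "0 < r" by (simp add: zero_less_iff_neq_zero)
  have "\<forall>\<^sub>F t in at r. ennreal s < a t"
    using clock_isCont[OF a r] s unfolding isCont_def by (rule order_tendstoD(1))
  then have "\<forall>\<^sub>F t in at_left r. ennreal s < a t"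
    by (simp add: eventually_at_split)
  then obtain b where b: "b < r" "\<And>t. b < t \<Longrightarrow> t < r \<Longrightarrow> ennreal s < a t"
    using eventually_at_left[OF r0] by auto
  obtain q where q: "q \<in> \<rat>" "0 \<le> q" "b < ennreal q" "ennreal q < r"
    using ennreal_rat_between[OF b(1)] .
  have "path_inv a s \<le> ennreal q"
    unfolding path_inv_def using q b(2)[OF q(3,4)] by (intro INF_lower2[of q]) auto
  then show "path_inv a s < r" using q(4) by auto
qed

lemma path_inv_le_iff:
  assumes a: "clock a" and t: "t < \<infinity>"
  shows "t \<le> path_inv a s \<longleftrightarrow> a t \<le> ennreal s"
  using path_inv_less_iff[OF a t, of s] by (auto simp: not_less[symmetric])

text \<open>Right-continuity excludes a jump over the level \<open>s\<close>. Hence each finite time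
  is the inverse of at most one nonnegative level, which expresses that the clock has no
  atoms.\<close>

lemma path_inv_eq_imp:
  assumes a: "clock a" and t: "t < \<infinity>" and eq: "path_inv a s = t"
  shows "a t = ennreal s"
proof (rule antisym)
  show "a t \<le> ennreal s" using path_inv_le_iff[OF a t, of s] eq by simp
  show "ennreal s \<le> a t"
  proof (rule ccontr)
    assume "\<not> ennreal s \<le> a t"
    then have "a t < ennreal s" by simp
    then have "\<forall>\<^sub>F u in at_right t. a u < ennreal s"
      using clock_isCont[OF a t] unfolding isCont_def
      by (auto simp: eventually_at_split dest: order_tendstoD(2))
    moreover have "t < \<top>" using t by simp
    ultimately obtain b where b: "b > t" "\<And>u. t < u \<Longrightarrow> u < b \<Longrightarrow> a u < ennreal s"
      using eventually_at_right[of t \<top>] by auto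
    obtain u where u: "t < u" "u < b" using dense[OF b(1)] by auto
    then have "u < \<infinity>" by (auto simp: less_top[symmetric])
    then have "ennreal s < a u" using path_inv_less_iff[OF a, of u s] eq u by auto
    then show False using b(2)[OF u] by auto
  qed
qed

lemma path_inv_measurable_joint [measurable]:
  assumes [measurable]: "\<And>q. A (ennreal q) \<in> borel_measurable M" "f \<in> borel_measurable M"
  shows "(\<lambda>w. path_inv (\<lambda>t. A t w) (f w)) \<in> borel_measurable M"
  unfolding path_inv_def
  by (intro borel_measurable_INF countable_Collect countable_rat) measurable

lemma path_inv_measurable [measurable]: "path_inv a \<in> borel_measurable borel"
  using path_inv_measurable_joint[of "\<lambda>t _. a t" borel "\<lambda>s. s"] by simp

text \<open>Here \<open>b\<close> is the clock restarted at time \<open>t\<close>: it reaches the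
  level \<open>s\<close> when \<open>a\<close> has grown by \<open>s\<close> beyond
  \<open>a t\<close>. The two sides are compared through their finite strict upper bounds, since
  \<open>path_inv_less_iff\<close> describes exactly those.\<close>

lemma path_inv_shift:
  assumes a: "clock a" and t: "t < \<infinity>" and s: "0 \<le> s"
    and b: "clock b" "\<And>r. r < \<infinity> \<Longrightarrow> a (t + r) = a t + b r"
  shows "path_inv b s + t = path_inv a (s + enn2real (a t))"
proof -
  have at: "a t < \<infinity>" by (rule clock_finite[OF a t])
  have le: "t \<le> path_inv a (s + enn2real (a t))"
    unfolding path_inv_le_iff[OF a t] using at s
    by (metis enn2real_nonneg ennreal_enn2real ennreal_leI infinity_ennreal_def le_add_same_cancel2)
  have lt: "path_inv b s + t < u \<longleftrightarrow> path_inv a (s + enn2real (a t)) < u" if u: "u < \<infinity>" for u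
  proof (cases "t \<le> u")
    case True
    then obtain r where r: "u = t + r" by (metis le_iff_add)
    with u have rf: "r < \<infinity>" by (auto simp: less_top[symmetric])
    have "path_inv b s + t < u \<longleftrightarrow> path_inv b s < r"
      unfolding r using t by (metis add.commute ennreal_add_left_cancel_less infinity_ennreal_def less_irrefl)
    also have "\<dots> \<longleftrightarrow> ennreal s < b r" by (rule path_inv_less_iff[OF b(1) rf])
    also have "\<dots> \<longleftrightarrow> a t + ennreal s < a t + b r"
      using at by (metis ennreal_add_left_cancel_less infinity_ennreal_def less_irrefl)
    also have "\<dots> \<longleftrightarrow> ennreal (s + enn2real (a t)) < a u"
      unfolding r b(2)[OF rf, symmetric] using at s by (simp add: ennreal_plus add.commute)
    also have "\<dots> \<longleftrightarrow> path_inv a (s + enn2real (a t)) < u"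
      using path_inv_less_iff[OF a u] by simp
    finally show ?thesis .
  next
    case False
    then have "\<not> path_inv b s + t < u"
      by (metis add.commute add_increasing2 le_less_trans less_imp_le order.refl zero_le)
    moreover have "\<not> path_inv a (s + enn2real (a t)) < u" using False le by auto
    ultimately show ?thesis by simp
  qed
  show ?thesis
  proof (rule antisym)
    show "path_inv b s + t \<le> path_inv a (s + enn2real (a t))"
    proof (rule ccontr)
      assume "\<not> ?thesis"
      then obtain u where "path_inv a (s + enn2real (a t)) < u" "u < path_inv b s + t"
        using dense by (metis not_le)
      moreover then have "u < \<infinity>" by (auto simp: less_top[symmetric])
      ultimately show False using lt[of u] by auto
    qed
    show "path_inv a (s + enn2real (a t)) \<le> path_inv b s + t"
    proof (rule ccontr)
      assume "\<not> ?thesis"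
      then obtain u where "path_inv b s + t < u" "u < path_inv a (s + enn2real (a t))"
        using dense by (metis not_le)
      moreover then have "u < \<infinity>" by (auto simp: less_top[symmetric])
      ultimately show False using lt[of u] by auto
    qed
  qed
qed

text \<open>The levels below \<open>n\<close> whose inverse is at most \<open>c\<close> form an
  interval from 0 to the truncated value of \<open>a\<close> at \<open>c\<close>, up to an end
  point. So both measures give the same mass to half-open intervals.\<close>

lemma interval_measure_truncated_clock:
  fixes n :: nat
  assumes a: "clock a"
  shows "interval_measure (\<lambda>t. enn2real (min (of_nat n) (a (ennreal t)))) =
    distr (density lborel (indicator {s. 0 \<le> s \<and> s < real n \<and> path_inv a s < \<infinity>})) borel
      (\<lambda>s. enn2real (path_inv a s))" (is "interval_measure ?F = distr (density lborel (indicator ?D)) borel ?f")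
proof -
  have [measurable]: "?D \<in> sets borel" by measurable
  have fin: "min (of_nat n) (a (ennreal t)) < \<top>" for t
    by (simp add: min_less_iff_disj of_nat_less_top)
  have mono: "?F x \<le> ?F y" if "x \<le> y" for x y
    using that fin[of y] clock_mono[OF a, of "ennreal x" "ennreal y"]
    by (intro enn2real_mono) (auto simp: ennreal_leI min_le_iff_disj)
  have cont: "isCont ?F x" for x
  proof -
    have "isCont (\<lambda>t. min (of_nat n) (a (ennreal t))) x"
    proof -
      have "(a \<longlongrightarrow> a (ennreal x)) (nhds (ennreal x))"
        using clock_isCont[OF a, of "ennreal x"] by (simp add: isCont_def tendsto_at_iff_tendsto_nhds)
      moreover have "((\<lambda>t. ennreal t) \<longlongrightarrow> ennreal x) (at x)" by (intro tendsto_intros)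
      ultimately have "((\<lambda>t. a (ennreal t)) \<longlongrightarrow> a (ennreal x)) (at x)"
        by (rule filterlim_compose)
      then show ?thesis unfolding isCont_def by (intro tendsto_min tendsto_const)
    qed
    then show ?thesis unfolding isCont_def using fin[of x] by (intro tendsto_enn2real) auto
  qed
  have F0: "0 \<le> ?F t" for t by simp
  have Fn: "?F t \<le> real n" for t
    using enn2real_mono[OF min.cobounded1[of "of_nat n" "a (ennreal t)"]] by (simp add: of_nat_less_top)
  have Fneg: "?F t = 0" if "t \<le> 0" for t
    using that clock_0[OF a] by (simp add: ennreal_neg min_def)
  \<comment> \<open>\<open>S c\<close> is squeezed between two intervals of the same length, so it
    need not be decided whether the upper end point belongs to it.\<close>
  define S where "S c = {s\<in>?D. ?f s \<le> c}" for c
  have [measurable]: "S c \<in> sets borel" for c unfolding S_def by measurable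
  have S1: "{0..<?F c} \<subseteq> S c" for c
  proof
    fix s assume s: "s \<in> {0..<?F c}"
    then have "0 < ?F c" by auto
    then have c: "0 < c" using Fneg[of c] by (cases "c \<le> 0") auto
    have "ennreal s < a (ennreal c)"
    proof -
      have "ennreal s < ennreal (?F c)" using s by (simp add: ennreal_less_iff)
      also have "\<dots> \<le> a (ennreal c)" using fin[of c] by (simp add: ennreal_enn2real_if)
      finally show ?thesis .
    qed
    then have "path_inv a s < ennreal c" using path_inv_less_iff[OF a, of "ennreal c" s] by simp
    moreover then have "path_inv a s < \<top>" by (auto simp: less_top[symmetric])
    ultimately show "s \<in> S c" using s Fn[of c] c
      by (auto simp: S_def intro!: enn2real_leI)
  qed
  have S2: "S c \<subseteq> {0..?F c}" for c
  proof
    fix s assume s: "s \<in> S c"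
    then have *: "0 \<le> s" "s < real n" "path_inv a s < \<top>" "enn2real (path_inv a s) \<le> c" by (auto simp: S_def)
    then have c: "0 \<le> c" using enn2real_nonneg order_trans by blast
    have le: "path_inv a s \<le> ennreal c" using * c
      by (metis ennreal_enn2real ennreal_leI)
    have "ennreal s \<le> a (ennreal c)"
    proof (cases "path_inv a s = ennreal c")
      case True then show ?thesis using path_inv_eq_imp[OF a _ True] by simp
    next
      case False
      then show ?thesis using le path_inv_less_iff[OF a, of "ennreal c" s] by auto
    qed
    then have "ennreal s \<le> min (of_nat n) (a (ennreal c))"
      using * by (simp add: ennreal_of_nat_eq_real_of_nat ennreal_leI)
    then have "enn2real (ennreal s) \<le> ?F c" using fin by (intro enn2real_mono) auto
    then show "s \<in> {0..?F c}" using * by simp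
  qed
  have emS: "emeasure lborel (S c) = ennreal (?F c)" for c
  proof (rule antisym)
    show "emeasure lborel (S c) \<le> ennreal (?F c)"
      using emeasure_mono[OF S2[of c], of lborel] by simp
    show "ennreal (?F c) \<le> emeasure lborel (S c)"
      using emeasure_mono[OF S1[of c], of lborel] by simp
  qed
  have meas_f: "?f \<in> density lborel (indicator ?D) \<rightarrow>\<^sub>M borel" by measurable
  have eq: "emeasure (interval_measure ?F) {b<..c} = emeasure (distr (density lborel (indicator ?D)) borel ?f) {b<..c}"
    if "b \<le> c" for b c
  proof -
    have "emeasure (distr (density lborel (indicator ?D)) borel ?f) {b<..c} =
        emeasure (density lborel (indicator ?D)) (?f -` {b<..c})"
      using meas_f by (subst emeasure_distr) auto
    also have "\<dots> = emeasure lborel (?D \<inter> ?f -` {b<..c})"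
    proof -
      have "?f \<in> borel \<rightarrow>\<^sub>M borel" by measurable
      then have [measurable]: "?f -` {b<..c} \<in> sets borel" by (rule measurable_sets_borel) simp
      show ?thesis by (auto simp: emeasure_density indicator_inter_arith[symmetric])
    qed
    also have "?D \<inter> ?f -` {b<..c} = S c - S b" by (auto simp: S_def)
    also have "emeasure lborel (S c - S b) = emeasure lborel (S c) - emeasure lborel (S b)"
      using emS \<open>b \<le> c\<close> by (intro emeasure_Diff) (auto simp: S_def)
    also have "\<dots> = ennreal (?F c - ?F b)" by (simp add: emS ennreal_minus)
    also have "\<dots> = emeasure (interval_measure ?F) {b<..c}"
      using mono cont \<open>b \<le> c\<close>
      by (subst emeasure_interval_measure_Ioc) (auto intro: continuous_at_imp_continuous_within)
    finally show ?thesis by simp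
  qed
  show ?thesis
  proof (rule measure_eqI_generator_eq)
    show "Int_stable (range (\<lambda>(b, c::real). {b<..c}))"
      by (auto simp: Int_stable_def image_iff)
    show "range (\<lambda>(b, c::real). {b<..c}) \<subseteq> Pow UNIV" by auto
    show "sets (interval_measure ?F) = sigma_sets UNIV (range (\<lambda>(b, c). {b<..c}))"
      by (simp add: borel_sigma_sets_Ioc)
    show "sets (distr (density lborel (indicator ?D)) borel ?f) = sigma_sets UNIV (range (\<lambda>(b, c). {b<..c}))"
      by (simp add: borel_sigma_sets_Ioc)
    show "emeasure (interval_measure ?F) Z = emeasure (distr (density lborel (indicator ?D)) borel ?f) Z"
      if "Z \<in> range (\<lambda>(b, c). {b<..c})" for Z
    proof -
      from that obtain b c where Z: "Z = {b<..c}" by auto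
      show ?thesis using eq[of b c] unfolding Z by (cases "b \<le> c") auto
    qed
    show "range (\<lambda>n. {-real n<..real n}) \<subseteq> range (\<lambda>(b, c::real). {b<..c})" by auto
    show "(\<Union>n. {-real n<..real n}) = UNIV" by (rule UN_Ioc_eq_UNIV)
    show "emeasure (interval_measure ?F) {-real n<..real n} \<noteq> \<infinity>" for n
      using mono cont by (subst emeasure_interval_measure_Ioc) (auto intro: continuous_at_imp_continuous_within)
  qed
qed

lemma stieltjes_clock:
  assumes a: "clock a"
  shows "stieltjes a = distr (density lborel (indicator {s. 0 \<le> s \<and> path_inv a s < \<infinity>})) borel
      (\<lambda>s. enn2real (path_inv a s))" (is "_ = distr (density lborel (indicator ?D)) borel ?f")
proof -
  define D where "D n = {s. 0 \<le> s \<and> s < real n \<and> path_inv a s < \<infinity>}" for n :: nat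
  have [measurable]: "D n \<in> sets borel" for n unfolding D_def by measurable
  have meas_f: "?f \<in> density lborel g \<rightarrow>\<^sub>M borel" for g by measurable
  have dens: "emeasure (distr (density lborel (indicator E)) borel ?f) B = emeasure lborel (E \<inter> ?f -` B)"
    if "B \<in> sets borel" and [measurable]: "E \<in> sets borel" for B E
  proof -
    have "?f \<in> borel \<rightarrow>\<^sub>M borel" by measurable
    from measurable_sets_borel[OF this that(1)] have [measurable]: "?f -` B \<in> sets borel" .
    show ?thesis
      using that(1) meas_f
      by (subst emeasure_distr) (auto simp: emeasure_density indicator_inter_arith[symmetric])
  qed
  have "(SUP n. emeasure (interval_measure (\<lambda>t. enn2real (min (of_nat n) (a (ennreal t))))) B) =
      emeasure (distr (density lborel (indicator ?D)) borel ?f) B" if B: "B \<in> sets borel" for B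
  proof -
    have "?f \<in> borel \<rightarrow>\<^sub>M borel" by measurable
    from measurable_sets_borel[OF this B] have [measurable]: "?f -` B \<in> sets borel" .
    have "(SUP n. emeasure (interval_measure (\<lambda>t. enn2real (min (of_nat n) (a (ennreal t))))) B) =
        (SUP n. emeasure lborel (D n \<inter> ?f -` B))"
      unfolding interval_measure_truncated_clock[OF a] D_def[symmetric]
      by (intro SUP_cong refl dens B) simp
    also have "\<dots> = emeasure lborel (\<Union>n. D n \<inter> ?f -` B)"
      by (intro SUP_emeasure_incseq) (auto simp: incseq_def D_def)
    also have "(\<Union>n. D n \<inter> ?f -` B) = ?D \<inter> ?f -` B"
      by (auto simp: D_def intro: reals_Archimedean2)
    finally show ?thesis using dens[OF B, of ?D] by simp
  qed
  then have "stieltjes a = measure_of UNIV (sets borel)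
      (emeasure (distr (density lborel (indicator ?D)) borel ?f))"
    unfolding stieltjes_def by (intro measure_of_eq) (auto simp: sets.sigma_sets_eq[of borel, simplified])
  also have "\<dots> = distr (density lborel (indicator ?D)) borel ?f"
    using measure_of_of_measure[of "distr (density lborel (indicator ?D)) borel ?f"] by simp
  finally show ?thesis .
qed

text \<open>Levels that the clock never exceeds have infinite inverse and contribute
  nothing.\<close>

lemma nn_integral_stieltjes_clock:
  assumes a: "clock a" and [measurable]: "h \<in> borel_measurable borel"
  shows "(\<integral>\<^sup>+t\<in>{0..}. h t \<partial>stieltjes a) =
    (\<integral>\<^sup>+s\<in>{0..}. (if path_inv a s < \<infinity> then h (enn2real (path_inv a s)) else 0) \<partial>lborel)"
proof -
  have "(\<integral>\<^sup>+t\<in>{0..}. h t \<partial>stieltjes a) =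
    (\<integral>\<^sup>+s. indicator {s. 0 \<le> s \<and> path_inv a s < \<infinity>} s *
       (h (enn2real (path_inv a s)) * indicator {0..} (enn2real (path_inv a s))) \<partial>lborel)"
    unfolding stieltjes_clock[OF a]
    by (subst nn_integral_distr, simp, simp, subst nn_integral_density) auto
  also have "\<dots> = (\<integral>\<^sup>+s\<in>{0..}. (if path_inv a s < \<infinity> then h (enn2real (path_inv a s)) else 0) \<partial>lborel)"
    by (intro nn_integral_cong) (auto simp: indicator_def)
  finally show ?thesis .
qed

section \<open>The state space with the cemetery, and the augmented filtration\<close>

lemma space_cem_borel [simp]: "space (cem_borel :: 's::topological_space option measure) = UNIV"
  by (simp add: cem_borel_def space_measure_of_conv)

text \<open>Open sets of the compactification have open traces on S, images of open subsets of S are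
  open, and \<open>{None}\<close> is the complement of the open set \<open>Some\<close> +
  \<open>UNIV\<close>. So measurability ignores how neighbourhoods of the cemetery look.\<close>

lemma sets_cem_borel: "sets (cem_borel :: 's::topological_space option measure) = {B. Some -` B \<in> sets borel}"
proof -
  have eq: "sets (cem_borel :: 's option measure) = sigma_sets UNIV {U. openin cem_top U}"
    unfolding cem_borel_def by (rule sets_measure_of) auto
  interpret C: sigma_algebra UNIV "sigma_sets UNIV {U. openin (cem_top :: 's option topology) U}"
    by (rule sigma_algebra_sigma_sets) auto
  have opn: "Some ` U \<in> sigma_sets UNIV {U. openin (cem_top :: 's option topology) U}" if "open U" for U
    using that by (intro sigma_sets.Basic) (simp add: cem_top_def)
  have bor: "Some ` B \<in> sigma_sets UNIV {U. openin (cem_top :: 's option topology) U}"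
    if "B \<in> sets borel" for B
    using that[unfolded sets_borel]
  proof (induction rule: sigma_sets.induct)
    case (Basic U) then show ?case using opn by auto
  next
    case Empty then show ?case by simp
  next
    case (Compl B)
    have "Some ` (UNIV - B) = Some ` UNIV - Some ` B" by auto
    then show ?case using Compl(2) opn[OF open_UNIV] C.Diff by metis
  next
    case (Union F)
    have "Some ` (\<Union>i. F i) = (\<Union>i. Some ` F i)" by auto
    then show ?case using Union(2) by auto
  qed
  show ?thesis unfolding eq
  proof (intro set_eqI iffI CollectI)
    fix B :: "'s option set" assume "B \<in> sigma_sets UNIV {U. openin cem_top U}"
    then show "Some -` B \<in> sets borel"
    proof (induction rule: sigma_sets.induct)
      case (Basic U)
      then consider V where "open V" "U = Some ` V" | C where "closed C" "U = insert None (Some ` (UNIV - C))"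
        by (auto simp: cem_top_def openin_Alexandroff_compactification)
      then have "open (Some -` U)"
      proof cases
        case 1 then show ?thesis by (simp add: inj_vimage_image_eq)
      next
        case 2
        then have "Some -` U = - C" by auto
        then show ?thesis using 2(1) by (metis open_Compl)
      qed
      then show ?case by simp
    next
      case Empty then show ?case by simp
    next
      case (Compl B)
      have "Some -` (UNIV - B) = UNIV - Some -` B" by auto
      then show ?case using Compl(2) by (metis sets.Diff sets.top space_borel)
    next
      case (Union F)
      have "Some -` (\<Union>i. F i) = (\<Union>i. Some -` F i)" by auto
      then show ?case using Union(2) by (metis sets.countable_UN range_subsetD subsetI image_subset_iff)
    qed
  next
    fix B :: "'s option set" assume "B \<in> {B. Some -` B \<in> sets borel}"
    then have *: "Some ` (Some -` B) \<in> sigma_sets UNIV {U. openin cem_top U}" by (intro bor) simp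
    have N: "{None} \<in> sigma_sets UNIV {U. openin (cem_top :: 's option topology) U}"
    proof -
      have "{None} = UNIV - Some ` (UNIV :: 's set)" by (auto, metis option.exhaust rangeI)
      then show ?thesis using opn[OF open_UNIV] C.compl_sets by metis
    qed
    have "B = Some ` (Some -` B) \<union> (if None \<in> B then {None} else {})"
      by (auto simp: image_iff) (metis option.exhaust)+
    also have "\<dots> \<in> sigma_sets UNIV {U. openin cem_top U}"
      using C.Un[OF * N] * by (cases "None \<in> B") (simp_all only: if_True if_False Un_empty_right)
    finally show "B \<in> sigma_sets UNIV {U. openin cem_top U}" .
  qed
qed

lemma measurable_cem_borel_iff:
  fixes f :: "'a \<Rightarrow> 's::topological_space option"
  shows "f \<in> M \<rightarrow>\<^sub>M cem_borel \<longleftrightarrow> (\<forall>U. open U \<longrightarrow> {w\<in>space M. f w \<in> Some ` U} \<in> sets M)"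
proof (intro iffI allI impI)
  fix U :: "'s set" assume f: "f \<in> M \<rightarrow>\<^sub>M cem_borel" and "open U"
  then have "Some ` U \<in> sets cem_borel" by (simp add: sets_cem_borel inj_vimage_image_eq)
  from measurable_sets[OF f this] show "{w\<in>space M. f w \<in> Some ` U} \<in> sets M"
    by (simp add: vimage_def Int_def conj_commute)
next
  assume *: "\<forall>U. open U \<longrightarrow> {w\<in>space M. f w \<in> Some ` U} \<in> sets M"
  have **: "{w\<in>space M. f w \<in> Some ` B} \<in> sets M" if "B \<in> sets borel" for B
    using that[unfolded sets_borel]
  proof (induction rule: sigma_sets.induct)
    case (Basic U) then show ?case using * by auto
  next
    case Empty then show ?case by simp
  next
    case (Compl B)
    have "{w\<in>space M. f w \<in> Some ` (UNIV - B)} =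
        {w\<in>space M. f w \<in> Some ` UNIV} - {w\<in>space M. f w \<in> Some ` B}" by auto
    then show ?case using Compl(2) * by auto
  next
    case (Union F)
    have "{w\<in>space M. f w \<in> Some ` (\<Union>i. F i)} = (\<Union>i. {w\<in>space M. f w \<in> Some ` F i})" by auto
    then show ?case using Union(2) by auto
  qed
  show "f \<in> M \<rightarrow>\<^sub>M cem_borel"
  proof (rule measurableI)
    fix B :: "'s option set" assume "B \<in> sets cem_borel"
    then have 1: "{w\<in>space M. f w \<in> Some ` (Some -` B)} \<in> sets M"
      by (intro **) (simp add: sets_cem_borel)
    have 2: "space M - {w\<in>space M. f w \<in> Some ` UNIV} \<in> sets M" using * by auto
    have "f -` B \<inter> space M = {w\<in>space M. f w \<in> Some ` (Some -` B)} \<union>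
        (if None \<in> B then space M - {w\<in>space M. f w \<in> Some ` UNIV} else {})"
      by (auto simp: image_iff) (metis option.exhaust)+
    with 1 2 show "f -` B \<inter> space M \<in> sets M" by auto
  qed simp
qed

text \<open>The theorem on pointwise limits of measurable maps into a metric space, adapted to the
  cemetery: convergence is demanded only towards points of S, and where the limit is the cemetery
  the approximations must already be there.\<close>

lemma measurable_cem_limit:
  fixes g :: "'a \<Rightarrow> 's::metric_space option" and f :: "nat \<Rightarrow> 'a \<Rightarrow> 's option"
  assumes f: "\<And>k. f k \<in> M \<rightarrow>\<^sub>M cem_borel"
    and None: "\<And>z k. z \<in> space M \<Longrightarrow> g z = None \<Longrightarrow> f k z = None"
    and Some: "\<And>z x W. z \<in> space M \<Longrightarrow> g z = Some x \<Longrightarrow> open W \<Longrightarrow> x \<in> W \<Longrightarrow>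
        \<forall>\<^sub>F k in sequentially. f k z \<in> Some ` W"
  shows "g \<in> M \<rightarrow>\<^sub>M cem_borel"
  unfolding measurable_cem_borel_iff
proof (intro allI impI)
  fix U :: "'s set" assume U: "open U"
  show "{z \<in> space M. g z \<in> Some ` U} \<in> sets M"
  \<comment> \<open>\<open>infdist x {}\<close> is 0, so for \<open>U = UNIV\<close> the exhausting
    sets \<open>W j\<close> of the other case would all be empty.\<close>
  proof (cases "U = UNIV")
    case True
    have "g z \<in> Some ` UNIV \<longleftrightarrow> (\<exists>k. f k z \<in> Some ` UNIV)" if z: "z \<in> space M" for z
      using None[OF z] Some[OF z _ open_UNIV] eventually_happens[of _ sequentially]
      by (cases "g z") fastforce+
    then have "{z \<in> space M. g z \<in> Some ` U} = (\<Union>k. {z \<in> space M. f k z \<in> Some ` U})"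
      unfolding True by blast
    also have "\<dots> \<in> sets M" using f U unfolding measurable_cem_borel_iff by blast
    finally show ?thesis .
  next
    case False
    define W where "W j = {x. 1 / real (Suc j) < infdist x (- U)}" for j
    have W: "open (W j)" for j
      unfolding W_def by (intro open_Collect_less continuous_intros)
    have cU: "closed (- U)" "- U \<noteq> {}" using U False by auto
    have WU: "W j \<subseteq> U" for j
      using in_closed_iff_infdist_zero[OF cU] by (auto simp: W_def) (smt (verit) ComplI divide_nonneg_nonneg of_nat_0_le_iff)
    have "g z \<in> Some ` U \<longleftrightarrow> (\<exists>j N. \<forall>k\<ge>N. f k z \<in> Some ` W j)" if z: "z \<in> space M" for z
    proof
      assume "g z \<in> Some ` U"
      then obtain x where x: "g z = Some x" "x \<in> U" by auto
      then have "0 < infdist x (- U)"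
        using in_closed_iff_infdist_zero[OF cU] infdist_nonneg[of x "- U"] by (auto simp: less_le)
      then obtain j where "x \<in> W j" unfolding W_def using nat_approx_posE by blast
      from Some[OF z x(1) W this] show "\<exists>j N. \<forall>k\<ge>N. f k z \<in> Some ` W j"
        unfolding eventually_sequentially by auto
    next
      assume "\<exists>j N. \<forall>k\<ge>N. f k z \<in> Some ` W j"
      then obtain j N where jN: "\<And>k. k \<ge> N \<Longrightarrow> f k z \<in> Some ` W j" by auto
      then obtain x where x: "g z = Some x" using None[OF z] by (cases "g z") force+
      have "x \<in> U"
      proof (rule ccontr)
        assume "x \<notin> U"
        then have "x \<in> {y. infdist y (- U) < 1 / real (Suc j)}"
          using in_closed_iff_infdist_zero[OF cU] by simp
        moreover have "open {y. infdist y (- U) < 1 / real (Suc j)}"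
          by (intro open_Collect_less continuous_intros)
        ultimately have "\<forall>\<^sub>F k in sequentially. f k z \<in> Some ` {y. infdist y (- U) < 1 / real (Suc j)}"
          using Some[OF z x, of "{y. infdist y (- U) < 1 / real (Suc j)}"] by simp
        then obtain k where "k \<ge> N" "f k z \<in> Some ` {y. infdist y (- U) < 1 / real (Suc j)}"
          unfolding eventually_sequentially by (metis nle_le)
        with jN[of k] show False by (auto simp: W_def)
      qed
      with x show "g z \<in> Some ` U" by simp
    qed
    then have "{z \<in> space M. g z \<in> Some ` U} = {z \<in> space M. \<exists>j N. \<forall>k\<ge>N. f k z \<in> Some ` W j}"
      by (simp cong: conj_cong)
    also have "\<dots> = (\<Union>j. \<Union>N. \<Inter>k\<in>{N..}. {z \<in> space M. f k z \<in> Some ` W j})" by auto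
    also have "\<dots> \<in> sets M"
    proof -
      have "{z \<in> space M. f k z \<in> Some ` W j} \<in> sets M" for k j
        using f W unfolding measurable_cem_borel_iff by blast
      then show ?thesis by (intro sets.countable_UN sets.countable_INT' image_subsetI) auto
    qed
    finally show ?thesis .
  qed
qed

lemma ennreal_rat_between_bex:
  fixes T t :: ennreal
  assumes "T < t"
  shows "\<exists>q\<in>{q\<in>\<rat>. 0 \<le> q}. T < ennreal q \<and> ennreal q < t"
  using ennreal_rat_between[OF assms] by blast

lemma sigma_sets_INT_sigma_algebras:
  assumes "\<And>i. i \<in> I \<Longrightarrow> sigma_algebra \<Omega> (F i)" "I \<noteq> {}"
  shows "sigma_sets \<Omega> (\<Inter>i\<in>I. F i) = (\<Inter>i\<in>I. F i)"
proof (intro equalityI INT_greatest)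
  fix i assume i: "i \<in> I"
  interpret sigma_algebra \<Omega> "F i" by (rule assms(1)[OF i])
  show "sigma_sets \<Omega> (\<Inter>i\<in>I. F i) \<subseteq> F i" using i by (intro sigma_sets_subset) auto
qed auto

section \<open>Paths, filtrations and stopping times of a standard process\<close>

locale standard_markov =
  fixes X :: "('w, 's::{metric_space, second_countable_topology}) process"
  assumes std: "standard_process X"
begin

abbreviation "\<Omega> \<equiv> space (pr_space X)"

abbreviation "P z \<equiv> pr_law X z"

abbreviation "PC z \<equiv> completion (pr_law X z)"

abbreviation "stopping T \<equiv> stopping_time (aug_filt X) T"

abbreviation alive :: "('w \<Rightarrow> ennreal) \<Rightarrow> 'w \<Rightarrow> ennreal" where
  "alive T w \<equiv> indicator {w\<in>space (pr_space X). T w < \<infinity>} w"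

abbreviation restart :: "('w \<Rightarrow> ennreal) \<Rightarrow> ('w \<Rightarrow> ennreal) \<Rightarrow> 'w \<Rightarrow> ennreal" where
  "restart F T w \<equiv> (\<integral>\<^sup>+w'. F w' \<partial>pr_law X (pr_at X (T w) w))"

abbreviation "path_dist T A B w \<equiv> sup_diff T (\<lambda>t. A t w) (\<lambda>t. B t w)"

lemma prob_space_law: "prob_space (P z)"
  and sets_law: "sets (P z) = sets (pr_space X)"
  using std by (auto simp: standard_process_def)

lemma space_law [simp]: "space (P z) = \<Omega>"
  using sets_law by (rule sets_eq_imp_space_eq)

lemma prob_space_completion_law: "prob_space (PC z)"
  using prob_space_law by (rule prob_space.prob_space_completion)

lemma measurable_at: "pr_at X t \<in> pr_space X \<rightarrow>\<^sub>M cem_borel"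
  using std by (auto simp: standard_process_def)

lemma AE_at_0: "AE w in P z. pr_at X 0 w = z"
  using std by (auto simp: standard_process_def)

lemma at_infinity: "w \<in> \<Omega> \<Longrightarrow> pr_at X \<infinity> w = None"
  using std by (auto simp: standard_process_def)

lemma shift_space: "w \<in> \<Omega> \<Longrightarrow> pr_shift X t w \<in> \<Omega>"
  and at_shift: "w \<in> \<Omega> \<Longrightarrow> pr_at X s (pr_shift X t w) = pr_at X (s + t) w"
  using std by (auto simp: standard_process_def)

lemma cemetery_absorbing:
  assumes "w \<in> \<Omega>" "pr_at X s w = None" "s \<le> t"
  shows "pr_at X t w = None"
proof -
  have "lifetime X w \<le> t" unfolding lifetime_def using assms by (intro Inf_lower2[of s]) auto
  then show ?thesis using std assms by (auto simp: standard_process_def)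
qed

lemma at_right_continuous:
  assumes "w \<in> \<Omega>" "t < \<infinity>" "pr_at X t w = Some x" "open W" "x \<in> W"
  shows "\<forall>\<^sub>F s in at_right t. pr_at X s w \<in> Some ` W"
proof -
  have "limitin cem_top (\<lambda>s. pr_at X s w) (pr_at X t w) (at_right t)"
    using std assms(1,2) unfolding standard_process_def by blast
  moreover have "openin cem_top (Some ` W)" using assms by (simp add: cem_top_def)
  ultimately show ?thesis using assms by (auto simp: limitin_def)
qed

lemma sets_raw_filt: "sets (raw_filt X t) = sigma_sets \<Omega>
     {pr_at X s -` B \<inter> \<Omega> |s B. s \<le> t \<and> B \<in> sets cem_borel}"
  and space_raw_filt [simp]: "space (raw_filt X t) = \<Omega>"
  unfolding raw_filt_def by (auto intro!: sets_measure_of space_measure_of)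

lemma raw_filt_mono: "s \<le> t \<Longrightarrow> sets (raw_filt X s) \<subseteq> sets (raw_filt X t)"
  unfolding sets_raw_filt by (intro sigma_sets_subseteq) (auto intro: order_trans)

lemma raw_filt_le: "sets (raw_filt X t) \<subseteq> sets (pr_space X)"
  unfolding sets_raw_filt using measurable_sets[OF measurable_at]
  by (intro sets.sigma_sets_subset) auto

lemma measurable_at_raw: "s \<le> t \<Longrightarrow> pr_at X s \<in> raw_filt X t \<rightarrow>\<^sub>M cem_borel"
  by (intro measurableI) (auto simp: sets_raw_filt)

lemma return_init_dist: "return cem_borel z \<in> init_dists"
  by (auto simp: init_dists_def intro: prob_space_return)

lemma sigma_algebra_aug: "sigma_algebra \<Omega> (sigma_sets \<Omega> (sets (raw_filt X t) \<union> init_null X \<nu>))"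
  using sets.space_closed[of "raw_filt X t"]
  by (intro sigma_algebra_sigma_sets) (auto simp: init_null_def)

lemma sets_aug_filt: "sets (aug_filt X t) =
   (\<Inter>\<nu>\<in>init_dists. sigma_sets \<Omega> (sets (raw_filt X t) \<union> init_null X \<nu>))" (is "_ = ?S")
  and space_aug_filt [simp]: "space (aug_filt X t) = \<Omega>"
proof -
  have ne: "(init_dists :: 's option measure set) \<noteq> {}" using return_init_dist by auto
  then obtain \<nu> :: "'s option measure" where \<nu>: "\<nu> \<in> init_dists" by auto
  have "sigma_sets \<Omega> (sets (raw_filt X t) \<union> init_null X \<nu>) \<subseteq> Pow \<Omega>"
    using sigma_algebra_aug[of t \<nu>] unfolding sigma_algebra_iff2 by (elim conjE)
  with \<nu> have sub: "?S \<subseteq> Pow \<Omega>" by (rule INF_lower2)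
  show "sets (aug_filt X t) = ?S"
    unfolding aug_filt_def using sub ne
    by (subst sets_measure_of) (auto intro!: sigma_sets_INT_sigma_algebras sigma_algebra_aug)
  show "space (aug_filt X t) = \<Omega>"
    unfolding aug_filt_def using sub by (rule space_measure_of)
qed

lemma aug_filt_mono: "s \<le> t \<Longrightarrow> sets (aug_filt X s) \<subseteq> sets (aug_filt X t)"
  unfolding sets_aug_filt using raw_filt_mono
  by (intro INF_mono) (meson Un_mono order_refl sigma_sets_subseteq)

sublocale filtration \<Omega> "aug_filt X"
  by standard (auto intro: aug_filt_mono[THEN subsetD])

lemma raw_le_aug: "sets (raw_filt X t) \<subseteq> sets (aug_filt X t)"
  unfolding sets_aug_filt by auto

text \<open>The point mass at \<open>z\<close> is one of the initial distributions over which the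
  augmentation intersects.\<close>

lemma aug_le_completion: "sets (aug_filt X t) \<subseteq> sets (PC z)"
proof
  fix S assume "S \<in> sets (aug_filt X t)"
  then have "S \<in> sigma_sets \<Omega> (sets (raw_filt X t) \<union> init_null X (return cem_borel z))"
    using return_init_dist unfolding sets_aug_filt by auto
  also have "\<dots> \<subseteq> sets (PC z)"
  proof -
    have "init_null X (return cem_borel z) \<subseteq> sets (PC z)"
    proof
      fix N assume "N \<in> init_null X (return cem_borel z)"
      then obtain B where B: "B \<in> sets (raw_filt X \<infinity>)" "N \<subseteq> B"
          "(\<integral>\<^sup>+x. emeasure (P x) B \<partial>return cem_borel z) = 0"
        by (auto simp: init_null_def)
      \<comment> \<open>Inserting the indicator of the measurable set \<open>{z}\<close> bounds the
        integral against the point mass from below without measurability of the integrand.\<close>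
      have z: "{z} \<in> sets cem_borel" by (cases z) (auto simp: sets_cem_borel vimage_def)
      have "emeasure (P z) B = (\<integral>\<^sup>+x. emeasure (P z) B * indicator {z} x \<partial>return cem_borel z)"
        using z by (subst nn_integral_cmult_indicator) auto
      also have "\<dots> \<le> (\<integral>\<^sup>+x. emeasure (P x) B \<partial>return cem_borel z)"
        by (intro nn_integral_mono) (auto simp: indicator_def)
      finally have "B \<in> null_sets (P z)"
        using B raw_filt_le by (intro null_setsI) (auto simp: sets_law)
      then show "N \<in> sets (PC z)" using B(2) by (rule sets_completionI_sub)
    qed
    moreover have "sets (raw_filt X t) \<subseteq> sets (PC z)"
      using raw_filt_le sets_law by (auto intro!: sets_completionI_sets)
    ultimately show ?thesis
      using sets.sigma_sets_subset[of _ "PC z"] by auto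
  qed
  finally show "S \<in> sets (PC z)" .
qed

lemma pre_sigma_le_aug: "stopping T \<Longrightarrow> sets (pre_sigma T) \<subseteq> sets (aug_filt X \<infinity>)"
proof
  fix A assume T: "stopping T" and A: "A \<in> sets (pre_sigma T)"
  have "{w\<in>A. T w \<le> \<infinity>} \<in> sets (aug_filt X \<infinity>)" using sets_pre_sigmaD[OF T A] .
  then show "A \<in> sets (aug_filt X \<infinity>)" by simp
qed

lemma measurable_aug_completion: "f \<in> aug_filt X t \<rightarrow>\<^sub>M N \<Longrightarrow> f \<in> PC z \<rightarrow>\<^sub>M N"
  using measurable_mono[of N N "aug_filt X t" "PC z"] aug_le_completion by auto

lemma measurable_aug_mono: "s \<le> t \<Longrightarrow> f \<in> aug_filt X s \<rightarrow>\<^sub>M N \<Longrightarrow> f \<in> aug_filt X t \<rightarrow>\<^sub>M N"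
  using measurable_mono[of N N "aug_filt X s" "aug_filt X t"] aug_filt_mono by auto

lemma measurable_raw_aug: "f \<in> raw_filt X t \<rightarrow>\<^sub>M N \<Longrightarrow> f \<in> aug_filt X t \<rightarrow>\<^sub>M N"
  using measurable_mono[of N N "raw_filt X t" "aug_filt X t"] raw_le_aug by auto

lemma measurable_at_aug: "s \<le> t \<Longrightarrow> pr_at X s \<in> aug_filt X t \<rightarrow>\<^sub>M cem_borel"
  by (intro measurable_raw_aug measurable_at_raw)

lemma measurable_pre_sigma_aug:
  "stopping T \<Longrightarrow> f \<in> pre_sigma T \<rightarrow>\<^sub>M N \<Longrightarrow> f \<in> aug_filt X \<infinity> \<rightarrow>\<^sub>M N"
  using measurable_mono[of N N "pre_sigma T" "aug_filt X \<infinity>"] pre_sigma_le_aug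
  by (auto simp: space_pre_sigma)

text \<open>\<open>T w \<le> t\<close> means \<open>T w < q\<close> for all rationals q in any
  interval (t, s), hence lies in the past of every s > t. Right-continuity of the filtration, a part
  of \<open>strong_markov\<close>, concludes.\<close>

lemma stopping_time_rightI:
  assumes "\<And>t. t < \<infinity> \<Longrightarrow> Measurable.pred (aug_filt X t) (\<lambda>w. T w < t)"
  shows "stopping T"
proof (rule stopping_timeI)
  fix t :: ennreal
  show "Measurable.pred (aug_filt X t) (\<lambda>w. T w \<le> t)"
  proof (cases "t < \<infinity>")
    case False
    then have "t = \<infinity>" by (simp add: less_top[symmetric])
    then show ?thesis by simp
  next
    case True
    have "{w\<in>\<Omega>. T w \<le> t} \<in> sets (aug_filt X s)" if s: "t < s" for s
    proof -
      let ?I = "{q\<in>\<rat>. 0 \<le> q \<and> t < ennreal q \<and> ennreal q < s}"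
      have "T w \<le> t \<longleftrightarrow> (\<forall>q\<in>?I. T w < ennreal q)" for w
      proof
        assume *: "\<forall>q\<in>?I. T w < ennreal q"
        show "T w \<le> t"
        proof (rule ccontr)
          assume "\<not> T w \<le> t"
          then have "t < min (T w) s" using s by auto
          from ennreal_rat_between_bex[OF this] * show False by auto
        qed
      qed (use order.strict_trans1 in blast)
      moreover have "Measurable.pred (aug_filt X s) (\<lambda>w. \<forall>q\<in>?I. T w < ennreal q)"
      proof (rule measurable_pred_countable)
        show "countable ?I" using countable_rat by (rule countable_subset[rotated]) auto
        show "Measurable.pred (aug_filt X s) (\<lambda>w. T w < ennreal q)" if "q \<in> ?I" for q
          using that by (intro measurable_aug_mono[OF _ assms]) auto
      qed
      ultimately show ?thesis by (simp add: pred_def)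
    qed
    then have "{w\<in>\<Omega>. T w \<le> t} \<in> (\<Inter>s\<in>{t<..}. sets (aug_filt X s))" by auto
    also have "\<dots> = sets (aug_filt X t)"
      using std True by (auto simp: standard_process_def strong_markov_def)
    finally show ?thesis by (simp add: pred_def)
  qed
qed

text \<open>
  The time is approximated from the right by countably many values, capped at \<open>t\<close>; with a
  stopping time capped at \<open>t\<close> this is progressive measurability.
\<close>

lemma measurable_at_random_time:
  assumes T [measurable]: "T \<in> borel_measurable M" and Tt: "\<And>z. z \<in> space M \<Longrightarrow> T z \<le> t"
    and \<pi>: "\<And>z. z \<in> space M \<Longrightarrow> \<pi> z \<in> \<Omega>"
    and at: "\<And>s. s \<le> t \<Longrightarrow> (\<lambda>z. pr_at X s (\<pi> z)) \<in> M \<rightarrow>\<^sub>M cem_borel"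
  shows "(\<lambda>z. pr_at X (T z) (\<pi> z)) \<in> M \<rightarrow>\<^sub>M cem_borel"
proof (rule measurable_cem_limit)
  define D where "D k i = min t (ennreal ((real i + 1) / (real k + 1)))" for k i :: nat
  define n where "n k z = nat \<lfloor>enn2real (T z) * (real k + 1)\<rfloor>" for k :: nat and z
  define f where "f k z = (if T z < \<infinity> then pr_at X (D k (n k z)) (\<pi> z) else None)" for k z
  have [measurable]: "n k \<in> M \<rightarrow>\<^sub>M count_space UNIV" for k unfolding n_def by measurable
  have "(\<lambda>z. pr_at X (D k (n k z)) (\<pi> z)) \<in> M \<rightarrow>\<^sub>M cem_borel" for k
    by (rule measurable_compose_countable'[where f="\<lambda>i z. pr_at X (D k i) (\<pi> z)" and I=UNIV])
       (auto intro!: at simp: D_def)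
  then show "f k \<in> M \<rightarrow>\<^sub>M cem_borel" for k unfolding f_def by (intro measurable_If) auto
  have bounds: "T z < ennreal ((real (n k z) + 1) / (real k + 1))"
     "ennreal ((real (n k z) + 1) / (real k + 1)) \<le> T z + ennreal (1 / (real k + 1))"
    if "T z < \<infinity>" for k z
  proof -
    obtain r where r: "T z = ennreal r" "0 \<le> r" using \<open>T z < \<infinity>\<close> by (cases "T z") auto
    have n: "real (n k z) \<le> r * (real k + 1)" "r * (real k + 1) < real (n k z) + 1"
      using r(2) by (auto simp: n_def r(1) of_nat_nat)
    show "T z < ennreal ((real (n k z) + 1) / (real k + 1))"
      using n r by (simp add: ennreal_less_iff field_simps)
    have "(real (n k z) + 1) / (real k + 1) \<le> r + 1 / (real k + 1)"
    proof -
      have "real (n k z) / (real k + 1) \<le> r" using n(1) by (simp add: divide_le_eq)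
      then show ?thesis by (simp add: add_divide_distrib)
    qed
    then show "ennreal ((real (n k z) + 1) / (real k + 1)) \<le> T z + ennreal (1 / (real k + 1))"
      using r by (metis ennreal_leI ennreal_plus of_nat_0_le_iff add_nonneg_nonneg divide_nonneg_nonneg zero_le_one)
  qed
  have le: "T z \<le> D k (n k z)" if "T z < \<infinity>" "z \<in> space M" for k z
    using bounds(1)[OF that(1), of k] Tt[OF that(2)] by (auto simp: D_def)
  fix z assume z: "z \<in> space M"
  show "f k z = None" if "pr_at X (T z) (\<pi> z) = None" for k
    using cemetery_absorbing[OF \<pi>[OF z] that] le[OF _ z] by (auto simp: f_def)
  fix x W assume x: "pr_at X (T z) (\<pi> z) = Some x" and W: "open W" "x \<in> W"
  then have fin: "T z < \<infinity>" using at_infinity[OF \<pi>[OF z]] by (auto simp: less_top[symmetric])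
  show "\<forall>\<^sub>F k in sequentially. f k z \<in> Some ` W"
  \<comment> \<open>Right-continuity needs approximation by strictly larger times. The cap rules
    this out only if \<open>T z = t\<close>, and then the approximation is exact.\<close>
  proof (cases "T z = t")
    case True
    then have "D k (n k z) = T z" for k using bounds(1)[OF fin, of k] by (auto simp: D_def min_def)
    then show ?thesis using x W fin by (auto simp: f_def)
  next
    case False
    then have lt: "T z < t" using Tt[OF z] by auto
    have "((\<lambda>k. T z + ennreal (1 / (real k + 1))) \<longlongrightarrow> T z + ennreal 0) sequentially"
      by (intro tendsto_intros) real_asymp
    then have 1: "((\<lambda>k. T z + ennreal (1 / (real k + 1))) \<longlongrightarrow> T z) sequentially" by simp
    have "((\<lambda>k. D k (n k z)) \<longlongrightarrow> T z) sequentially"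
      by (rule tendsto_sandwich[OF _ _ tendsto_const 1])
         (use le[OF fin z] bounds(2)[OF fin] in \<open>auto simp: D_def min_le_iff_disj\<close>)
    moreover have "\<forall>\<^sub>F k in sequentially. D k (n k z) \<in> {T z<..} \<and> D k (n k z) \<noteq> T z"
    proof (rule always_eventually, rule allI)
      fix k
      have "T z < D k (n k z)" using bounds(1)[OF fin, of k] lt by (auto simp: D_def)
      then show "D k (n k z) \<in> {T z<..} \<and> D k (n k z) \<noteq> T z" by auto
    qed
    ultimately have "filterlim (\<lambda>k. D k (n k z)) (at_right (T z)) sequentially"
      by (auto simp: filterlim_at)
    from filterlim_iff[THEN iffD1, OF this, rule_format, OF at_right_continuous[OF \<pi>[OF z] fin x W]]
    show ?thesis using fin by (simp add: f_def)
  qed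
qed

text \<open>On the event \<open>T w \<le> t\<close> the position at \<open>T w\<close> is the one at
  \<open>min (T w) t\<close>, which depends only on the past of \<open>t\<close>.\<close>

lemma measurable_at_stopping_time:
  assumes T: "stopping T"
  shows "(\<lambda>w. pr_at X (T w) w) \<in> pre_sigma T \<rightarrow>\<^sub>M cem_borel"
  unfolding measurable_cem_borel_iff
proof (intro allI impI sets_pre_sigmaI[OF T])
  fix U :: "'s set" and t assume U: "open U"
  have mt: "(\<lambda>w. min (T w) t) \<in> borel_measurable (aug_filt X t)"
  proof (rule borel_measurableI_le)
    fix y :: ennreal
    show "{w \<in> space (aug_filt X t). min (T w) t \<le> y} \<in> sets (aug_filt X t)"
    proof (cases "t \<le> y")
      case True
      then have "{w \<in> space (aug_filt X t). min (T w) t \<le> y} = space (aug_filt X t)"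
        by (auto simp: min_le_iff_disj)
      then show ?thesis by (metis sets.top)
    next
      case False
      then show ?thesis using stopping_time_le_const[OF T, of y t] by (auto simp: min_le_iff_disj pred_def)
    qed
  qed
  have "(\<lambda>w. pr_at X (min (T w) t) w) \<in> aug_filt X t \<rightarrow>\<^sub>M cem_borel"
    by (rule measurable_at_random_time[OF mt, of t]) (auto intro: measurable_at_aug)
  then have "{w\<in>\<Omega>. pr_at X (min (T w) t) w \<in> Some ` U} \<in> sets (aug_filt X t)"
    using U by (auto simp: measurable_cem_borel_iff)
  moreover have "{w\<in>\<Omega>. T w \<le> t} \<in> sets (aug_filt X t)"
    using stopping_timeD[OF T, of t] by (simp add: pred_def)
  ultimately have "{w\<in>\<Omega>. pr_at X (min (T w) t) w \<in> Some ` U} \<inter> {w\<in>\<Omega>. T w \<le> t} \<in> sets (aug_filt X t)"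
    by (rule sets.Int)
  moreover have "{w\<in>\<Omega>. pr_at X (min (T w) t) w \<in> Some ` U} \<inter> {w\<in>\<Omega>. T w \<le> t} =
      {w \<in> {w \<in> space (pre_sigma T). pr_at X (T w) w \<in> Some ` U}. T w \<le> t}"
    by (auto simp: space_pre_sigma min_def)
  ultimately show "{w \<in> {w \<in> space (pre_sigma T). pr_at X (T w) w \<in> Some ` U}. T w \<le> t} \<in> sets (aug_filt X t)" by simp
qed

end

section \<open>The strong Markov property for path functionals\<close>

text \<open>Passes from an identity of measures to one of integrals. The weight \<open>u\<close>
  will be the indicator of an event known at a stopping time; the lemma is applied once to a later
  position and once to the shifted path.\<close>

lemma nn_integral_density_kernel_eq:
  assumes u: "u \<in> borel_measurable M" and f: "f \<in> M \<rightarrow>\<^sub>M N" and g: "g \<in> M \<rightarrow>\<^sub>M K"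
    and k: "k \<in> K \<rightarrow>\<^sub>M subprob_algebra N"
    and eq: "distr (density M u) N f = distr (density M u) K g \<bind> k"
    and h: "h \<in> borel_measurable N"
  shows "(\<integral>\<^sup>+w. h (f w) * u w \<partial>M) = (\<integral>\<^sup>+w. (\<integral>\<^sup>+y. h y \<partial>k (g w)) * u w \<partial>M)"
proof -
  have k': "(\<lambda>z. \<integral>\<^sup>+y. h y \<partial>k z) \<in> borel_measurable K"
    using measurable_compose[OF k nn_integral_measurable_subprob_algebra[OF h]] .
  have "(\<integral>\<^sup>+w. h (f w) * u w \<partial>M) = (\<integral>\<^sup>+y. h y \<partial>distr (density M u) N f)"
    using u f h by (subst nn_integral_distr) (auto simp: nn_integral_density mult.commute)
  also have "\<dots> = (\<integral>\<^sup>+z. \<integral>\<^sup>+y. h y \<partial>k z \<partial>distr (density M u) K g)"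
    unfolding eq using k by (intro nn_integral_bind[OF h]) simp
  also have "\<dots> = (\<integral>\<^sup>+w. (\<integral>\<^sup>+y. h y \<partial>k (g w)) * u w \<partial>M)"
    using u g k' by (subst nn_integral_distr) (auto simp: nn_integral_density mult.commute)
  finally show ?thesis .
qed

lemma emeasure_distr_density_indicator:
  assumes f: "f \<in> M \<rightarrow>\<^sub>M N" and S: "S \<in> sets M" and B: "B \<in> sets N"
  shows "emeasure (distr (density M (indicator S)) N f) B = emeasure M {w\<in>S. f w \<in> B}"
proof -
  have m: "f -` B \<inter> space M \<in> sets M" using measurable_sets[OF f B] .
  have "emeasure (distr (density M (indicator S)) N f) B = emeasure (density M (indicator S)) (f -` B \<inter> space M)"
    using f B by (subst emeasure_distr) auto
  also have "\<dots> = emeasure M (S \<inter> (f -` B \<inter> space M))"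
    using S m by (subst emeasure_density) (simp_all add: indicator_inter_arith[symmetric] del: indicator_simps)
  also have "S \<inter> (f -` B \<inter> space M) = {w\<in>S. f w \<in> B}"
    using sets.sets_into_space[OF S] by auto
  finally show ?thesis .
qed

lemma emeasure_bind_distr_density_indicator:
  assumes g: "g \<in> M \<rightarrow>\<^sub>M K" and S: "S \<in> sets M" and k: "k \<in> K \<rightarrow>\<^sub>M subprob_algebra N"
    and B: "B \<in> sets N" and ne: "space M \<noteq> {}"
  shows "emeasure (distr (density M (indicator S)) K g \<bind> k) B =
    (\<integral>\<^sup>+w. emeasure (k (g w)) B * indicator S w \<partial>M)"
proof -
  have k': "(\<lambda>z. emeasure (k z) B) \<in> borel_measurable K"
    using k B by (intro measurable_emeasure_kernel)
  have "space K \<noteq> {}" using ne g by (auto simp: measurable_def)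
  then have "emeasure (distr (density M (indicator S)) K g \<bind> k) B =
      (\<integral>\<^sup>+z. emeasure (k z) B \<partial>distr (density M (indicator S)) K g)"
    using k B by (intro emeasure_bind[where N=N]) auto
  also have "\<dots> = (\<integral>\<^sup>+w. emeasure (k (g w)) B * indicator S w \<partial>M)"
    using g k' S by (subst nn_integral_distr) (auto simp: nn_integral_density mult.commute)
  finally show ?thesis .
qed

lemma sets_completion_cong_AE:
  assumes A: "A \<in> sets (completion M)" and B: "B \<subseteq> space M" and eq: "AE x in M. x \<in> A \<longleftrightarrow> x \<in> B"
  shows "B \<in> sets (completion M)"
proof -
  obtain N where N: "N \<in> null_sets M" "{x\<in>space M. \<not> (x \<in> A \<longleftrightarrow> x \<in> B)} \<subseteq> N"
    using eq unfolding eventually_ae_filter by auto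
  have "A \<subseteq> space M" using sets.sets_into_space[OF A] by simp
  then have B_eq: "B = (A - {x\<in>space M. x \<in> A \<and> x \<notin> B}) \<union> {x\<in>space M. x \<notin> A \<and> x \<in> B}" using B by auto
  moreover have "{x\<in>space M. x \<in> A \<and> x \<notin> B} \<in> sets (completion M)"
    using N by (intro sets_completionI_sub[OF N(1)]) auto
  moreover have "{x\<in>space M. x \<notin> A \<and> x \<in> B} \<in> sets (completion M)"
    using N by (intro sets_completionI_sub[OF N(1)]) auto
  ultimately show ?thesis using A by (subst B_eq) (intro sets.Un sets.Diff)
qed

lemma measurable_completion_AE:
  assumes f: "f \<in> completion M \<rightarrow>\<^sub>M borel" and eq: "AE x in completion M. f x = g x"
  shows "g \<in> completion M \<rightarrow>\<^sub>M borel"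
proof (rule measurableI)
  fix A :: "'b set" assume A: "A \<in> sets borel"
  have "f -` A \<inter> space M \<in> sets (completion M)" using measurable_sets[OF f A] by simp
  moreover have "AE x in M. x \<in> f -` A \<inter> space M \<longleftrightarrow> x \<in> g -` A \<inter> space M"
    using eq unfolding AE_completion_iff by eventually_elim auto
  ultimately show "g -` A \<inter> space (completion M) \<in> sets (completion M)"
    using sets_completion_cong_AE[of "f -` A \<inter> space M" M "g -` A \<inter> space M"] by auto
qed simp

context standard_markov
begin

lemma sample_space_nonempty: "\<Omega> \<noteq> {}"
  using prob_space.not_empty[OF prob_space_law] by auto

lemma measurable_at_completion:
  assumes "S \<in> borel_measurable (PC z)"
  shows "(\<lambda>w. pr_at X (S w) w) \<in> PC z \<rightarrow>\<^sub>M cem_borel"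
  by (rule measurable_at_random_time[OF assms, of \<infinity>])
     (auto intro: measurable_aug_completion[OF measurable_at_aug])

lemma measurable_stopping_time_aug:
  "stopping T \<Longrightarrow> T \<in> borel_measurable (aug_filt X \<infinity>)"
  by (rule measurable_pre_sigma_aug[OF _ measurable_stopping_time_pre_sigma])

lemma sets_stopped_event:
  assumes T: "stopping T" and L: "L \<in> sets (pre_sigma T)"
  shows "{w\<in>L. T w < \<infinity>} \<in> sets (PC z)"
proof -
  have [measurable]: "T \<in> borel_measurable (PC z)"
    by (rule measurable_aug_completion[OF measurable_stopping_time_aug[OF T]])
  have L': "L \<in> sets (PC z)" using L pre_sigma_le_aug[OF T] aug_le_completion by blast
  have "{w\<in>L. T w < \<infinity>} = L \<inter> {w\<in>space (PC z). T w < \<infinity>}" using sets.sets_into_space[OF L'] by auto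
  also have "\<dots> \<in> sets (PC z)" using L' by measurable
  finally show ?thesis .
qed

lemma stopping_time_add_const:
  assumes T: "stopping T" and t: "t < \<infinity>"
  shows "stopping (\<lambda>w. T w + t)"
proof (rule stopping_timeI)
  fix s
  show "Measurable.pred (aug_filt X s) (\<lambda>w. T w + t \<le> s)"
  proof (cases "t \<le> s")
    case True
    then obtain r where r: "s = t + r" by (metis le_iff_add)
    have "T w + t \<le> s \<longleftrightarrow> T w \<le> r" for w
      unfolding r using t by (simp add: add.commute[of _ t] ennreal_add_left_cancel_le less_top[symmetric])
    then show ?thesis using stopping_time_le_const[OF T, of r s] r by simp
  next
    case False
    then have "\<not> T w + t \<le> s" for w by (metis add.commute add_increasing2 order.trans order_refl le_add_same_cancel2 zero_le)
    then show ?thesis by simp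
  qed
qed

section \<open>From one position after a stopping time to cylinder events\<close>

definition transition :: "ennreal \<Rightarrow> 's option \<Rightarrow> 's option measure" where
  "transition t z = distr (P z) cem_borel (pr_at X t)"

lemma measurable_at_law: "pr_at X t \<in> P z \<rightarrow>\<^sub>M cem_borel"
  using measurable_at measurable_cong_sets[OF sets_law refl] by metis

lemma emeasure_transition:
  "B \<in> sets cem_borel \<Longrightarrow> emeasure (transition t z) B = emeasure (P z) {w\<in>\<Omega>. pr_at X t w \<in> B}"
  unfolding transition_def using measurable_at_law
  by (subst emeasure_distr) (auto simp: vimage_def Int_def conj_commute)

lemma measurable_transition: "t < \<infinity> \<Longrightarrow> transition t \<in> cem_borel \<rightarrow>\<^sub>M subprob_algebra cem_borel"
proof (rule measurable_subprob_algebra)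
  show "subprob_space (transition t z)" for z
    unfolding transition_def using measurable_at_law
    by (intro prob_space_imp_subprob_space prob_space.prob_space_distr prob_space_law)
  show "sets (transition t z) = sets cem_borel" for z by (simp add: transition_def)
  assume t: "t < \<infinity>" fix B :: "'s option set" assume "B \<in> sets cem_borel"
  with t std show "(\<lambda>z. emeasure (transition t z) B) \<in> borel_measurable cem_borel"
    by (simp add: emeasure_transition standard_process_def strong_markov_def)
qed

lemma strong_markov_one_time:
  assumes T: "stopping T" and L: "L \<in> sets (pre_sigma T)" and t: "t < \<infinity>"
    and g: "g \<in> borel_measurable cem_borel"
  shows "(\<integral>\<^sup>+w. g (pr_at X (T w + t) w) * indicator {w\<in>L. T w < \<infinity>} w \<partial>PC z) =
    (\<integral>\<^sup>+w. (\<integral>\<^sup>+y. g y \<partial>transition t (pr_at X (T w) w)) * indicator {w\<in>L. T w < \<infinity>} w \<partial>PC z)"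
proof -
  let ?S = "{w\<in>L. T w < \<infinity>}"
  have [measurable]: "T \<in> borel_measurable (PC z)"
    by (rule measurable_aug_completion[OF measurable_stopping_time_aug[OF T]])
  note S = sets_stopped_event[OF T L, of z]
  have m1: "(\<lambda>w. pr_at X (T w + t) w) \<in> PC z \<rightarrow>\<^sub>M cem_borel"
    by (rule measurable_at_completion) measurable
  have m2: "(\<lambda>w. pr_at X (T w) w) \<in> PC z \<rightarrow>\<^sub>M cem_borel"
    by (rule measurable_at_completion) measurable
  have ne: "space (PC z) \<noteq> {}" using sample_space_nonempty by simp
  show ?thesis
  proof (rule nn_integral_density_kernel_eq[OF _ m1 m2 measurable_transition[OF t] _ g])
    show "indicator ?S \<in> borel_measurable (PC z)" using S by simp
    show "distr (density (PC z) (indicator ?S)) cem_borel (\<lambda>w. pr_at X (T w + t) w) =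
      distr (density (PC z) (indicator ?S)) cem_borel (\<lambda>w. pr_at X (T w) w) \<bind> transition t" (is "?l = ?r")
    proof (rule measure_eqI)
      show "sets ?l = sets ?r"
        using sets_bind[of "distr (density (PC z) (indicator ?S)) cem_borel (\<lambda>w. pr_at X (T w) w)" "transition t" cem_borel]
        by (simp add: transition_def)
      fix B assume "B \<in> sets ?l"
      then have B: "B \<in> sets cem_borel" by simp
      have "emeasure ?l B = emeasure (PC z) {w\<in>L. T w < \<infinity> \<and> pr_at X (T w + t) w \<in> B}"
        unfolding emeasure_distr_density_indicator[OF m1 S B] by (rule arg_cong2[where f=emeasure]) auto
      also have "\<dots> = (\<integral>\<^sup>+w. emeasure (transition t (pr_at X (T w) w)) B * indicator ?S w \<partial>PC z)"
        using std T L t B unfolding standard_process_def strong_markov_def emeasure_transition[OF B] by blast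
      also have "\<dots> = emeasure ?r B"
        unfolding emeasure_bind_distr_density_indicator[OF m2 S measurable_transition[OF t] B ne] ..
      finally show "emeasure ?l B = emeasure ?r B" .
    qed
  qed
qed

text \<open>
  Only the existence of a kernel \<open>K\<close> is claimed, but one that serves all \<open>T\<close>, \<open>z\<close> and \<open>L\<close>: the
  earliest time of the cylinder can then be split off by the one-time property at \<open>T + r\<close>.
  The case \<open>T = 0\<close> identifies \<open>K\<close> afterwards.
\<close>

lemma strong_markov_cylinder_ex:
  assumes "finite J" and B: "\<And>s. B s \<in> sets cem_borel"
  shows "\<forall>r<\<infinity>. (\<forall>s\<in>J. r \<le> s \<and> s < \<infinity>) \<longrightarrow> (\<exists>K\<in>borel_measurable cem_borel. \<forall>T z. \<forall>L\<in>sets (pre_sigma (\<lambda>w. T w + r)).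
      stopping T \<longrightarrow>
      emeasure (PC z) {w\<in>L. T w < \<infinity> \<and> (\<forall>s\<in>J. pr_at X (T w + s) w \<in> B s)} =
      (\<integral>\<^sup>+w. K (pr_at X (T w + r) w) * indicator {w\<in>L. T w < \<infinity>} w \<partial>PC z))"
  using assms(1)
proof (induction rule: finite_linorder_min_induct)
  case empty
  show ?case
  proof (intro allI impI bexI[of _ "\<lambda>_. 1"] ballI)
    fix r :: ennreal and T z L assume r: "r < \<infinity>" and L: "L \<in> sets (pre_sigma (\<lambda>w. T w + r))" and T: "stopping T"
    have "{w\<in>L. T w < \<infinity>} \<in> sets (PC z)"
      using sets_stopped_event[OF stopping_time_add_const[OF T r] L, of z] r by (simp add: less_top[symmetric])
    then show "emeasure (PC z) {w \<in> L. T w < \<infinity> \<and> (\<forall>s\<in>{}. pr_at X (T w + s) w \<in> B s)} =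
        (\<integral>\<^sup>+w. 1 * indicator {w\<in>L. T w < \<infinity>} w \<partial>PC z)"
      by (simp del: emeasure_completion)
  qed simp
next
  case (insert b A)
  show ?case
  proof (intro allI impI)
    fix r assume r: "r < \<infinity>" and rA: "\<forall>s\<in>insert b A. r \<le> s \<and> s < \<infinity>"
    then have b: "b < \<infinity>" "r \<le> b" by auto
    then obtain d where d: "b = r + d" by (metis le_iff_add)
    with b have dfin: "d < \<infinity>" by (auto simp: less_top[symmetric])
    have "\<forall>s\<in>A. b \<le> s \<and> s < \<infinity>" using insert(2) rA by auto
    with insert(3) b(1) obtain K where K [measurable]: "K \<in> borel_measurable cem_borel"
      and Keq: "\<And>T z L. L \<in> sets (pre_sigma (\<lambda>w. T w + b)) \<Longrightarrow> stopping T \<Longrightarrow>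
      emeasure (PC z) {w\<in>L. T w < \<infinity> \<and> (\<forall>s\<in>A. pr_at X (T w + s) w \<in> B s)} =
      (\<integral>\<^sup>+w. K (pr_at X (T w + b) w) * indicator {w\<in>L. T w < \<infinity>} w \<partial>PC z)" by meson
    define g where "g z = K z * indicator (B b) z" for z
    have g: "g \<in> borel_measurable cem_borel" unfolding g_def using B[of b] by measurable
    show "\<exists>K\<in>borel_measurable cem_borel. \<forall>T z. \<forall>L\<in>sets (pre_sigma (\<lambda>w. T w + r)).
      stopping T \<longrightarrow>
      emeasure (PC z) {w\<in>L. T w < \<infinity> \<and> (\<forall>s\<in>insert b A. pr_at X (T w + s) w \<in> B s)} =
      (\<integral>\<^sup>+w. K (pr_at X (T w + r) w) * indicator {w\<in>L. T w < \<infinity>} w \<partial>PC z)"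
    proof (intro bexI[of _ "\<lambda>z. \<integral>\<^sup>+y. g y \<partial>transition d z"] allI ballI impI)
      show "(\<lambda>z. \<integral>\<^sup>+y. g y \<partial>transition d z) \<in> borel_measurable cem_borel"
        using measurable_compose[OF measurable_transition[OF dfin] nn_integral_measurable_subprob_algebra[OF g]] .
      fix T z L assume L: "L \<in> sets (pre_sigma (\<lambda>w. T w + r))" and T: "stopping T"
      have Tr: "stopping (\<lambda>w. T w + r)" and Tb: "stopping (\<lambda>w. T w + b)"
        using T r b by (auto intro: stopping_time_add_const)
      \<comment> \<open>The constraint at the earliest time \<open>b\<close> is known at time T + b
        and is absorbed into the event, which leaves the later times to the induction hypothesis. It
        reappears as the factor \<open>indicator (B b)\<close> in \<open>g\<close>.\<close>
      define L' where "L' = L \<inter> {w\<in>space (pre_sigma (\<lambda>w. T w + b)). pr_at X (T w + b) w \<in> B b}"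
      have "L \<in> sets (pre_sigma (\<lambda>w. T w + b))"
        using mono_pre_sigma[OF Tr Tb] b(2) L by (auto intro: add_left_mono)
      moreover have "{w\<in>space (pre_sigma (\<lambda>w. T w + b)). pr_at X (T w + b) w \<in> B b} \<in> sets (pre_sigma (\<lambda>w. T w + b))"
        using measurable_sets[OF measurable_at_stopping_time[OF Tb] B[of b]] by (simp add: vimage_def Int_def conj_commute)
      ultimately have L': "L' \<in> sets (pre_sigma (\<lambda>w. T w + b))" unfolding L'_def by (rule sets.Int)
      have Ls: "L \<subseteq> \<Omega>" using sets.sets_into_space[OF L] by (simp add: space_pre_sigma)
      have "emeasure (PC z) {w\<in>L. T w < \<infinity> \<and> (\<forall>s\<in>insert b A. pr_at X (T w + s) w \<in> B s)} =
          emeasure (PC z) {w\<in>L'. T w < \<infinity> \<and> (\<forall>s\<in>A. pr_at X (T w + s) w \<in> B s)}"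
        using Ls by (intro arg_cong2[where f=emeasure]) (auto simp: L'_def space_pre_sigma)
      also have "\<dots> = (\<integral>\<^sup>+w. K (pr_at X (T w + b) w) * indicator {w\<in>L'. T w < \<infinity>} w \<partial>PC z)"
        by (rule Keq[OF L' T])
      also have "\<dots> = (\<integral>\<^sup>+w. g (pr_at X ((T w + r) + d) w) * indicator {w\<in>L. T w + r < \<infinity>} w \<partial>PC z)"
        using r Ls by (intro nn_integral_cong)
          (auto simp: g_def L'_def d indicator_def space_pre_sigma add.assoc less_top[symmetric])
      also have "\<dots> = (\<integral>\<^sup>+w. (\<integral>\<^sup>+y. g y \<partial>transition d (pr_at X (T w + r) w)) * indicator {w\<in>L. T w + r < \<infinity>} w \<partial>PC z)"
        by (rule strong_markov_one_time[OF Tr L dfin g])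
      also have "\<dots> = (\<integral>\<^sup>+w. (\<integral>\<^sup>+y. g y \<partial>transition d (pr_at X (T w + r) w)) * indicator {w\<in>L. T w < \<infinity>} w \<partial>PC z)"
        using r by (intro nn_integral_cong) (auto simp: indicator_def less_top[symmetric])
      finally show "emeasure (PC z) {w\<in>L. T w < \<infinity> \<and> (\<forall>s\<in>insert b A. pr_at X (T w + s) w \<in> B s)} =
        (\<integral>\<^sup>+w. (\<integral>\<^sup>+y. g y \<partial>transition d (pr_at X (T w + r) w)) * indicator {w\<in>L. T w < \<infinity>} w \<partial>PC z)" .
    qed
  qed
qed

section \<open>Path laws and the strong Markov property for raw functionals\<close>

definition cylinders :: "'w set set" where
  "cylinders = {{w\<in>\<Omega>. \<forall>s\<in>J. pr_at X s w \<in> B s} |J B. finite J \<and> (\<forall>s\<in>J. s < \<infinity>) \<and> (\<forall>s. B s \<in> sets cem_borel)}"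

lemma sets_cylinder:
  assumes "finite J" "\<And>s. B s \<in> sets cem_borel"
  shows "{w\<in>\<Omega>. \<forall>s\<in>J. pr_at X s w \<in> B s} \<in> sets (raw_filt X \<infinity>)"
proof -
  have "{w\<in>space (raw_filt X \<infinity>). \<forall>s\<in>J. pr_at X s w \<in> B s} \<in> sets (raw_filt X \<infinity>)"
  proof (rule sets.sets_Collect_finite_All[OF _ assms(1)])
    fix s
    show "{w \<in> space (raw_filt X \<infinity>). pr_at X s w \<in> B s} \<in> sets (raw_filt X \<infinity>)"
      using measurable_sets[OF measurable_at_raw[of s \<infinity>] assms(2)[of s]]
      by (simp add: vimage_def Int_def conj_commute)
  qed
  then show ?thesis by simp
qed

lemma sets_raw_cylinders: "sets (raw_filt X \<infinity>) = sigma_sets \<Omega> cylinders"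
proof (rule antisym)
  show "sigma_sets \<Omega> cylinders \<subseteq> sets (raw_filt X \<infinity>)"
    using sets.sigma_sets_subset[of cylinders "raw_filt X \<infinity>"] sets_cylinder by (auto simp: cylinders_def)
  show "sets (raw_filt X \<infinity>) \<subseteq> sigma_sets \<Omega> cylinders"
    unfolding sets_raw_filt
  proof (rule sigma_sets_mono, safe)
    fix s and B :: "'s option set" assume B: "B \<in> sets cem_borel"
    show "pr_at X s -` B \<inter> \<Omega> \<in> sigma_sets \<Omega> cylinders"
    proof (cases "s < \<infinity>")
      case True
      then show ?thesis using B
        by (intro sigma_sets.Basic) (auto simp: cylinders_def intro!: exI[of _ "{s}"] exI[of _ "\<lambda>_. B"])
    next
      case False
      then have "pr_at X s -` B \<inter> \<Omega> = (if None \<in> B then \<Omega> else {})"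
        using at_infinity by (auto simp: less_top[symmetric])
      then show ?thesis by (auto intro: sigma_sets_top sigma_sets.Empty)
    qed
  qed
qed

lemma Int_stable_cylinders: "Int_stable cylinders"
proof (rule Int_stableI)
  fix a b assume "a \<in> cylinders" and "b \<in> cylinders"
  from \<open>a \<in> cylinders\<close> obtain J B where 1: "a = {w\<in>\<Omega>. \<forall>s\<in>J. pr_at X s w \<in> B s}"
    "finite J" "\<forall>s\<in>J. s < \<infinity>" "\<forall>s. B s \<in> sets cem_borel"
    unfolding cylinders_def mem_Collect_eq by (elim exE conjE) (rule that)
  from \<open>b \<in> cylinders\<close> obtain J' B' where 2: "b = {w\<in>\<Omega>. \<forall>s\<in>J'. pr_at X s w \<in> B' s}"
    "finite J'" "\<forall>s\<in>J'. s < \<infinity>" "\<forall>s. B' s \<in> sets cem_borel"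
    unfolding cylinders_def mem_Collect_eq by (elim exE conjE) (rule that)
  let ?C = "\<lambda>s. (if s \<in> J then B s else UNIV) \<inter> (if s \<in> J' then B' s else UNIV)"
  have "a \<inter> b = {w\<in>\<Omega>. \<forall>s\<in>J \<union> J'. pr_at X s w \<in> ?C s}" unfolding 1 2 by (auto split: if_splits)
  moreover have "\<forall>s. ?C s \<in> sets cem_borel"
    using 1(4) 2(4) sets.top[of "cem_borel :: 's option measure"] by auto
  moreover have "finite (J \<union> J')" "\<forall>s\<in>J \<union> J'. s < \<infinity>" using 1 2 by auto
  ultimately show "a \<inter> b \<in> cylinders"
    unfolding cylinders_def mem_Collect_eq by (intro exI[of _ "J \<union> J'"] exI[of _ ?C] conjI)
qed

lemma cylinders_Pow: "cylinders \<subseteq> Pow \<Omega>" and space_in_cylinders: "\<Omega> \<in> cylinders"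
  by (auto simp: cylinders_def intro!: exI[of _ "{}"] exI[of _ "\<lambda>_. UNIV"] simp: sets_cem_borel)

text \<open>The \<sigma>-algebra of the sample space may be larger than the one generated by the
  positions. Only on the latter is the law shown to depend measurably on the starting point.\<close>

definition path_law :: "'s option \<Rightarrow> 'w measure" where
  "path_law z = restr_to_subalg (P z) (raw_filt X \<infinity>)"

lemma subalgebra_raw: "subalgebra (P z) (raw_filt X \<infinity>)"
  using raw_filt_le sets_law by (auto simp: subalgebra_def)

lemma sets_path_law [simp]: "sets (path_law z) = sets (raw_filt X \<infinity>)"
  and space_path_law [simp]: "space (path_law z) = \<Omega>"
  and emeasure_path_law: "S \<in> sets (raw_filt X \<infinity>) \<Longrightarrow> emeasure (path_law z) S = emeasure (P z) S"
  unfolding path_law_def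
  using sets_restr_to_subalg[OF subalgebra_raw] emeasure_restr_to_subalg[OF subalgebra_raw]
  by (simp_all only: space_law space_restr_to_subalg)

lemma nn_integral_path_law:
  "F \<in> borel_measurable (raw_filt X \<infinity>) \<Longrightarrow> (\<integral>\<^sup>+w. F w \<partial>path_law z) = (\<integral>\<^sup>+w. F w \<partial>P z)"
  unfolding path_law_def by (rule nn_integral_subalgebra2[OF subalgebra_raw])

lemma raw_in_completion: "S \<in> sets (raw_filt X \<infinity>) \<Longrightarrow> S \<in> sets (PC z) \<and> emeasure (PC z) S = emeasure (P z) S"
  using raw_filt_le sets_law by (metis emeasure_completion main_part sets_completionI_sets subsetD)

lemma strong_markov_cylinder:
  assumes "finite J" "\<And>s. s \<in> J \<Longrightarrow> s < \<infinity>" and B: "\<And>s. B s \<in> sets cem_borel"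
  shows "(\<lambda>z. emeasure (P z) {w\<in>\<Omega>. \<forall>s\<in>J. pr_at X s w \<in> B s}) \<in> borel_measurable cem_borel" (is "?P \<in> _")
    and "stopping T \<Longrightarrow> L \<in> sets (pre_sigma T) \<Longrightarrow>
      emeasure (PC z) {w\<in>L. T w < \<infinity> \<and> (\<forall>s\<in>J. pr_at X (T w + s) w \<in> B s)} =
      (\<integral>\<^sup>+w. emeasure (P (pr_at X (T w) w)) {w\<in>\<Omega>. \<forall>s\<in>J. pr_at X s w \<in> B s} *
         indicator {w\<in>L. T w < \<infinity>} w \<partial>PC z)"
proof -
  obtain K where K [measurable]: "K \<in> borel_measurable cem_borel"
    and Keq: "\<And>T z L. L \<in> sets (pre_sigma T) \<Longrightarrow> stopping T \<Longrightarrow>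
      emeasure (PC z) {w\<in>L. T w < \<infinity> \<and> (\<forall>s\<in>J. pr_at X (T w + s) w \<in> B s)} =
      (\<integral>\<^sup>+w. K (pr_at X (T w) w) * indicator {w\<in>L. T w < \<infinity>} w \<partial>PC z)"
    using strong_markov_cylinder_ex[where B=B, OF assms(1) B, THEN spec, of 0] assms(2) by auto
  have KP: "K z = emeasure (P z) {w\<in>\<Omega>. \<forall>s\<in>J. pr_at X s w \<in> B s}" for z
  proof -
    have "emeasure (P z) {w\<in>\<Omega>. \<forall>s\<in>J. pr_at X s w \<in> B s} =
        emeasure (PC z) {w\<in>\<Omega>. \<forall>s\<in>J. pr_at X s w \<in> B s}"
      using raw_in_completion[OF sets_cylinder[OF assms(1) B]] by simp
    also have "\<dots> = (\<integral>\<^sup>+w. K (pr_at X 0 w) * indicator \<Omega> w \<partial>PC z)"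
      using Keq[of \<Omega> "\<lambda>_. 0" z] sets.top[of "pre_sigma (\<lambda>_. 0)"]
      by (simp add: stopping_time_const space_pre_sigma del: emeasure_completion)
    also have "\<dots> = (\<integral>\<^sup>+w. K z \<partial>PC z)"
      using AE_at_0[of z] AE_space[of "P z"]
      by (intro nn_integral_cong_AE) (auto simp: AE_completion_iff)
    also have "\<dots> = K z" using prob_space.emeasure_space_1[OF prob_space_completion_law[of z]] by simp
    finally show ?thesis by simp
  qed
  show "?P \<in> borel_measurable cem_borel" using K unfolding KP[symmetric] .
  show "emeasure (PC z) {w\<in>L. T w < \<infinity> \<and> (\<forall>s\<in>J. pr_at X (T w + s) w \<in> B s)} =
      (\<integral>\<^sup>+w. emeasure (P (pr_at X (T w) w)) {w\<in>\<Omega>. \<forall>s\<in>J. pr_at X s w \<in> B s} *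
         indicator {w\<in>L. T w < \<infinity>} w \<partial>PC z)"
    if "stopping T" "L \<in> sets (pre_sigma T)"
    using Keq[OF that(2,1)] unfolding KP .
qed

lemma measurable_path_law: "path_law \<in> cem_borel \<rightarrow>\<^sub>M prob_algebra (raw_filt X \<infinity>)"
proof (rule measurable_prob_algebra_generated[OF sets_raw_cylinders Int_stable_cylinders cylinders_Pow])
  show "prob_space (path_law z)" for z
    unfolding path_law_def by (intro prob_space_restr_to_subalg prob_space_law subalgebra_raw)
  fix A assume "A \<in> cylinders"
  then show "(\<lambda>z. emeasure (path_law z) A) \<in> borel_measurable cem_borel"
    using strong_markov_cylinder(1) sets_cylinder
    by (auto simp: cylinders_def emeasure_path_law)
qed simp

lemma measurable_shift:
  assumes "S \<in> borel_measurable (PC z)"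
  shows "(\<lambda>w. pr_shift X (S w) w) \<in> PC z \<rightarrow>\<^sub>M raw_filt X \<infinity>"
  unfolding raw_filt_def
proof (rule measurable_measure_of)
  show "(\<lambda>w. pr_shift X (S w) w) \<in> space (PC z) \<rightarrow> \<Omega>" using shift_space by auto
  fix Y assume "Y \<in> {pr_at X s -` B \<inter> \<Omega> |s B. s \<le> \<infinity> \<and> B \<in> sets cem_borel}"
  then obtain s B where Y: "Y = pr_at X s -` B \<inter> \<Omega>" "B \<in> sets cem_borel" by auto
  have "(\<lambda>w. pr_at X (s + S w) w) \<in> PC z \<rightarrow>\<^sub>M cem_borel"
    using assms by (intro measurable_at_completion) measurable
  from measurable_sets[OF this Y(2)]
  show "(\<lambda>w. pr_shift X (S w) w) -` Y \<inter> space (PC z) \<in> sets (PC z)"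
    by (rule back_subst[of "\<lambda>A. A \<in> sets (PC z)"]) (auto simp: Y(1) at_shift shift_space)
qed auto

lemma measurable_path_law': "path_law \<in> cem_borel \<rightarrow>\<^sub>M subprob_algebra (raw_filt X \<infinity>)"
  using measurable_path_law by (rule measurable_prob_algebraD)

lemma measurable_nn_integral_path_law:
  assumes "F \<in> borel_measurable (raw_filt X \<infinity>)"
  shows "(\<lambda>z. \<integral>\<^sup>+w. F w \<partial>P z) \<in> borel_measurable cem_borel"
  using measurable_compose[OF measurable_path_law' nn_integral_measurable_subprob_algebra[OF assms]]
  by (simp add: nn_integral_path_law[OF assms])

text \<open>As functions of \<open>F\<close> both sides are finite measures on path space, and they
  agree on cylinders, which are stable under intersection.\<close>

lemma strong_markov_raw_event:
  assumes T: "stopping T" and L: "L \<in> sets (pre_sigma T)"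
    and F: "F \<in> borel_measurable (raw_filt X \<infinity>)"
  shows "(\<integral>\<^sup>+w. F (pr_shift X (T w) w) * indicator {w\<in>L. T w < \<infinity>} w \<partial>PC z) =
    (\<integral>\<^sup>+w. restart F T w * indicator {w\<in>L. T w < \<infinity>} w \<partial>PC z)"
proof -
  let ?S = "{w\<in>L. T w < \<infinity>}"
  have [measurable]: "T \<in> borel_measurable (PC z)"
    by (rule measurable_aug_completion[OF measurable_stopping_time_aug[OF T]])
  note S = sets_stopped_event[OF T L, of z]
  have m1: "(\<lambda>w. pr_shift X (T w) w) \<in> PC z \<rightarrow>\<^sub>M raw_filt X \<infinity>"
    by (rule measurable_shift) measurable
  have m2: "(\<lambda>w. pr_at X (T w) w) \<in> PC z \<rightarrow>\<^sub>M cem_borel"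
    by (rule measurable_at_completion) measurable
  have ne: "space (PC z) \<noteq> {}" using sample_space_nonempty by simp
  have "(\<integral>\<^sup>+w. F (pr_shift X (T w) w) * indicator ?S w \<partial>PC z) =
    (\<integral>\<^sup>+w. (\<integral>\<^sup>+w'. F w' \<partial>path_law (pr_at X (T w) w)) * indicator ?S w \<partial>PC z)"
  proof (rule nn_integral_density_kernel_eq[OF _ m1 m2 measurable_path_law' _ F])
    show "indicator ?S \<in> borel_measurable (PC z)" using S by simp
    let ?l = "distr (density (PC z) (indicator ?S)) (raw_filt X \<infinity>) (\<lambda>w. pr_shift X (T w) w)"
    let ?r = "distr (density (PC z) (indicator ?S)) cem_borel (\<lambda>w. pr_at X (T w) w) \<bind> path_law"
    have sl: "sets ?l = sigma_sets \<Omega> cylinders" by (simp add: sets_raw_cylinders[symmetric])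
    have sr: "sets ?r = sigma_sets \<Omega> cylinders"
      using sets_bind[of "distr (density (PC z) (indicator ?S)) cem_borel (\<lambda>w. pr_at X (T w) w)" path_law "raw_filt X \<infinity>"]
      by (simp add: sets_raw_cylinders[symmetric])
    show "?l = ?r"
    proof (rule measure_eqI_generator_eq[OF Int_stable_cylinders cylinders_Pow _ sl sr, of "\<lambda>_. \<Omega>"])
      show "range (\<lambda>_. \<Omega>) \<subseteq> cylinders" using space_in_cylinders by auto
      have "emeasure ?l \<Omega> \<le> 1"
      proof -
        have "\<Omega> \<in> sets (raw_filt X \<infinity>)" using sets.top[of "raw_filt X \<infinity>"] by simp
        then have "emeasure ?l \<Omega> = emeasure (PC z) {w\<in>?S. pr_shift X (T w) w \<in> \<Omega>}"
          by (rule emeasure_distr_density_indicator[OF m1 S])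
        also have "\<dots> \<le> 1" by (rule prob_space.measure_le_1[OF prob_space_completion_law])
        finally show ?thesis .
      qed
      then show "emeasure ?l \<Omega> \<noteq> \<infinity>" by (metis ennreal_one_less_top infinity_ennreal_def leD)
      fix Y assume "Y \<in> cylinders"
      then obtain J B where Y: "Y = {w\<in>\<Omega>. \<forall>s\<in>J. pr_at X s w \<in> B s}"
        and J: "finite J" "\<forall>s\<in>J. s < \<infinity>" and B: "\<forall>s. B s \<in> sets cem_borel"
        unfolding cylinders_def mem_Collect_eq by (elim exE conjE) (rule that)
      have Yr: "Y \<in> sets (raw_filt X \<infinity>)" unfolding Y using J B by (intro sets_cylinder) auto
      have "L \<subseteq> \<Omega>" using sets.sets_into_space[OF L] by (simp add: space_pre_sigma)
      then have "{w\<in>?S. pr_shift X (T w) w \<in> Y} = {w\<in>L. T w < \<infinity> \<and> (\<forall>s\<in>J. pr_at X (T w + s) w \<in> B s)}"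
        unfolding Y by (auto simp: at_shift shift_space add.commute)
      then have "emeasure ?l Y = emeasure (PC z) {w\<in>L. T w < \<infinity> \<and> (\<forall>s\<in>J. pr_at X (T w + s) w \<in> B s)}"
        unfolding emeasure_distr_density_indicator[OF m1 S Yr] by simp
      also have "\<dots> = (\<integral>\<^sup>+w. emeasure (path_law (pr_at X (T w) w)) Y * indicator ?S w \<partial>PC z)"
        unfolding emeasure_path_law[OF Yr] unfolding Y
        using J B by (intro strong_markov_cylinder(2) T L) auto
      also have "\<dots> = emeasure ?r Y"
        unfolding emeasure_bind_distr_density_indicator[OF m2 S measurable_path_law' Yr ne] ..
      finally show "emeasure ?l Y = emeasure ?r Y" .
    qed simp
  qed
  then show ?thesis unfolding nn_integral_path_law[OF F] .
qed

text \<open>The weight \<open>W\<close> will carry the discount factors and the indicator of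
  \<open>V\<close> at the time \<open>T\<close>.\<close>

lemma strong_markov_raw:
  assumes T: "stopping T" and F: "F \<in> borel_measurable (raw_filt X \<infinity>)"
    and W: "W \<in> borel_measurable (pre_sigma T)"
  shows "(\<integral>\<^sup>+w. W w * (F (pr_shift X (T w) w) * alive T w) \<partial>PC z) =
    (\<integral>\<^sup>+w. W w * (restart F T w * alive T w) \<partial>PC z)"
proof -
  have Tm [measurable]: "T \<in> borel_measurable (PC z)"
    by (rule measurable_aug_completion[OF measurable_stopping_time_aug[OF T]])
  have S: "{w\<in>\<Omega>. T w < \<infinity>} \<in> sets (PC z)"
    using sets_stopped_event[OF T, of \<Omega>] sets.top[of "pre_sigma T"] by (simp add: space_pre_sigma)
  define u where "u w = F (pr_shift X (T w) w) * alive T w" for w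
  define v where "v w = restart F T w * alive T w" for w
  have u [measurable]: "u \<in> borel_measurable (PC z)"
    unfolding u_def using S measurable_compose[OF measurable_shift[OF Tm] F] by measurable
  have v [measurable]: "v \<in> borel_measurable (PC z)"
    unfolding v_def using S measurable_compose[OF measurable_at_completion[OF Tm] measurable_nn_integral_path_law[OF F]] by measurable
  have m: "f \<in> borel_measurable (PC z)" if "f \<in> borel_measurable (pre_sigma T)" for f :: "'w \<Rightarrow> ennreal"
    by (rule measurable_aug_completion[OF measurable_pre_sigma_aug[OF T that]])
  have "(\<integral>\<^sup>+w. W w * u w \<partial>PC z) = (\<integral>\<^sup>+w. W w * v w \<partial>PC z)"
    using W
  proof (induction rule: borel_measurable_induct)
    case (cong f g)
    have "(\<integral>\<^sup>+w. f w * h w \<partial>PC z) = (\<integral>\<^sup>+w. g w * h w \<partial>PC z)" for h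
      using cong(3) by (intro nn_integral_cong) (simp add: space_pre_sigma)
    then show ?case using cong by simp
  next
    case (set L)
    have "L \<subseteq> \<Omega>" using sets.sets_into_space[OF set] by (simp add: space_pre_sigma)
    then have *: "(\<integral>\<^sup>+w. indicator L w * (f w * alive T w) \<partial>PC z) =
        (\<integral>\<^sup>+w. f w * indicator {w\<in>L. T w < \<infinity>} w \<partial>PC z)" for f
      by (intro nn_integral_cong) (auto simp: indicator_def)
    show ?case unfolding u_def v_def * by (rule strong_markov_raw_event[OF T set F])
  next
    case (mult f c)
    have [measurable]: "f \<in> borel_measurable (PC z)" using mult m by blast
    have "(\<integral>\<^sup>+w. (c * f w) * h w \<partial>PC z) = c * (\<integral>\<^sup>+w. f w * h w \<partial>PC z)"
      if [measurable]: "h \<in> borel_measurable (PC z)" for h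
      unfolding mult.assoc by (rule nn_integral_cmult) measurable
    from this[OF u] this[OF v] mult show ?case by simp
  next
    case (add f g)
    have [measurable]: "f \<in> borel_measurable (PC z)" "g \<in> borel_measurable (PC z)" using add m by blast+
    have "(\<integral>\<^sup>+w. (g w + f w) * h w \<partial>PC z) = (\<integral>\<^sup>+w. g w * h w \<partial>PC z) + (\<integral>\<^sup>+w. f w * h w \<partial>PC z)"
      if [measurable]: "h \<in> borel_measurable (PC z)" for h
      unfolding distrib_right by (rule nn_integral_add) measurable
    from this[OF u] this[OF v] add show ?case by simp
  next
    case (seq U)
    have "(\<integral>\<^sup>+w. (SUP i. U i) w * h w \<partial>PC z) = (SUP i. \<integral>\<^sup>+w. U i w * h w \<partial>PC z)"
      if [measurable]: "h \<in> borel_measurable (PC z)" for h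
    proof -
      have "(\<integral>\<^sup>+w. (SUP i. U i) w * h w \<partial>PC z) = (\<integral>\<^sup>+w. (SUP i. U i w * h w) \<partial>PC z)"
        by (intro nn_integral_cong) (simp add: SUP_apply SUP_mult_right_ennreal image_image)
      also have "\<dots> = (SUP i. \<integral>\<^sup>+w. U i w * h w \<partial>PC z)"
        using seq(3) m[OF seq(1)]
        by (intro nn_integral_monotone_convergence_SUP) (auto simp: incseq_def le_fun_def intro!: mult_right_mono)
      finally show ?thesis .
    qed
    from this[OF u] this[OF v] show ?case using seq.IH by simp
  qed
  then show ?thesis unfolding u_def v_def .
qed

text \<open>
  The augmentation is used for the initial distribution \<open>\<nu>\<close> that is the law of the position at
  time \<open>T\<close>.
\<close>

lemma aug_functional_raw_version:
  assumes T: "stopping T" and F: "F \<in> borel_measurable (aug_filt X \<infinity>)"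
  obtains F' where "F' \<in> borel_measurable (raw_filt X \<infinity>)"
    "AE w in PC z. T w < \<infinity> \<longrightarrow> F (pr_shift X (T w) w) = F' (pr_shift X (T w) w)"
    "AE w in PC z. restart F T w = restart F' T w"
proof -
  have Tm [measurable]: "T \<in> borel_measurable (PC z)"
    by (rule measurable_aug_completion[OF measurable_stopping_time_aug[OF T]])
  have at: "(\<lambda>w. pr_at X (T w) w) \<in> PC z \<rightarrow>\<^sub>M cem_borel" by (rule measurable_at_completion[OF Tm])
  define \<nu> where "\<nu> = distr (PC z) cem_borel (\<lambda>w. pr_at X (T w) w)"
  \<comment> \<open>\<open>Q\<close> is the law of a path whose starting point has law \<nu>. Sets
    in \<open>init_null X \<nu>\<close> are negligible for it, so \<open>F\<close> agrees with a raw
    functional outside a raw \<open>Q\<close>-null set \<open>N\<close>.\<close>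
  define Q where "Q = \<nu> \<bind> path_law"
  have \<nu>: "\<nu> \<in> init_dists"
    using prob_space.prob_space_distr[OF prob_space_completion_law at] by (simp add: init_dists_def \<nu>_def)
  have \<nu>p: "\<nu> \<in> space (prob_algebra cem_borel)"
    using \<nu> by (simp add: init_dists_def space_prob_algebra)
  have setsQ: "sets Q = sets (raw_filt X \<infinity>)"
    unfolding Q_def using sets_bind[of \<nu> path_law "raw_filt X \<infinity>"] by (simp add: \<nu>_def)
  have spaceQ: "space Q = \<Omega>" using sets_eq_imp_space_eq[OF setsQ] by simp
  have emQ: "emeasure Q N = (\<integral>\<^sup>+y. emeasure (P y) N \<partial>\<nu>)" if "N \<in> sets (raw_filt X \<infinity>)" for N
    unfolding Q_def using emeasure_bind_prob_algebra[OF \<nu>p measurable_path_law that] by (simp add: emeasure_path_law[OF that])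
  have emQ': "emeasure Q N = (\<integral>\<^sup>+w. emeasure (P (pr_at X (T w) w)) N \<partial>PC z)"
    and mN: "(\<lambda>w. emeasure (P (pr_at X (T w) w)) N) \<in> borel_measurable (PC z)"
    if N: "N \<in> sets (raw_filt X \<infinity>)" for N
  proof -
    have k: "(\<lambda>y. emeasure (P y) N) \<in> borel_measurable cem_borel"
      using measurable_emeasure_kernel[OF measurable_path_law' N] by (simp add: emeasure_path_law[OF N])
    then show "emeasure Q N = (\<integral>\<^sup>+w. emeasure (P (pr_at X (T w) w)) N \<partial>PC z)"
      unfolding emQ[OF N] \<nu>_def using at by (subst nn_integral_distr) auto
    show "(\<lambda>w. emeasure (P (pr_at X (T w) w)) N) \<in> borel_measurable (PC z)"
      using measurable_compose[OF at k] .
  qed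
  have "init_null X \<nu> \<subseteq> sets (completion Q)"
  proof
    fix N assume "N \<in> init_null X \<nu>"
    then obtain B where B: "B \<in> sets (raw_filt X \<infinity>)" "N \<subseteq> B" "(\<integral>\<^sup>+x. emeasure (P x) B \<partial>\<nu>) = 0"
      by (auto simp: init_null_def)
    then have "B \<in> null_sets Q" by (intro null_setsI) (auto simp: emQ setsQ)
    then show "N \<in> sets (completion Q)" using B(2) by (rule sets_completionI_sub)
  qed
  moreover have "sets (raw_filt X \<infinity>) \<subseteq> sets (completion Q)"
    unfolding setsQ[symmetric] by (auto intro: sets_completionI_sets)
  ultimately have "sigma_sets \<Omega> (sets (raw_filt X \<infinity>) \<union> init_null X \<nu>) \<subseteq> sets (completion Q)"
    using sets.sigma_sets_subset[of _ "completion Q"] spaceQ by auto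
  then have "sets (aug_filt X \<infinity>) \<subseteq> sets (completion Q)"
    using \<nu> unfolding sets_aug_filt by blast
  then have "F \<in> borel_measurable (completion Q)"
    using F spaceQ measurable_mono[of borel borel "aug_filt X \<infinity>" "completion Q"] by auto
  then obtain F' where F': "F' \<in> borel_measurable Q" and FF: "AE w in Q. F w = F' w"
    using completion_ex_borel_measurable by blast
  have F'raw: "F' \<in> borel_measurable (raw_filt X \<infinity>)" using F' measurable_cong_sets[OF setsQ refl] by blast
  obtain N where N: "N \<in> null_sets Q" "{w\<in>\<Omega>. F w \<noteq> F' w} \<subseteq> N"
    using FF unfolding eventually_ae_filter spaceQ by auto
  have Nr: "N \<in> sets (raw_filt X \<infinity>)" using N(1) setsQ by auto
  have "(\<integral>\<^sup>+w. emeasure (P (pr_at X (T w) w)) N \<partial>PC z) = 0"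
    using emQ'[OF Nr] N(1) by auto
  then have AE0: "AE w in PC z. emeasure (P (pr_at X (T w) w)) N = 0"
    using nn_integral_0_iff_AE[OF mN[OF Nr]] by simp
  \<comment> \<open>The strong Markov property is already available for the raw set
    \<open>N\<close>. It shows that the shifted path almost surely avoids \<open>N\<close> when
    \<open>T\<close> is finite.\<close>
  have "(\<integral>\<^sup>+w. 1 * (indicator N (pr_shift X (T w) w) * alive T w) \<partial>PC z) =
    (\<integral>\<^sup>+w. 1 * (restart (indicator N) T w * alive T w) \<partial>PC z)"
    using Nr by (intro strong_markov_raw[OF T]) auto
  also have "\<dots> = (\<integral>\<^sup>+w. 0 \<partial>PC z)"
  proof (rule nn_integral_cong_AE)
    show "AE w in PC z. 1 * (restart (indicator N) T w * alive T w) = (0::ennreal)"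
      using AE0
    proof eventually_elim
      case (elim w)
      have "N \<in> sets (P y)" for y using Nr raw_filt_le sets_law by auto
      then show ?case using elim by simp
    qed
  qed
  finally have "(\<integral>\<^sup>+w. indicator N (pr_shift X (T w) w) * alive T w \<partial>PC z) = 0" by simp
  moreover have "(\<lambda>w. indicator N (pr_shift X (T w) w) * alive T w :: ennreal) \<in> borel_measurable (PC z)"
  proof -
    have "(\<lambda>w. indicator N (pr_shift X (T w) w) :: ennreal) \<in> borel_measurable (PC z)"
      using measurable_compose[OF measurable_shift[OF Tm], of "indicator N" borel] Nr by auto
    moreover have "{w\<in>space (PC z). T w < \<infinity>} \<in> sets (PC z)" by measurable
    ultimately show ?thesis by simp
  qed
  ultimately have "AE w in PC z. indicator N (pr_shift X (T w) w) * alive T w = (0::ennreal)"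
    by (simp add: nn_integral_0_iff_AE)
  then have 1: "AE w in PC z. T w < \<infinity> \<longrightarrow> F (pr_shift X (T w) w) = F' (pr_shift X (T w) w)"
    using AE_space
  proof eventually_elim
    case (elim w)
    then show ?case using N(2) shift_space[of w "T w"] by (auto simp: indicator_def split: if_splits)
  qed
  have 2: "AE w in PC z. restart F T w = restart F' T w"
    using AE0
  proof eventually_elim
    case (elim w)
    then have "N \<in> null_sets (P (pr_at X (T w) w))"
      using Nr raw_filt_le sets_law by (intro null_setsI) auto
    then show ?case using N(2) by (intro nn_integral_cong_AE AE_I'[of N]) auto
  qed
  show thesis using that[OF F'raw 1 2] .
qed

text \<open>Transferred from an almost surely equal raw version, which is why measurability is
  obtained for the completion.\<close>

lemma strong_markov:
  assumes T: "stopping T" and F: "F \<in> borel_measurable (aug_filt X \<infinity>)"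
  shows "(\<lambda>w. F (pr_shift X (T w) w) * alive T w) \<in> borel_measurable (PC z)"
    and "W \<in> borel_measurable (pre_sigma T) \<Longrightarrow>
      (\<integral>\<^sup>+w. W w * (F (pr_shift X (T w) w) * alive T w) \<partial>PC z) =
      (\<integral>\<^sup>+w. W w * (restart F T w * alive T w) \<partial>PC z)"
proof -
  have Tm [measurable]: "T \<in> borel_measurable (PC z)"
    by (rule measurable_aug_completion[OF measurable_stopping_time_aug[OF T]])
  obtain F' where F': "F' \<in> borel_measurable (raw_filt X \<infinity>)"
    and 1: "AE w in PC z. T w < \<infinity> \<longrightarrow> F (pr_shift X (T w) w) = F' (pr_shift X (T w) w)"
    and 2: "AE w in PC z. restart F T w = restart F' T w"
    using aug_functional_raw_version[OF T F] .
  have eq: "AE w in PC z. F' (pr_shift X (T w) w) * alive T w =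
      F (pr_shift X (T w) w) * alive T w"
    using 1 by eventually_elim (auto simp: indicator_def)
  have "{w\<in>space (PC z). T w < \<infinity>} \<in> sets (PC z)" by measurable
  then have m: "(\<lambda>w. F' (pr_shift X (T w) w) * alive T w) \<in> borel_measurable (PC z)"
    using measurable_compose[OF measurable_shift[OF Tm] F'] by auto
  show "(\<lambda>w. F (pr_shift X (T w) w) * alive T w) \<in> borel_measurable (PC z)"
    by (rule measurable_completion_AE[OF m eq])
  assume W: "W \<in> borel_measurable (pre_sigma T)"
  have "(\<integral>\<^sup>+w. W w * (F (pr_shift X (T w) w) * alive T w) \<partial>PC z) =
      (\<integral>\<^sup>+w. W w * (F' (pr_shift X (T w) w) * alive T w) \<partial>PC z)"
    using eq by (intro nn_integral_cong_AE) (auto elim: eventually_mono)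
  also have "\<dots> = (\<integral>\<^sup>+w. W w * (restart F' T w * alive T w) \<partial>PC z)"
    by (rule strong_markov_raw[OF T F' W])
  also have "\<dots> = (\<integral>\<^sup>+w. W w * (restart F T w * alive T w) \<partial>PC z)"
    using 2 by (intro nn_integral_cong_AE) (auto elim: eventually_mono)
  finally show "(\<integral>\<^sup>+w. W w * (F (pr_shift X (T w) w) * alive T w) \<partial>PC z) =
      (\<integral>\<^sup>+w. W w * (restart F T w * alive T w) \<partial>PC z)" .
qed

end

section \<open>Discounted masses of additive functionals\<close>

lemma ext0_measurable [measurable]:
  fixes f :: "'s::topological_space \<Rightarrow> ennreal"
  assumes "f \<in> borel_measurable borel"
  shows "ext0 f \<in> borel_measurable cem_borel"
proof (rule measurableI)
  fix B :: "ennreal set" assume "B \<in> sets borel"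
  moreover have "Some -` (ext0 f -` B) = f -` B" by (auto simp: ext0_def)
  ultimately show "ext0 f -` B \<inter> space cem_borel \<in> sets cem_borel"
    using measurable_sets_borel[OF assms] by (simp add: sets_cem_borel)
qed simp

text \<open>Since \<open>p\<close> is measurable only over positive times, the time integral is
  first rewritten over Lebesgue measure restricted to them.\<close>

lemma res_dens_measurable:
  assumes "dual_density X Xh m p"
  shows "(\<lambda>(x, y). res_dens p \<alpha> x y) \<in> borel_measurable (borel \<Otimes>\<^sub>M borel)"
proof -
  let ?R = "restrict_space lborel {0<..} :: real measure"
  have p: "(\<lambda>(t, x, y). p t x y) \<in> borel_measurable (restrict_space borel {0<..} \<Otimes>\<^sub>M (borel \<Otimes>\<^sub>M borel))"
    using assms by (simp add: dual_density_def)
  have sR: "sets ?R = sets (restrict_space borel {0<..})"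
    by (simp add: sets_restrict_space)
  interpret R: sigma_finite_measure ?R
    by (rule sigma_finite_measure_restrict_space) (auto intro: lborel.sigma_finite_measure_axioms)
  have "(\<lambda>z. (snd z, fst z)) \<in> (borel \<Otimes>\<^sub>M borel) \<Otimes>\<^sub>M ?R \<rightarrow>\<^sub>M ?R \<Otimes>\<^sub>M (borel \<Otimes>\<^sub>M borel)"
    by measurable
  then have "(\<lambda>z. (snd z, fst z)) \<in> (borel \<Otimes>\<^sub>M borel) \<Otimes>\<^sub>M ?R \<rightarrow>\<^sub>M restrict_space borel {0<..} \<Otimes>\<^sub>M (borel \<Otimes>\<^sub>M borel)"
    using measurable_cong_sets[OF refl sets_pair_measure_cong[OF sR refl]] by blast
  from measurable_compose[OF this p]
  have [measurable]: "(\<lambda>z. p (snd z) (fst (fst z)) (snd (fst z))) \<in> borel_measurable ((borel \<Otimes>\<^sub>M borel) \<Otimes>\<^sub>M ?R)"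
    by (simp add: case_prod_beta)
  have [measurable]: "(\<lambda>t. ennreal (exp (- \<alpha> * t))) \<in> borel_measurable ?R"
    by (intro measurable_restrict_space1) measurable
  have "res_dens p \<alpha> x y = (\<integral>\<^sup>+t. ennreal (exp (- \<alpha> * t)) * p t x y \<partial>?R)" for x y
    unfolding res_dens_def by (subst nn_integral_restrict_space) auto
  then have "(\<lambda>(x, y). res_dens p \<alpha> x y) = (\<lambda>z. \<integral>\<^sup>+t. ennreal (exp (- \<alpha> * t)) * p t (fst z) (snd z) \<partial>?R)"
    by (auto simp: fun_eq_iff)
  also have "\<dots> \<in> borel_measurable (borel \<Otimes>\<^sub>M borel)"
  proof (rule R.borel_measurable_nn_integral)
    have "(\<lambda>z. ennreal (exp (- \<alpha> * snd z)) * p (snd z) (fst (fst z)) (snd (fst z)))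
        \<in> borel_measurable ((borel \<Otimes>\<^sub>M borel) \<Otimes>\<^sub>M ?R)"
      using measurable_compose[OF measurable_snd \<open>(\<lambda>t. ennreal (exp (- \<alpha> * t))) \<in> borel_measurable ?R\<close>]
      by (intro borel_measurable_times_ennreal) auto
    then show "(\<lambda>(z, t). ennreal (exp (- \<alpha> * t)) * p t (fst z) (snd z))
        \<in> borel_measurable ((borel \<Otimes>\<^sub>M borel) \<Otimes>\<^sub>M ?R)"
      by (simp add: case_prod_beta)
  qed
  finally show ?thesis .
qed

text \<open>The discount factor; its value 0 at infinity removes the levels that a clock never
  exceeds.\<close>

definition disc :: "ennreal \<Rightarrow> ennreal" where
  "disc t = (if t < \<infinity> then ennreal (exp (- enn2real t)) else 0)"

lemma disc_measurable [measurable]: "disc \<in> borel_measurable borel"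
  unfolding disc_def by measurable

lemma disc_infinity [simp]: "disc \<infinity> = 0"
  by (simp add: disc_def)

lemma disc_add: "s < \<infinity> \<Longrightarrow> t < \<infinity> \<Longrightarrow> disc (s + t) = disc s * disc t"
  by (simp add: disc_def enn2real_plus ennreal_mult[symmetric] exp_add[symmetric] less_top[symmetric])

context standard_markov
begin

definition inv_time :: "(ennreal \<Rightarrow> 'w \<Rightarrow> ennreal) \<Rightarrow> real \<Rightarrow> 'w \<Rightarrow> ennreal" where
  "inv_time A s w = path_inv (\<lambda>t. A t w) s"

text \<open>
  Density of the measure \<open>e\<^sup>-\<^sup>t 1\<^sub>V(X\<^sub>t) dA\<^sub>t\<close> after the change of time \<open>t = inv_time A s\<close>, which
  turns \<open>dA\<^sub>t\<close> into Lebesgue measure and random times into stopping times.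
\<close>

definition disc_rate :: "'s set \<Rightarrow> (ennreal \<Rightarrow> 'w \<Rightarrow> ennreal) \<Rightarrow> real \<Rightarrow> 'w \<Rightarrow> ennreal" where
  "disc_rate V A s w = indicator {0..} s *
     (disc (inv_time A s w) * indicator (Some ` V) (pr_at X (inv_time A s w) w))"

definition disc_total :: "'s set \<Rightarrow> (ennreal \<Rightarrow> 'w \<Rightarrow> ennreal) \<Rightarrow> 'w \<Rightarrow> ennreal" where
  "disc_total V A w = (\<integral>\<^sup>+s. disc_rate V A s w \<partial>lborel)"

text \<open>All shifts of the path are included so that one exceptional set serves every time, in
  particular random ones.\<close>

definition regular_paths :: "(ennreal \<Rightarrow> 'w \<Rightarrow> ennreal) \<Rightarrow> 'w set" where
  "regular_paths A = {w\<in>\<Omega>. clock (\<lambda>t. A t w) \<and> (\<forall>t<\<infinity>. clock (\<lambda>s. A s (pr_shift X t w)) \<and>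
     (\<forall>s<\<infinity>. A (t + s) w = A t w + A s (pr_shift X t w)))}"

text \<open>Additivity gives monotonicity, and survival gives an infinite lifetime, hence finiteness
  at all finite times.\<close>

lemma defining_set_clock:
  assumes L: "pcaf_defining_set X A L" and w: "w \<in> L" "w \<in> \<Omega>" and alive: "\<forall>t<\<infinity>. pr_at X t w \<noteq> None"
  shows "clock (\<lambda>t. A t w)"
proof -
  have life: "lifetime X w = \<infinity>"
  proof -
    have "{t. pr_at X t w = None} = {\<infinity>}"
      using alive at_infinity[OF w(2)] by (auto simp: less_top[symmetric])
    then show ?thesis by (simp add: lifetime_def)
  qed
  from L w(1) have *: "A 0 w = 0" "continuous_on {..<\<infinity>} (\<lambda>t. A t w)" "\<forall>t<lifetime X w. A t w < \<infinity>"
    "\<forall>s<\<infinity>. \<forall>t<\<infinity>. A (t + s) w = A t w + A s (pr_shift X t w)"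
    unfolding pcaf_defining_set_def by blast+
  have "A s w \<le> A t w" if "s \<le> t" "t < \<infinity>" for s t
  proof -
    obtain r where r: "t = s + r" using \<open>s \<le> t\<close> by (auto simp: le_iff_add)
    then have "s < \<infinity>" "r < \<infinity>" using \<open>t < \<infinity>\<close> by (auto simp: less_top[symmetric])
    then show ?thesis using *(4) r by simp
  qed
  then show ?thesis using * life by (auto simp: clock_def)
qed

text \<open>A defining set is stable under shifts, and a path that never dies has only shifts that
  never die.\<close>

lemma AE_regular_paths:
  assumes A: "pcaf X A" and c: "conservative X"
  shows "AE w in P (Some x). w \<in> regular_paths A"
proof -
  obtain L where L: "pcaf_defining_set X A L" using A by (auto simp: pcaf_def)
  have "AE w in P (Some x). w \<in> L" using L by (auto simp: pcaf_defining_set_def)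
  moreover have "AE w in P (Some x). \<forall>t<\<infinity>. pr_at X t w \<in> range Some"
    using c by (auto simp: conservative_def)
  ultimately show ?thesis using AE_space
  proof eventually_elim
    case (elim w)
    then have w: "w \<in> \<Omega>" by simp
    have alive: "\<forall>t<\<infinity>. pr_at X t w \<noteq> None" using elim(2) by fastforce
    have "clock (\<lambda>s. A s (pr_shift X t w))" if t: "t < \<infinity>" for t
    proof (rule defining_set_clock[OF L])
      show "pr_shift X t w \<in> L" using L elim(1) t unfolding pcaf_defining_set_def by blast
      show "\<forall>s<\<infinity>. pr_at X s (pr_shift X t w) \<noteq> None"
        using alive t by (auto simp: at_shift[OF w] less_top[symmetric])
    qed (rule shift_space[OF w])
    moreover have "A (t + s) w = A t w + A s (pr_shift X t w)" if "t < \<infinity>" "s < \<infinity>" for s t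
      using L elim(1) that unfolding pcaf_defining_set_def by blast
    ultimately show ?case
      using defining_set_clock[OF L elim(1) w alive] w by (auto simp: regular_paths_def)
  qed
qed

text \<open>With the infimum over rationals, being less than \<open>t\<close> is a countable union
  of events of the past of \<open>t\<close> on every path, not only on regular ones.\<close>

lemma inv_time_stopping_time:
  assumes A: "pcaf X A"
  shows "stopping (inv_time A s)"
proof (rule stopping_time_rightI)
  fix t :: ennreal assume t: "t < \<infinity>"
  let ?I = "{q\<in>{q\<in>\<rat>. 0 \<le> q}. ennreal q < t}"
  have "inv_time A s w < t \<longleftrightarrow> (\<exists>q\<in>?I. ennreal s < A (ennreal q) w)" for w
    unfolding inv_time_def path_inv_def INF_less_iff using t by (auto split: if_splits)
  moreover have "Measurable.pred (aug_filt X t) (\<lambda>w. \<exists>q\<in>?I. ennreal s < A (ennreal q) w)"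
  proof (rule measurable_pred_countable)
    show "countable ?I" by (rule countable_subset[OF _ countable_rat]) auto
    fix q assume q: "q \<in> ?I"
    then have "ennreal q < \<infinity>" by simp
    then have "A (ennreal q) \<in> borel_measurable (aug_filt X (ennreal q))" using A by (auto simp: pcaf_def)
    then have [measurable]: "A (ennreal q) \<in> borel_measurable (aug_filt X t)"
      using q by (intro measurable_aug_mono[of "ennreal q" t]) auto
    show "Measurable.pred (aug_filt X t) (\<lambda>w. ennreal s < A (ennreal q) w)" by measurable
  qed
  ultimately show "Measurable.pred (aug_filt X t) (\<lambda>w. inv_time A s w < t)" by simp
qed

lemma pcaf_measurable_aug:
  assumes "pcaf X A" "t < \<infinity>" shows "A t \<in> borel_measurable (aug_filt X \<infinity>)"
  using assms by (intro measurable_aug_mono[of t \<infinity>]) (auto simp: pcaf_def)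

text \<open>Covers both the augmented \<sigma>-algebra and the completions of the laws, so that each
  joint measurability proof serves for either.\<close>

definition aug_extension :: "'w measure \<Rightarrow> bool" where
  "aug_extension N \<longleftrightarrow> space N = \<Omega> \<and> sets (aug_filt X \<infinity>) \<subseteq> sets N"

lemma aug_extension_aug: "aug_extension (aug_filt X \<infinity>)"
  and aug_extension_completion: "aug_extension (PC z)"
  using aug_le_completion by (auto simp: aug_extension_def)

lemma measurable_aug_extension:
  "aug_extension N \<Longrightarrow> f \<in> aug_filt X \<infinity> \<rightarrow>\<^sub>M K \<Longrightarrow> f \<in> N \<rightarrow>\<^sub>M K"
  using measurable_mono[of K K "aug_filt X \<infinity>" N] by (auto simp: aug_extension_def)

lemma inv_time_measurable:
  assumes A: "pcaf X A" and N: "aug_extension N" and f: "f \<in> borel_measurable M'" and g: "g \<in> M' \<rightarrow>\<^sub>M N"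
  shows "(\<lambda>z. inv_time A (f z) (g z)) \<in> borel_measurable M'"
proof -
  have "(\<lambda>z. A (ennreal q) (g z)) \<in> borel_measurable M'" for q
    using measurable_compose[OF g measurable_aug_extension[OF N pcaf_measurable_aug[OF A]]] by simp
  from path_inv_measurable_joint[of "\<lambda>t z. A t (g z)", OF this f] show ?thesis
    by (simp add: inv_time_def)
qed

lemma at_inv_time_measurable:
  assumes A: "pcaf X A" and N: "aug_extension N" and f: "f \<in> borel_measurable M'" and g: "g \<in> M' \<rightarrow>\<^sub>M N"
  shows "(\<lambda>z. pr_at X (inv_time A (f z) (g z)) (g z)) \<in> M' \<rightarrow>\<^sub>M cem_borel"
proof (rule measurable_at_random_time[OF inv_time_measurable[OF assms], of \<infinity>])
  show "g z \<in> \<Omega>" if "z \<in> space M'" for z using measurable_space[OF g that] N by (simp add: aug_extension_def)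
  show "(\<lambda>z. pr_at X s (g z)) \<in> M' \<rightarrow>\<^sub>M cem_borel" if "s \<le> \<infinity>" for s
    using measurable_compose[OF g measurable_aug_extension[OF N measurable_at_aug[OF that]]] .
qed simp

lemma disc_rate_measurable:
  assumes A: "pcaf X A" and N: "aug_extension N" and V: "open V"
    and f [measurable]: "f \<in> borel_measurable M'" and g: "g \<in> M' \<rightarrow>\<^sub>M N"
  shows "(\<lambda>z. disc_rate V A (f z) (g z)) \<in> borel_measurable M'"
proof -
  note [measurable] = inv_time_measurable[OF A N f g] at_inv_time_measurable[OF A N f g]
  have [measurable]: "Some ` V \<in> sets cem_borel" using V by (simp add: sets_cem_borel inj_vimage_image_eq)
  show ?thesis unfolding disc_rate_def by measurable
qed

lemma disc_total_measurable:
  assumes A: "pcaf X A" and N: "aug_extension N" and V: "open V"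
  shows "disc_total V A \<in> borel_measurable N"
proof -
  have "(\<lambda>z. disc_rate V A (snd z) (fst z)) \<in> borel_measurable (N \<Otimes>\<^sub>M lborel)"
    by (rule disc_rate_measurable[OF A N V]) measurable
  then show ?thesis unfolding disc_total_def
    by (intro lborel.borel_measurable_nn_integral) (simp add: case_prod_beta)
qed

lemma disc_rate_pre_sigma:
  assumes A: "pcaf X A" and V: "open V"
  shows "(\<lambda>w. disc_rate V A s w * disc (inv_time A s w)) \<in> borel_measurable (pre_sigma (inv_time A s))"
proof -
  note T = inv_time_stopping_time[OF A, of s]
  note [measurable] = measurable_stopping_time_pre_sigma[OF T] measurable_at_stopping_time[OF T]
  have [measurable]: "Some ` V \<in> sets cem_borel" using V by (simp add: sets_cem_borel inj_vimage_image_eq)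
  show ?thesis unfolding disc_rate_def by measurable
qed

lemma path_measurable:
  assumes "w \<in> \<Omega>"
  shows "(\<lambda>t. pr_at X (ennreal t) w) \<in> borel \<rightarrow>\<^sub>M cem_borel"
  by (rule measurable_at_random_time[of ennreal borel \<infinity> "\<lambda>_. w"]) (auto simp: assms)

text \<open>A pathwise change of variables in \<open>revuz_corr\<close>. From here on the random
  measure \<open>dA\<close> appears only as Lebesgue measure in the level \<open>s\<close>, to which
  Fubini applies.\<close>

lemma revuz_time_change:
  assumes c: "conservative X" and A: "pcaf X A" and r: "revuz_corr X p A \<mu>"
    and \<alpha>: "\<alpha> > 0" and f [measurable]: "f \<in> borel_measurable borel"
  shows "(\<integral>\<^sup>+w. (\<integral>\<^sup>+s. indicator {0..} s * (if inv_time A s w < \<infinity>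
        then ennreal (exp (- \<alpha> * enn2real (inv_time A s w))) * ext0 f (pr_at X (inv_time A s w) w) else 0)
        \<partial>lborel) \<partial>PC (Some x)) = (\<integral>\<^sup>+y. res_dens p \<alpha> x y * f y \<partial>\<mu>)"
proof -
  have "(\<integral>\<^sup>+y. res_dens p \<alpha> x y * f y \<partial>\<mu>) =
    (\<integral>\<^sup>+w. (\<integral>\<^sup>+t\<in>{0..}. ennreal (exp (- \<alpha> * t)) * ext0 f (pr_at X (ennreal t) w)
             \<partial>stieltjes (\<lambda>t. A t w)) \<partial>PC (Some x))"
    using r \<alpha> f unfolding revuz_corr_def by simp
  also have "\<dots> = (\<integral>\<^sup>+w. (\<integral>\<^sup>+s. indicator {0..} s * (if inv_time A s w < \<infinity>
        then ennreal (exp (- \<alpha> * enn2real (inv_time A s w))) * ext0 f (pr_at X (inv_time A s w) w) else 0)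
        \<partial>lborel) \<partial>PC (Some x))"
  proof (rule nn_integral_cong_AE)
    have "AE w in PC (Some x). w \<in> regular_paths A"
      using AE_regular_paths[OF A c] by (simp add: AE_completion_iff)
    then show "AE w in PC (Some x). (\<integral>\<^sup>+t\<in>{0..}. ennreal (exp (- \<alpha> * t)) * ext0 f (pr_at X (ennreal t) w)
             \<partial>stieltjes (\<lambda>t. A t w)) = (\<integral>\<^sup>+s. indicator {0..} s * (if inv_time A s w < \<infinity>
        then ennreal (exp (- \<alpha> * enn2real (inv_time A s w))) * ext0 f (pr_at X (inv_time A s w) w) else 0)
        \<partial>lborel)"
    proof eventually_elim
      case (elim w)
      then have w: "w \<in> \<Omega>" "clock (\<lambda>t. A t w)" by (auto simp: regular_paths_def)
      have "(\<lambda>t. ext0 f (pr_at X (ennreal t) w)) \<in> borel_measurable borel"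
        using measurable_compose[OF path_measurable[OF w(1)] ext0_measurable[OF f]] .
      then have "(\<lambda>t. ennreal (exp (- \<alpha> * t)) * ext0 f (pr_at X (ennreal t) w)) \<in> borel_measurable borel" by measurable
      from nn_integral_stieltjes_clock[OF w(2) this] show ?case
        unfolding inv_time_def by (auto intro!: nn_integral_cong simp: indicator_def)
    qed
  qed
  finally show ?thesis by simp
qed

lemma potential_restr:
  assumes d: "dual_density X Xh m p" and \<mu>: "sets \<mu> = sets borel" and V: "V \<in> sets borel"
    and f: "f \<in> borel_measurable borel"
  shows "(\<integral>\<^sup>+y. res_dens p \<alpha> x y * f y \<partial>restr \<mu> V) = (\<integral>\<^sup>+y. res_dens p \<alpha> x y * (indicator V y * f y) \<partial>\<mu>)"
proof -
  have "res_dens p \<alpha> x \<in> borel_measurable borel"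
    using measurable_compose[OF measurable_Pair1'[of x borel] res_dens_measurable[OF d]] by simp
  then have [measurable]: "res_dens p \<alpha> x \<in> borel_measurable \<mu>" "f \<in> borel_measurable \<mu>"
    using f measurable_cong_sets[OF \<mu> refl] by blast+
  have [measurable]: "V \<in> sets \<mu>" using V \<mu> by simp
  show ?thesis unfolding restr_def
    by (subst nn_integral_density) (auto intro!: nn_integral_cong simp: ac_simps)
qed

text \<open>The Revuz formula for \<open>\<alpha> = 1\<close> and the indicator of
  \<open>V\<close>.\<close>

lemma expectation_disc_total:
  assumes c: "conservative X" and A: "pcaf X A" and r: "revuz_corr X p A \<mu>"
    and d: "dual_density X Xh m p" and \<mu>: "sets \<mu> = sets borel" and V: "open V"
  shows "(\<integral>\<^sup>+w. disc_total V A w \<partial>P (Some x)) = potential p 1 (restr \<mu> V) x"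
proof -
  have Vb: "V \<in> sets borel" using V by simp
  have "potential p 1 (restr \<mu> V) x = (\<integral>\<^sup>+y. res_dens p 1 x y * indicator V y \<partial>\<mu>)"
    using potential_restr[OF d \<mu> Vb, of "\<lambda>_. 1" 1 x] by (simp add: potential_def)
  also have "\<dots> = (\<integral>\<^sup>+w. (\<integral>\<^sup>+s. indicator {0..} s * (if inv_time A s w < \<infinity>
        then ennreal (exp (- 1 * enn2real (inv_time A s w))) * ext0 (indicator V) (pr_at X (inv_time A s w) w) else 0)
        \<partial>lborel) \<partial>PC (Some x))"
    using Vb by (intro revuz_time_change[OF c A r, symmetric]) auto
  also have "\<dots> = (\<integral>\<^sup>+w. disc_total V A w \<partial>PC (Some x))"
    unfolding disc_total_def disc_rate_def
    by (intro nn_integral_cong) (auto simp: disc_def ext0_def indicator_def image_iff split: option.splits)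
  finally show ?thesis by (simp add: nn_integral_completion)
qed

lemma potential_measurable:
  assumes d: "dual_density X Xh m p" and \<nu>: "sets \<nu> = sets borel" "finite_measure \<nu>"
  shows "potential p \<alpha> \<nu> \<in> borel_measurable borel"
proof -
  interpret finite_measure \<nu> by fact
  have "(\<lambda>(x, y). res_dens p \<alpha> x y) \<in> borel_measurable (borel \<Otimes>\<^sub>M \<nu>)"
    using res_dens_measurable[OF d, of \<alpha>] measurable_cong_sets[OF sets_pair_measure_cong[OF refl \<nu>(1), of borel] refl] by blast
  then show ?thesis unfolding potential_def by (rule borel_measurable_nn_integral)
qed

text \<open>The inverse of the restarted clock is the old inverse at levels translated by
  \<open>A t w\<close>, minus \<open>t\<close>. The discount factor is multiplicative and Lebesgue
  measure is translation invariant, so the restarted total is the part of the original one from time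
  \<open>t\<close> on.\<close>

lemma disc_total_shift:
  assumes w: "w \<in> regular_paths A" and A: "pcaf X A" and V: "open V" and t: "t < \<infinity>"
  shows "disc t * disc_total V A (pr_shift X t w) =
    (\<integral>\<^sup>+s. disc_rate V A s w * indicator {s. t \<le> inv_time A s w} s \<partial>lborel)"
proof -
  have \<Omega>: "w \<in> \<Omega>" and cl: "clock (\<lambda>t. A t w)" and cl': "clock (\<lambda>s. A s (pr_shift X t w))"
    and add: "\<And>s. s < \<infinity> \<Longrightarrow> A (t + s) w = A t w + A s (pr_shift X t w)"
    using w t by (auto simp: regular_paths_def)
  define a where "a = enn2real (A t w)"
  have Aa: "A t w = ennreal a" "0 \<le> a"
    using clock_finite[OF cl t] by (auto simp: a_def)
  have m1: "(\<lambda>s. disc_rate V A s w) \<in> borel_measurable borel"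
    using \<Omega> by (intro disc_rate_measurable[OF A aug_extension_aug V]) auto
  have m2: "(\<lambda>s. disc_rate V A s (pr_shift X t w)) \<in> borel_measurable borel"
    using shift_space[OF \<Omega>] by (intro disc_rate_measurable[OF A aug_extension_aug V]) auto
  have shift: "disc t * disc_rate V A s (pr_shift X t w) = indicator {0..} s * disc_rate V A (a + 1 * s) w" for s
  proof (cases "0 \<le> s")
    case True
    have eq: "inv_time A s (pr_shift X t w) + t = inv_time A (a + s) w"
      using path_inv_shift[OF cl t True cl' add] by (simp add: inv_time_def a_def add.commute)
    show ?thesis
    proof (cases "inv_time A s (pr_shift X t w) < \<infinity>")
      case fin: True
      have "disc (inv_time A (a + s) w) = disc t * disc (inv_time A s (pr_shift X t w))"
        unfolding eq[symmetric] using disc_add[OF fin t] by (simp add: mult.commute)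
      then show ?thesis using True Aa(2)
        by (simp add: disc_rate_def at_shift[OF \<Omega>] eq mult.assoc)
    next
      case False
      then have *: "inv_time A s (pr_shift X t w) = \<infinity>" by (simp add: less_top[symmetric])
      then have "inv_time A (a + s) w = \<infinity>" using eq by simp
      then show ?thesis using * by (simp add: disc_rate_def disc_def)
    qed
  qed (simp add: disc_rate_def)
  have "disc t * disc_total V A (pr_shift X t w) = (\<integral>\<^sup>+s. disc t * disc_rate V A s (pr_shift X t w) \<partial>lborel)"
    unfolding disc_total_def using m2 by (subst nn_integral_cmult) auto
  also have "\<dots> = (\<integral>\<^sup>+s. indicator {a..} (a + 1 * s) * disc_rate V A (a + 1 * s) w \<partial>lborel)"
    unfolding shift by (intro nn_integral_cong) (auto simp: indicator_def)
  also have "\<dots> = (\<integral>\<^sup>+s. indicator {a..} s * disc_rate V A s w \<partial>lborel)"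
    using m1 by (subst (2) nn_integral_real_affine[where c=1 and t=a]) auto
  also have "\<dots> = (\<integral>\<^sup>+s. disc_rate V A s w * indicator {s. t \<le> inv_time A s w} s \<partial>lborel)"
  proof (intro nn_integral_cong)
    fix s
    have "t \<le> inv_time A s w \<longleftrightarrow> a \<le> s" if "0 \<le> s"
      using path_inv_le_iff[OF cl t, of s] that Aa by (simp add: inv_time_def)
    then show "indicator {a..} s * disc_rate V A s w = disc_rate V A s w * indicator {s. t \<le> inv_time A s w} s"
      by (auto simp: disc_rate_def indicator_def)
  qed
  finally show ?thesis .
qed

end

section \<open>Second moments of discounted masses\<close>

text \<open>The absolute difference: for finite arguments at most one of the truncated differences
  is nonzero.\<close>

definition ennreal_dist :: "ennreal \<Rightarrow> ennreal \<Rightarrow> ennreal" where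
  "ennreal_dist a b = (a - b) + (b - a)"

lemma ennreal_dist_measurable [measurable (raw)]:
  assumes [measurable]: "f \<in> borel_measurable M" "g \<in> borel_measurable M"
  shows "(\<lambda>x. ennreal_dist (f x) (g x)) \<in> borel_measurable M"
  unfolding ennreal_dist_def by measurable

lemma ennreal_dist_ennreal:
  "0 \<le> a \<Longrightarrow> 0 \<le> b \<Longrightarrow> ennreal_dist (ennreal a) (ennreal b) = ennreal \<bar>a - b\<bar>"
  unfolding ennreal_dist_def
  by (cases "a \<le> b") (simp_all add: ennreal_minus ennreal_neg)

lemma le_add_ennreal_dist: "b \<le> a + ennreal_dist a b"
proof -
  have "b \<le> a + (b - a)"
  proof (cases a; cases b)
    fix r s assume *: "a = ennreal r" "0 \<le> r" "b = ennreal s" "0 \<le> s"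
    show ?thesis
      using * by (cases "s \<le> r") (simp_all add: ennreal_minus ennreal_neg ennreal_leI ennreal_plus[symmetric] del: ennreal_plus)
  qed auto
  also have "\<dots> \<le> a + ennreal_dist a b" unfolding ennreal_dist_def by (intro add_left_mono) simp
  finally show ?thesis .
qed

text \<open>This is \<open>2 \<eta> |a - b| \<le> \<eta>^2 + (a - b)^2\<close>, with the mixed
  product moved to the left so that it contains no subtraction of squares and survives infinite
  values.\<close>

lemma ennreal_dist_young:
  assumes "0 < \<eta>"
  shows "ennreal (2 * \<eta>) * ennreal_dist a b + 2 * (a * b) \<le> ennreal (\<eta>\<^sup>2) + (a * a + b * b)"
proof (cases a; cases b)
  fix r s assume a: "a = ennreal r" "0 \<le> r" and b: "b = ennreal s" "0 \<le> s"
  have "2 * \<eta> * \<bar>r - s\<bar> + 2 * (r * s) \<le> \<eta>\<^sup>2 + (r * r + s * s)"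
    using zero_le_power2[of "\<bar>r - s\<bar> - \<eta>"] by (simp add: power2_eq_square algebra_simps abs_mult_self_eq)
  then have "ennreal (2 * \<eta> * \<bar>r - s\<bar> + 2 * (r * s)) \<le> ennreal (\<eta>\<^sup>2 + (r * r + s * s))"
    by (rule ennreal_leI)
  then show ?thesis using a b assms
    by (simp add: ennreal_dist_ennreal ennreal_plus[symmetric] ennreal_mult[symmetric] ennreal_numeral[symmetric]
        del: ennreal_plus ennreal_numeral)
qed (auto simp: ennreal_top_mult)

text \<open>A bound \<open>K\<close> on the mean square difference gives a bound on the mean
  difference for every \<open>\<eta>\<close>. Finiteness of the mixed moment permits its
  cancellation from both sides.\<close>

lemma nn_integral_ennreal_dist_le:
  assumes "prob_space M" and [measurable]: "f \<in> borel_measurable M" "g \<in> borel_measurable M"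
    and le: "(\<integral>\<^sup>+x. f x * f x \<partial>M) + (\<integral>\<^sup>+x. g x * g x \<partial>M) \<le> 2 * (\<integral>\<^sup>+x. f x * g x \<partial>M) + ennreal K"
    and fin: "(\<integral>\<^sup>+x. f x * g x \<partial>M) < \<infinity>" and "0 < \<eta>" "0 \<le> K"
  shows "(\<integral>\<^sup>+x. ennreal_dist (f x) (g x) \<partial>M) \<le> ennreal ((\<eta> + K / \<eta>) / 2)"
proof -
  interpret prob_space M by fact
  let ?I = "\<integral>\<^sup>+x. ennreal_dist (f x) (g x) \<partial>M" and ?J = "\<integral>\<^sup>+x. f x * g x \<partial>M"
  have "ennreal (2 * \<eta>) * ?I + 2 * ?J = (\<integral>\<^sup>+x. ennreal (2 * \<eta>) * ennreal_dist (f x) (g x) + 2 * (f x * g x) \<partial>M)"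
    by (simp add: nn_integral_add nn_integral_cmult)
  also have "\<dots> \<le> (\<integral>\<^sup>+x. ennreal (\<eta>\<^sup>2) + (f x * f x + g x * g x) \<partial>M)"
    by (intro nn_integral_mono ennreal_dist_young assms)
  also have "\<dots> = ennreal (\<eta>\<^sup>2) + ((\<integral>\<^sup>+x. f x * f x \<partial>M) + (\<integral>\<^sup>+x. g x * g x \<partial>M))"
    by (simp add: nn_integral_add emeasure_space_1)
  also have "\<dots> \<le> ennreal (\<eta>\<^sup>2) + (2 * ?J + ennreal K)" by (intro add_left_mono le)
  finally have "2 * ?J + ennreal (2 * \<eta>) * ?I \<le> 2 * ?J + ennreal (\<eta>\<^sup>2 + K)"
    using \<open>0 \<le> K\<close> by (simp add: ennreal_plus ac_simps)
  moreover have "2 * ?J \<noteq> \<top>" using fin by (simp add: ennreal_mult_eq_top_iff)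
  ultimately have *: "ennreal (2 * \<eta>) * ?I \<le> ennreal (\<eta>\<^sup>2 + K)"
    by (simp add: ennreal_add_left_cancel_le)
  then have "ennreal (2 * \<eta>) * ?I < \<top>" by (rule order.strict_trans1) simp
  then have "?I < \<top>" using \<open>0 < \<eta>\<close> by (auto simp: ennreal_mult_less_top)
  then obtain i where i: "?I = ennreal i" "0 \<le> i" by (cases ?I) auto
  have "2 * \<eta> * i \<le> \<eta>\<^sup>2 + K"
    using * i \<open>0 < \<eta>\<close> \<open>0 \<le> K\<close>
    by (simp add: ennreal_mult[symmetric] ennreal_le_iff del: ennreal_plus)
  then have "i \<le> (\<eta> + K / \<eta>) / 2" using \<open>0 < \<eta>\<close> by (simp add: field_simps power2_eq_square)
  then show ?thesis unfolding i(1) by (rule ennreal_leI)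
qed

context standard_markov
begin

lemma rate_remaining_measurable:
  assumes A: "pcaf X A" and A': "pcaf X A'" and N: "aug_extension N" and V: "open V"
  shows "(\<lambda>(s, w). \<integral>\<^sup>+s'. disc_rate V A' s' w * indicator {s'. inv_time A s w \<le> inv_time A' s' w} s' \<partial>lborel)
    \<in> borel_measurable (lborel \<Otimes>\<^sub>M N)"
proof -
  let ?M = "(lborel \<Otimes>\<^sub>M N) \<Otimes>\<^sub>M (lborel :: real measure)"
  have [measurable]: "(\<lambda>z. disc_rate V A' (snd z) (snd (fst z))) \<in> borel_measurable ?M"
    "(\<lambda>z. inv_time A (fst (fst z)) (snd (fst z))) \<in> borel_measurable ?M"
    "(\<lambda>z. inv_time A' (snd z) (snd (fst z))) \<in> borel_measurable ?M"
    by (rule disc_rate_measurable[OF A' N V] inv_time_measurable[OF A N] inv_time_measurable[OF A' N]; measurable)+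
  have "(\<lambda>z. disc_rate V A' (snd z) (snd (fst z)) *
      indicator {z. inv_time A (fst (fst z)) (snd (fst z)) \<le> inv_time A' (snd z) (snd (fst z))} z) \<in> borel_measurable ?M"
    by measurable
  also have "(\<lambda>z. disc_rate V A' (snd z) (snd (fst z)) *
      indicator {z. inv_time A (fst (fst z)) (snd (fst z)) \<le> inv_time A' (snd z) (snd (fst z))} z) =
     (\<lambda>(z, s'). disc_rate V A' s' (snd z) * indicator {s'. inv_time A (fst z) (snd z) \<le> inv_time A' s' (snd z)} s')"
    by (auto simp: fun_eq_iff indicator_def)
  finally show ?thesis
    unfolding case_prod_beta by (intro lborel.borel_measurable_nn_integral) (simp add: case_prod_beta)
qed

text \<open>
  At the stopping time \<open>inv_time A s\<close> the mass of \<open>A'\<close> still to come has conditional expectation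
  \<open>e\<^sup>-\<^sup>t\<close> times the 1-potential of \<open>\<mu>'\<close>; the two discount factors combine to \<open>r\<^sub>2\<close>.
\<close>

lemma expectation_ordered_product:
  assumes c: "conservative X" and d: "dual_density X Xh m p" and V: "open V"
    and A: "pcaf X A" "revuz_corr X p A \<mu>" "sets \<mu> = sets borel"
    and A': "pcaf X A'" "revuz_corr X p A' \<mu>'" "sets \<mu>' = sets borel"
    and fin': "finite_measure (restr \<mu>' V)"
  shows "(\<integral>\<^sup>+w. (\<integral>\<^sup>+s. disc_rate V A s w *
      (\<integral>\<^sup>+s'. disc_rate V A' s' w * indicator {s'. inv_time A s w \<le> inv_time A' s' w} s' \<partial>lborel) \<partial>lborel) \<partial>PC (Some x)) =
    (\<integral>\<^sup>+y. res_dens p 2 x y * potential p 1 (restr \<mu>' V) y \<partial>restr \<mu> V)"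
proof -
  let ?M = "PC (Some x)"
  let ?u = "potential p 1 (restr \<mu>' V)"
  define K where "K s w = (\<integral>\<^sup>+s'. disc_rate V A' s' w * indicator {s'. inv_time A s w \<le> inv_time A' s' w} s' \<partial>lborel)" for s w
  interpret M: prob_space ?M by (rule prob_space_completion_law)
  interpret P: pair_sigma_finite "lborel :: real measure" ?M ..
  have Vb: "V \<in> sets borel" using V by simp
  have u [measurable]: "?u \<in> borel_measurable borel"
    by (rule potential_measurable[OF d _ fin']) (simp add: restr_def A')
  have [measurable]: "(\<lambda>z. K (fst z) (snd z)) \<in> borel_measurable (lborel \<Otimes>\<^sub>M ?M)"
    using rate_remaining_measurable[OF A(1) A'(1) aug_extension_completion V, of "Some x"]
    unfolding K_def by (simp add: case_prod_beta)
  have [measurable]: "(\<lambda>z. disc_rate V A (fst z) (snd z)) \<in> borel_measurable (lborel \<Otimes>\<^sub>M ?M)"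
    "(\<lambda>z. inv_time A (fst z) (snd z)) \<in> borel_measurable (lborel \<Otimes>\<^sub>M ?M)"
    "(\<lambda>z. pr_at X (inv_time A (fst z) (snd z)) (snd z)) \<in> lborel \<Otimes>\<^sub>M ?M \<rightarrow>\<^sub>M cem_borel"
    by (rule disc_rate_measurable[OF A(1) aug_extension_completion V] inv_time_measurable[OF A(1) aug_extension_completion]
       at_inv_time_measurable[OF A(1) aug_extension_completion]; measurable)+
  have reg: "AE w in ?M. w \<in> regular_paths A'"
    using AE_regular_paths[OF A'(1) c] by (simp add: AE_completion_iff)
  have step: "(\<integral>\<^sup>+w. disc_rate V A s w * K s w \<partial>?M) =
      (\<integral>\<^sup>+w. disc_rate V A s w * disc (inv_time A s w) * ext0 ?u (pr_at X (inv_time A s w) w) \<partial>?M)" for s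
  proof -
    let ?T = "inv_time A s"
    have "AE w in ?M. disc_rate V A s w * K s w =
        (disc_rate V A s w * disc (?T w)) * (disc_total V A' (pr_shift X (?T w) w) * alive ?T w)"
      using reg
    proof eventually_elim
      case (elim w)
      then have \<Omega>: "w \<in> \<Omega>" by (simp add: regular_paths_def)
      show ?case
      proof (cases "?T w < \<infinity>")
        case True
        then show ?thesis
          using disc_total_shift[OF elim A'(1) V True] \<Omega> by (simp add: K_def mult.assoc)
      next
        case False
        then have "?T w = \<infinity>" by (simp add: less_top[symmetric])
        then show ?thesis by (simp add: disc_rate_def disc_def)
      qed
    qed
    then have "(\<integral>\<^sup>+w. disc_rate V A s w * K s w \<partial>?M) = (\<integral>\<^sup>+w. (disc_rate V A s w * disc (?T w)) *
        (disc_total V A' (pr_shift X (?T w) w) * alive ?T w) \<partial>?M)"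
      by (rule nn_integral_cong_AE)
    also have "\<dots> = (\<integral>\<^sup>+w. (disc_rate V A s w * disc (?T w)) *
        (restart (disc_total V A') ?T w * alive ?T w) \<partial>?M)"
      by (rule strong_markov(2)[OF inv_time_stopping_time[OF A(1)] disc_total_measurable[OF A'(1) aug_extension_aug V]
            disc_rate_pre_sigma[OF A(1) V]])
    also have "\<dots> = (\<integral>\<^sup>+w. disc_rate V A s w * disc (?T w) * ext0 ?u (pr_at X (?T w) w) \<partial>?M)"
    proof (intro nn_integral_cong)
      fix w assume "w \<in> space ?M"
      then have \<Omega>: "w \<in> \<Omega>" by simp
      show "(disc_rate V A s w * disc (?T w)) *
        (restart (disc_total V A') ?T w * alive ?T w) =
        disc_rate V A s w * disc (?T w) * ext0 ?u (pr_at X (?T w) w)"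
      proof (cases "?T w < \<infinity>")
        case True
        then show ?thesis using \<Omega> expectation_disc_total[OF c A'(1,2) d A'(3) V]
          by (cases "pr_at X (?T w) w") (auto simp: disc_rate_def ext0_def)
      qed (simp add: disc_def)
    qed
    finally show ?thesis .
  qed
  \<comment> \<open>The strong Markov property acts at one fixed level \<open>s\<close>. Fubini
    brings the level integral outside for this and back inside for the Revuz formula of
    \<open>A\<close>.\<close>
  have "(\<integral>\<^sup>+w. (\<integral>\<^sup>+s. disc_rate V A s w * K s w \<partial>lborel) \<partial>?M) = (\<integral>\<^sup>+s. (\<integral>\<^sup>+w. disc_rate V A s w * K s w \<partial>?M) \<partial>lborel)"
    by (rule P.Fubini') (simp add: case_prod_beta)
  also have "\<dots> = (\<integral>\<^sup>+s. (\<integral>\<^sup>+w. disc_rate V A s w * disc (inv_time A s w) * ext0 ?u (pr_at X (inv_time A s w) w) \<partial>?M) \<partial>lborel)"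
    unfolding step ..
  also have "\<dots> = (\<integral>\<^sup>+w. (\<integral>\<^sup>+s. disc_rate V A s w * disc (inv_time A s w) * ext0 ?u (pr_at X (inv_time A s w) w) \<partial>lborel) \<partial>?M)"
    by (rule P.Fubini'[symmetric]) (simp add: case_prod_beta)
  also have "\<dots> = (\<integral>\<^sup>+w. (\<integral>\<^sup>+s. indicator {0..} s * (if inv_time A s w < \<infinity>
        then ennreal (exp (- 2 * enn2real (inv_time A s w))) *
          ext0 (\<lambda>y. indicator V y * ?u y) (pr_at X (inv_time A s w) w) else 0) \<partial>lborel) \<partial>?M)"
  proof (intro nn_integral_cong)
    fix w s
    have "disc t * disc t = (if t < \<infinity> then ennreal (exp (- 2 * enn2real t)) else 0)" for t
      by (simp add: disc_def ennreal_mult[symmetric] exp_add[symmetric])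
    note dd = this
    have "disc_rate V A s w * disc (inv_time A s w) * ext0 ?u (pr_at X (inv_time A s w) w) =
        indicator {0..} s * ((disc (inv_time A s w) * disc (inv_time A s w)) *
          (indicator (Some ` V) (pr_at X (inv_time A s w) w) * ext0 ?u (pr_at X (inv_time A s w) w)))"
      by (simp add: disc_rate_def ac_simps)
    also have "indicator (Some ` V) (pr_at X (inv_time A s w) w) * ext0 ?u (pr_at X (inv_time A s w) w) =
        ext0 (\<lambda>y. indicator V y * ?u y) (pr_at X (inv_time A s w) w)"
      by (auto simp: ext0_def indicator_def split: option.splits)
    finally show "disc_rate V A s w * disc (inv_time A s w) * ext0 ?u (pr_at X (inv_time A s w) w) =
      indicator {0..} s * (if inv_time A s w < \<infinity>
        then ennreal (exp (- 2 * enn2real (inv_time A s w))) *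
          ext0 (\<lambda>y. indicator V y * ?u y) (pr_at X (inv_time A s w) w) else 0)"
      unfolding dd by simp
  qed
  also have "\<dots> = (\<integral>\<^sup>+y. res_dens p 2 x y * (indicator V y * ?u y) \<partial>\<mu>)"
    using Vb by (intro revuz_time_change[OF c A(1,2)]) auto
  also have "\<dots> = (\<integral>\<^sup>+y. res_dens p 2 x y * ?u y \<partial>restr \<mu> V)"
    by (rule potential_restr[OF d A(3) Vb u, symmetric])
  finally show ?thesis unfolding K_def .
qed

text \<open>
  The product measure is split along the diagonal, which is null because \<open>A\<close> has no atoms.
\<close>

lemma disc_total_product:
  assumes A: "pcaf X A" and A': "pcaf X A'" and V: "open V"
    and w: "w \<in> regular_paths A"
  shows "disc_total V A w * disc_total V A' w =
    (\<integral>\<^sup>+s. disc_rate V A s w *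
      (\<integral>\<^sup>+s'. disc_rate V A' s' w * indicator {s'. inv_time A s w \<le> inv_time A' s' w} s' \<partial>lborel) \<partial>lborel) +
    (\<integral>\<^sup>+s'. disc_rate V A' s' w *
      (\<integral>\<^sup>+s. disc_rate V A s w * indicator {s. inv_time A' s' w \<le> inv_time A s w} s \<partial>lborel) \<partial>lborel)"
proof -
  have \<Omega>: "w \<in> \<Omega>" and cl: "clock (\<lambda>t. A t w)" using w by (auto simp: regular_paths_def)
  have const: "(\<lambda>z. w) \<in> N \<rightarrow>\<^sub>M aug_filt X \<infinity>" for N :: "'b measure" using \<Omega> by simp
  have [measurable]: "(\<lambda>z. disc_rate V A (f z) w) \<in> borel_measurable N" "(\<lambda>z. disc_rate V A' (f z) w) \<in> borel_measurable N"
    "(\<lambda>z. inv_time A (f z) w) \<in> borel_measurable N" "(\<lambda>z. inv_time A' (f z) w) \<in> borel_measurable N"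
    if "f \<in> borel_measurable N" for N :: "'b measure" and f
    using that const[of N] by (auto intro!: disc_rate_measurable[OF A aug_extension_aug V] disc_rate_measurable[OF A' aug_extension_aug V]
      inv_time_measurable[OF A aug_extension_aug] inv_time_measurable[OF A' aug_extension_aug])
  let ?G = "\<lambda>s. disc_rate V A s w" and ?G' = "\<lambda>s. disc_rate V A' s w"
  let ?t = "\<lambda>s. inv_time A s w" and ?t' = "\<lambda>s. inv_time A' s w"
  have "disc_total V A w * disc_total V A' w = (\<integral>\<^sup>+s. ?G s * (\<integral>\<^sup>+s'. ?G' s' \<partial>lborel) \<partial>lborel)"
    unfolding disc_total_def by (subst nn_integral_multc) auto
  also have "\<dots> = (\<integral>\<^sup>+s. ?G s * (\<integral>\<^sup>+s'. ?G' s' * indicator {s'. ?t s \<le> ?t' s'} s' \<partial>lborel) +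
      ?G s * (\<integral>\<^sup>+s'. ?G' s' * indicator {s'. ?t' s' < ?t s} s' \<partial>lborel) \<partial>lborel)"
  proof (intro nn_integral_cong)
    fix s
    have "(\<integral>\<^sup>+s'. ?G' s' \<partial>lborel) = (\<integral>\<^sup>+s'. ?G' s' * indicator {s'. ?t s \<le> ?t' s'} s' + ?G' s' * indicator {s'. ?t' s' < ?t s} s' \<partial>lborel)"
      by (intro nn_integral_cong) (auto simp: indicator_def)
    also have "\<dots> = (\<integral>\<^sup>+s'. ?G' s' * indicator {s'. ?t s \<le> ?t' s'} s' \<partial>lborel) + (\<integral>\<^sup>+s'. ?G' s' * indicator {s'. ?t' s' < ?t s} s' \<partial>lborel)"
      by (intro nn_integral_add) measurable
    finally show "?G s * (\<integral>\<^sup>+s'. ?G' s' \<partial>lborel) = ?G s * (\<integral>\<^sup>+s'. ?G' s' * indicator {s'. ?t s \<le> ?t' s'} s' \<partial>lborel) +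
      ?G s * (\<integral>\<^sup>+s'. ?G' s' * indicator {s'. ?t' s' < ?t s} s' \<partial>lborel)"
      by (simp add: distrib_left)
  qed
  also have "\<dots> = (\<integral>\<^sup>+s. ?G s * (\<integral>\<^sup>+s'. ?G' s' * indicator {s'. ?t s \<le> ?t' s'} s' \<partial>lborel) \<partial>lborel) +
      (\<integral>\<^sup>+s. ?G s * (\<integral>\<^sup>+s'. ?G' s' * indicator {s'. ?t' s' < ?t s} s' \<partial>lborel) \<partial>lborel)"
    by (intro nn_integral_add) measurable
  also have "(\<integral>\<^sup>+s. ?G s * (\<integral>\<^sup>+s'. ?G' s' * indicator {s'. ?t' s' < ?t s} s' \<partial>lborel) \<partial>lborel) =
      (\<integral>\<^sup>+s. (\<integral>\<^sup>+s'. ?G s * (?G' s' * indicator {s'. ?t' s' < ?t s} s') \<partial>lborel) \<partial>lborel)"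
    by (intro nn_integral_cong nn_integral_cmult[symmetric]) measurable
  also have "\<dots> = (\<integral>\<^sup>+s'. (\<integral>\<^sup>+s. ?G s * (?G' s' * indicator {s'. ?t' s' < ?t s} s') \<partial>lborel) \<partial>lborel)"
    by (rule lborel_pair.Fubini') (simp add: case_prod_beta indicator_def)
  also have "\<dots> = (\<integral>\<^sup>+s'. ?G' s' * (\<integral>\<^sup>+s. ?G s * indicator {s. ?t' s' \<le> ?t s} s \<partial>lborel) \<partial>lborel)"
  proof (intro nn_integral_cong)
    fix s'
    show "(\<integral>\<^sup>+s. ?G s * (?G' s' * indicator {s'. ?t' s' < ?t s} s') \<partial>lborel) =
      ?G' s' * (\<integral>\<^sup>+s. ?G s * indicator {s. ?t' s' \<le> ?t s} s \<partial>lborel)"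
    proof (cases "?t' s' < \<infinity>")
      case True
      \<comment> \<open>The level of \<open>A\<close> at the time of the other functional is the
        only nonnegative \<open>s\<close> for which the two inverse times can coincide.\<close>
      have "AE s in lborel. s \<noteq> enn2real (A (?t' s') w)" by (rule AE_lborel_singleton)
      then have "AE s in lborel. ?G s * (?G' s' * indicator {s'. ?t' s' < ?t s} s') =
          ?G' s' * (?G s * indicator {s. ?t' s' \<le> ?t s} s)"
      proof eventually_elim
        case (elim s)
        show ?case
        proof (cases "0 \<le> s")
          case s: True
          have "?t s \<noteq> ?t' s'"
          proof
            assume "?t s = ?t' s'"
            then have "A (?t' s') w = ennreal s"
              using path_inv_eq_imp[OF cl True] by (simp add: inv_time_def)
            then show False using elim s by simp
          qed
          then show ?thesis by (auto simp: indicator_def ac_simps)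
        qed (simp add: disc_rate_def)
      qed
      then have "(\<integral>\<^sup>+s. ?G s * (?G' s' * indicator {s'. ?t' s' < ?t s} s') \<partial>lborel) =
        (\<integral>\<^sup>+s. ?G' s' * (?G s * indicator {s. ?t' s' \<le> ?t s} s) \<partial>lborel)"
        by (rule nn_integral_cong_AE)
      also have "\<dots> = ?G' s' * (\<integral>\<^sup>+s. ?G s * indicator {s. ?t' s' \<le> ?t s} s \<partial>lborel)"
        by (rule nn_integral_cmult) measurable
      finally show ?thesis .
    next
      case False
      then have "?G' s' = 0" by (simp add: disc_rate_def disc_def)
      then show ?thesis by simp
    qed
  qed
  finally show ?thesis .
qed

end

section \<open>Uniform mean distance of discounted masses\<close>

lemma res_dens_antimono:
  assumes "\<alpha> \<le> \<beta>"
  shows "res_dens p \<beta> x y \<le> res_dens p \<alpha> x y"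
  unfolding res_dens_def
  using assms by (intro nn_integral_mono) (auto simp: indicator_def intro!: mult_right_mono ennreal_leI)

text \<open>From \<open>a1 - b1 = (a - b) - c (a2 - b2)\<close> with \<open>c \<le> 1\<close>.
  Positivity of \<open>c\<close> lets finiteness of \<open>a\<close> and \<open>b\<close> pass to
  \<open>a2\<close> and \<open>b2\<close>. It is meant for a total mass split at time t, with c the
  discount factor.\<close>

lemma ennreal_dist_split_le:
  assumes a: "a = a1 + c * a2" "a < \<infinity>" and b: "b = b1 + c * b2" "b < \<infinity>" and c: "0 < c" "c \<le> 1"
  shows "ennreal_dist a1 b1 \<le> ennreal_dist a b + ennreal_dist a2 b2"
proof -
  from c obtain c' where c': "c = ennreal c'" "0 < c'" "c' \<le> 1"
    by (cases c) (auto simp: ennreal_le_1 top_unique)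
  have "a1 < \<top>" "c * a2 < \<top>" "b1 < \<top>" "c * b2 < \<top>" using a b by (auto simp: less_top[symmetric])
  then have "a2 < \<top>" "b2 < \<top>" using c by (auto simp: ennreal_mult_less_top)
  with \<open>a1 < \<top>\<close> \<open>b1 < \<top>\<close> obtain x1 x2 y1 y2 where
    *: "a1 = ennreal x1" "a2 = ennreal x2" "b1 = ennreal y1" "b2 = ennreal y2" "0 \<le> x1" "0 \<le> x2" "0 \<le> y1" "0 \<le> y2"
    by (cases a1; cases a2; cases b1; cases b2) auto
  have ab: "a = ennreal (x1 + c' * x2)" "b = ennreal (y1 + c' * y2)"
    using a b c' * by (simp_all add: ennreal_mult)
  have "\<bar>x1 - y1\<bar> \<le> \<bar>(x1 + c' * x2) - (y1 + c' * y2)\<bar> + \<bar>c' * (x2 - y2)\<bar>" by (simp add: algebra_simps)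
  also have "\<bar>c' * (x2 - y2)\<bar> \<le> \<bar>x2 - y2\<bar>"
    using c' mult_right_mono[of c' 1 "\<bar>x2 - y2\<bar>"] by (simp add: abs_mult)
  finally show ?thesis unfolding ab *(1-4) using * c'
    by (simp add: ennreal_dist_ennreal ennreal_plus[symmetric] ennreal_leI del: ennreal_plus)
qed

context standard_markov
begin

text \<open>One term for each order of the two time points. The instance with equal functionals
  gives the second moments.\<close>

lemma expectation_product:
  assumes c: "conservative X" and d: "dual_density X Xh m p" and V: "open V"
    and A: "pcaf X A" "revuz_corr X p A \<mu>" "sets \<mu> = sets borel" "finite_measure (restr \<mu> V)"
    and A': "pcaf X A'" "revuz_corr X p A' \<mu>'" "sets \<mu>' = sets borel" "finite_measure (restr \<mu>' V)"
  shows "(\<integral>\<^sup>+w. disc_total V A w * disc_total V A' w \<partial>P (Some x)) =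
    (\<integral>\<^sup>+y. res_dens p 2 x y * potential p 1 (restr \<mu>' V) y \<partial>restr \<mu> V) +
    (\<integral>\<^sup>+y. res_dens p 2 x y * potential p 1 (restr \<mu> V) y \<partial>restr \<mu>' V)"
proof -
  let ?M = "PC (Some x)"
  let ?I = "\<lambda>A A' w. \<integral>\<^sup>+s. disc_rate V A s w *
      (\<integral>\<^sup>+s'. disc_rate V A' s' w * indicator {s'. inv_time A s w \<le> inv_time A' s' w} s' \<partial>lborel) \<partial>lborel"
  have m: "?I A A' \<in> borel_measurable ?M" if A: "pcaf X A" and A': "pcaf X A'" for A A'
  proof -
    note rate_remaining_measurable[OF A A' aug_extension_completion V, of "Some x"]
    from measurable_compose[OF measurable_pair_swap' this]
    have [measurable]: "(\<lambda>z. \<integral>\<^sup>+s'. disc_rate V A' s' (fst z) *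
        indicator {s'. inv_time A (snd z) (fst z) \<le> inv_time A' s' (fst z)} s' \<partial>lborel) \<in> borel_measurable (?M \<Otimes>\<^sub>M lborel)"
      by (simp add: case_prod_beta)
    have [measurable]: "(\<lambda>z. disc_rate V A (snd z) (fst z)) \<in> borel_measurable (?M \<Otimes>\<^sub>M lborel)"
      by (rule disc_rate_measurable[OF A aug_extension_completion V]) measurable
    show ?thesis
      by (intro lborel.borel_measurable_nn_integral) (simp add: case_prod_beta)
  qed
  have "AE w in ?M. w \<in> regular_paths A"
    using AE_regular_paths[OF A(1) c] by (simp add: AE_completion_iff)
  then have "(\<integral>\<^sup>+w. disc_total V A w * disc_total V A' w \<partial>?M) = (\<integral>\<^sup>+w. ?I A A' w + ?I A' A w \<partial>?M)"
    by (intro nn_integral_cong_AE) (auto elim!: eventually_mono intro!: disc_total_product A A' V)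
  also have "\<dots> = (\<integral>\<^sup>+w. ?I A A' w \<partial>?M) + (\<integral>\<^sup>+w. ?I A' A w \<partial>?M)"
    by (intro nn_integral_add m A A')
  also have "\<dots> = (\<integral>\<^sup>+y. res_dens p 2 x y * potential p 1 (restr \<mu>' V) y \<partial>restr \<mu> V) +
    (\<integral>\<^sup>+y. res_dens p 2 x y * potential p 1 (restr \<mu> V) y \<partial>restr \<mu>' V)"
    using expectation_ordered_product[OF c d V A(1-3) A'] expectation_ordered_product[OF c d V A'(1-3) A] by simp
  finally show ?thesis by (simp add: nn_integral_completion)
qed

text \<open>The mean square difference is
  \<open>2 R_2((u - u') \<mu>^V)(x) + 2 R_2((u' - u) \<mu>'^V)(x)\<close>, so a one-sided comparison
  is needed under each of the two measures. The bounds \<open>b\<close> and \<open>b'\<close> serve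
  to make the mixed moment finite.\<close>

lemma L1_dist_disc_total:
  assumes c: "conservative X" and d: "dual_density X Xh m p" and V: "open V"
    and A: "pcaf X A" "revuz_corr X p A \<mu>" "sets \<mu> = sets borel" "finite_measure (restr \<mu> V)"
    and A': "pcaf X A'" "revuz_corr X p A' \<mu>'" "sets \<mu>' = sets borel" "finite_measure (restr \<mu>' V)"
    and bd: "\<And>y. potential p 1 (restr \<mu> V) y \<le> ennreal b" "0 \<le> b"
    and bd': "\<And>y. potential p 1 (restr \<mu>' V) y \<le> ennreal b'" "0 \<le> b'"
    and \<delta>: "0 < \<delta>"
    and close: "AE y in restr \<mu> V. potential p 1 (restr \<mu> V) y \<le> potential p 1 (restr \<mu>' V) y + ennreal \<delta>"
    and close': "AE y in restr \<mu>' V. potential p 1 (restr \<mu>' V) y \<le> potential p 1 (restr \<mu> V) y + ennreal \<delta>"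
  shows "(\<integral>\<^sup>+w. ennreal_dist (disc_total V A w) (disc_total V A' w) \<partial>P (Some x)) \<le>
    ennreal (sqrt \<delta> / 2 + sqrt \<delta> * (enn2real (potential p 1 (restr \<mu> V) x) + enn2real (potential p 1 (restr \<mu>' V) x)))"
proof -
  let ?M = "PC (Some x)" and ?\<mu> = "restr \<mu> V" and ?\<mu>' = "restr \<mu>' V"
  let ?u = "potential p 1 ?\<mu>" and ?u' = "potential p 1 ?\<mu>'"
  let ?C = "disc_total V A" and ?C' = "disc_total V A'"
  have s: "sets ?\<mu> = sets borel" "sets ?\<mu>' = sets borel" using A A' by (simp_all add: restr_def)
  have u: "?u \<in> borel_measurable borel" "?u' \<in> borel_measurable borel"
    using potential_measurable[OF d s(1) A(4)] potential_measurable[OF d s(2) A'(4)] by auto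
  have r: "res_dens p \<alpha> x \<in> borel_measurable borel" for \<alpha>
    using measurable_compose[OF measurable_Pair1'[of x borel] res_dens_measurable[OF d]] by simp
  have [measurable]: "?u \<in> borel_measurable ?\<mu>" "?u' \<in> borel_measurable ?\<mu>" "res_dens p \<alpha> x \<in> borel_measurable ?\<mu>"
    "?u \<in> borel_measurable ?\<mu>'" "?u' \<in> borel_measurable ?\<mu>'" "res_dens p \<alpha> x \<in> borel_measurable ?\<mu>'" for \<alpha>
    using u r measurable_cong_sets[OF s(1) refl] measurable_cong_sets[OF s(2) refl] by blast+
  have fin: "?u x < \<top>" "?u' x < \<top>"
    using bd(1)[of x] bd'(1)[of x] by (auto intro: order.strict_trans1)
  \<comment> \<open>\<open>K\<close> bounds the mean square difference.\<close>
  define K where "K = 2 * \<delta> * (enn2real (?u x) + enn2real (?u' x))"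
  have K0: "0 \<le> K" using \<delta> by (simp add: K_def)
  have K: "ennreal K = 2 * (ennreal \<delta> * ?u x + ennreal \<delta> * ?u' x)"
    unfolding K_def using \<delta> fin by (simp add: ennreal_mult distrib_left ennreal_plus mult.assoc)
  \<comment> \<open>Only the error term is enlarged from \<open>r_2\<close> to \<open>r_1\<close>,
    which turns it into a multiple of the 1-potential. The main terms keep \<open>r_2\<close>, so
    that they match those of the mixed moment.\<close>
  have cmp: "(\<integral>\<^sup>+y. res_dens p 2 x y * v y \<partial>\<nu>) \<le> (\<integral>\<^sup>+y. res_dens p 2 x y * v' y \<partial>\<nu>) + ennreal \<delta> * potential p 1 \<nu> x"
    if "AE y in \<nu>. v y \<le> v' y + ennreal \<delta>" and [measurable]: "v' \<in> borel_measurable \<nu>" "\<And>\<alpha>. res_dens p \<alpha> x \<in> borel_measurable \<nu>"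
    for \<nu> v v'
  proof -
    have "(\<integral>\<^sup>+y. res_dens p 2 x y * v y \<partial>\<nu>) \<le> (\<integral>\<^sup>+y. res_dens p 2 x y * v' y + ennreal \<delta> * res_dens p 1 x y \<partial>\<nu>)"
    proof (rule nn_integral_mono_AE)
      show "AE y in \<nu>. res_dens p 2 x y * v y \<le> res_dens p 2 x y * v' y + ennreal \<delta> * res_dens p 1 x y"
        using that(1)
      proof eventually_elim
        case (elim y)
        have "res_dens p 2 x y * v y \<le> res_dens p 2 x y * (v' y + ennreal \<delta>)" by (intro mult_left_mono elim) simp
        also have "\<dots> = res_dens p 2 x y * v' y + ennreal \<delta> * res_dens p 2 x y"
          unfolding distrib_left by (simp add: mult.commute)
        also have "\<dots> \<le> res_dens p 2 x y * v' y + ennreal \<delta> * res_dens p 1 x y"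
          by (intro add_left_mono mult_left_mono res_dens_antimono) auto
        finally show ?case .
      qed
    qed
    also have "\<dots> = (\<integral>\<^sup>+y. res_dens p 2 x y * v' y \<partial>\<nu>) + ennreal \<delta> * potential p 1 \<nu> x"
      by (simp add: nn_integral_add nn_integral_cmult potential_def)
    finally show ?thesis .
  qed
  have bound: "(\<integral>\<^sup>+y. res_dens p 2 x y * v y \<partial>\<nu>) < \<top>"
    if "\<And>y. v y \<le> ennreal k" "potential p 1 \<nu> x < \<top>" and [measurable]: "\<And>\<alpha>. res_dens p \<alpha> x \<in> borel_measurable \<nu>"
    for \<nu> v k
  proof -
    have "(\<integral>\<^sup>+y. res_dens p 2 x y * v y \<partial>\<nu>) \<le> (\<integral>\<^sup>+y. res_dens p 1 x y * ennreal k \<partial>\<nu>)"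
      by (intro nn_integral_mono mult_mono that(1) res_dens_antimono) auto
    also have "\<dots> = potential p 1 \<nu> x * ennreal k" by (simp add: nn_integral_multc potential_def)
    also have "\<dots> < \<top>" using that(2) by (simp add: ennreal_mult_less_top)
    finally show ?thesis .
  qed
  have [measurable]: "?C \<in> borel_measurable ?M" "?C' \<in> borel_measurable ?M"
    using disc_total_measurable[OF A(1) aug_extension_completion V] disc_total_measurable[OF A'(1) aug_extension_completion V] by auto
  have CC: "(\<integral>\<^sup>+w. ?C w * ?C' w \<partial>?M) =
      (\<integral>\<^sup>+y. res_dens p 2 x y * ?u' y \<partial>?\<mu>) + (\<integral>\<^sup>+y. res_dens p 2 x y * ?u y \<partial>?\<mu>')"
    using expectation_product[OF c d V A A'] by (simp add: nn_integral_completion)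
  have C2: "(\<integral>\<^sup>+w. ?C w * ?C w \<partial>?M) = 2 * (\<integral>\<^sup>+y. res_dens p 2 x y * ?u y \<partial>?\<mu>)"
    using expectation_product[OF c d V A A] by (simp add: nn_integral_completion mult_2)
  have C2': "(\<integral>\<^sup>+w. ?C' w * ?C' w \<partial>?M) = 2 * (\<integral>\<^sup>+y. res_dens p 2 x y * ?u' y \<partial>?\<mu>')"
    using expectation_product[OF c d V A' A'] by (simp add: nn_integral_completion mult_2)
  have "(\<integral>\<^sup>+w. ?C w * ?C w \<partial>?M) + (\<integral>\<^sup>+w. ?C' w * ?C' w \<partial>?M) =
      2 * ((\<integral>\<^sup>+y. res_dens p 2 x y * ?u y \<partial>?\<mu>) + (\<integral>\<^sup>+y. res_dens p 2 x y * ?u' y \<partial>?\<mu>'))"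
    unfolding C2 C2' by (simp add: distrib_left)
  also have "\<dots> \<le> 2 * (((\<integral>\<^sup>+y. res_dens p 2 x y * ?u' y \<partial>?\<mu>) + ennreal \<delta> * ?u x) +
      ((\<integral>\<^sup>+y. res_dens p 2 x y * ?u y \<partial>?\<mu>') + ennreal \<delta> * ?u' x))"
    by (intro mult_left_mono add_mono cmp close close') auto
  also have "\<dots> = 2 * (\<integral>\<^sup>+w. ?C w * ?C' w \<partial>?M) + ennreal K"
    unfolding CC K by (simp add: distrib_left ac_simps)
  finally have le: "(\<integral>\<^sup>+w. ?C w * ?C w \<partial>?M) + (\<integral>\<^sup>+w. ?C' w * ?C' w \<partial>?M) \<le>
      2 * (\<integral>\<^sup>+w. ?C w * ?C' w \<partial>?M) + ennreal K" .
  have finCC: "(\<integral>\<^sup>+w. ?C w * ?C' w \<partial>?M) < \<infinity>"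
    unfolding CC using bound[of ?u' b' ?\<mu>] bound[of ?u b ?\<mu>'] bd bd' fin by simp
  \<comment> \<open>With \<open>\<eta> = sqrt \<delta>\<close> both \<eta> and
    \<open>K / \<eta>\<close> are of order \<open>sqrt \<delta>\<close>.\<close>
  have "(\<integral>\<^sup>+w. ennreal_dist (?C w) (?C' w) \<partial>?M) \<le> ennreal ((sqrt \<delta> + K / sqrt \<delta>) / 2)"
    using \<delta> K0 by (intro nn_integral_ennreal_dist_le prob_space_completion_law le finCC) auto
  also have "(sqrt \<delta> + K / sqrt \<delta>) / 2 = sqrt \<delta> / 2 + sqrt \<delta> * (enn2real (?u x) + enn2real (?u' x))"
  proof -
    have "\<delta> / sqrt \<delta> = sqrt \<delta>" using \<delta> by (simp add: real_div_sqrt)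
    moreover have "K / sqrt \<delta> = 2 * (\<delta> / sqrt \<delta>) * (enn2real (?u x) + enn2real (?u' x))"
      by (simp add: K_def)
    ultimately have "K / sqrt \<delta> = 2 * sqrt \<delta> * (enn2real (?u x) + enn2real (?u' x))" by simp
    then show ?thesis by (simp add: add_divide_distrib)
  qed
  finally show ?thesis by (simp add: nn_integral_completion)
qed

text \<open>
  The dependence on \<open>\<mu>'\<close> is removed with \<open>R\<^sub>1\<mu>' \<le> R\<^sub>1\<mu> + E\<bar>C - C'\<bar>\<close>, where \<open>C\<close> and \<open>C'\<close> are the
  two total masses.
\<close>

lemma L1_dist_disc_total_uniform:
  assumes c: "conservative X" and d: "dual_density X Xh m p" and V: "open V"
    and A: "pcaf X A" "revuz_corr X p A \<mu>" "sets \<mu> = sets borel" "finite_measure (restr \<mu> V)"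
    and A': "pcaf X A'" "revuz_corr X p A' \<mu>'" "sets \<mu>' = sets borel" "finite_measure (restr \<mu>' V)"
    and bd: "\<And>y. potential p 1 (restr \<mu> V) y \<le> ennreal b" "0 \<le> b"
    and bd': "\<And>y. potential p 1 (restr \<mu>' V) y \<le> ennreal b'" "0 \<le> b'"
    and \<delta>: "0 < \<delta>" "\<delta> \<le> 1/4"
    and close: "AE y in restr \<mu> V. potential p 1 (restr \<mu> V) y \<le> potential p 1 (restr \<mu>' V) y + ennreal \<delta>"
    and close': "AE y in restr \<mu>' V. potential p 1 (restr \<mu>' V) y \<le> potential p 1 (restr \<mu> V) y + ennreal \<delta>"
  shows "(\<integral>\<^sup>+w. ennreal_dist (disc_total V A w) (disc_total V A' w) \<partial>P (Some x)) \<le>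
    ennreal (sqrt \<delta> * (1 + 4 * b))"
proof -
  let ?M = "PC (Some x)"
  let ?C = "disc_total V A" and ?C' = "disc_total V A'"
  let ?I = "\<integral>\<^sup>+w. ennreal_dist (?C w) (?C' w) \<partial>P (Some x)"
  obtain u where u: "potential p 1 (restr \<mu> V) x = ennreal u" "0 \<le> u" "u \<le> b"
    using bd(1)[of x] bd(2) by (cases "potential p 1 (restr \<mu> V) x") (auto simp: ennreal_le_iff top_unique)
  obtain u' where u': "potential p 1 (restr \<mu>' V) x = ennreal u'" "0 \<le> u'"
    using bd'(1)[of x] by (cases "potential p 1 (restr \<mu>' V) x") (auto simp: top_unique)
  have I: "?I \<le> ennreal (sqrt \<delta> / 2 + sqrt \<delta> * (u + u'))"
    using L1_dist_disc_total[OF c d V A A' bd bd' \<delta>(1) close close', of x] u u' by simp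
  then obtain i where i: "?I = ennreal i" "0 \<le> i" by (cases ?I) (auto simp: top_unique)
  have i_le: "i \<le> sqrt \<delta> / 2 + sqrt \<delta> * (u + u')"
    using I i u u' \<delta> by (simp add: ennreal_le_iff del: ennreal_plus)
  have [measurable]: "?C \<in> borel_measurable ?M" "?C' \<in> borel_measurable ?M"
    using disc_total_measurable[OF A(1) aug_extension_completion V] disc_total_measurable[OF A'(1) aug_extension_completion V] by auto
  have "(\<integral>\<^sup>+w. ?C' w \<partial>?M) \<le> (\<integral>\<^sup>+w. ?C w + ennreal_dist (?C w) (?C' w) \<partial>?M)"
    by (intro nn_integral_mono le_add_ennreal_dist)
  also have "\<dots> = (\<integral>\<^sup>+w. ?C w \<partial>?M) + (\<integral>\<^sup>+w. ennreal_dist (?C w) (?C' w) \<partial>?M)"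
    by (rule nn_integral_add) measurable
  finally have "ennreal u' \<le> ennreal u + ennreal i"
    using expectation_disc_total[OF c A(1,2) d A(3) V, of x] expectation_disc_total[OF c A'(1,2) d A'(3) V, of x] u u' i
    by (simp add: nn_integral_completion)
  then have u'_le: "u' \<le> u + i" using u u' i by (simp add: ennreal_plus[symmetric] ennreal_le_iff del: ennreal_plus)
  \<comment> \<open>Since \<open>\<delta> \<le> 1/4\<close>, the factor \<open>sqrt \<delta>\<close>
    is at most 1/2, so in \<open>u' \<le> u + i\<close> the part of \<open>i\<close> containing
    \<open>u'\<close> can be absorbed on the left. This leaves
    \<open>u' \<le> 3 * u + 1/2\<close>.\<close>
  have "sqrt \<delta> \<le> sqrt ((1/2)\<^sup>2)" using \<delta> by (intro real_sqrt_le_mono) (simp add: power2_eq_square)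
  then have q: "0 < sqrt \<delta>" "sqrt \<delta> \<le> 1/2"
    unfolding real_sqrt_abs using \<delta> by auto
  have "sqrt \<delta> * (u + u') \<le> 1/2 * (u + u')" using q u u' by (intro mult_right_mono) auto
  then have "u' \<le> 3 * u + 1/2" using i_le u'_le q by argo
  then have "sqrt \<delta> * (u + u') \<le> sqrt \<delta> * (4 * b + 1/2)" using q u by (intro mult_left_mono) auto
  then have "i \<le> sqrt \<delta> * (1 + 4 * b)" using i_le by (simp add: algebra_simps)
  then show ?thesis unfolding i(1) by (rule ennreal_leI)
qed

section \<open>Discounted masses of bounded time intervals\<close>

definition disc_until :: "ennreal \<Rightarrow> 's set \<Rightarrow> (ennreal \<Rightarrow> 'w \<Rightarrow> ennreal) \<Rightarrow> 'w \<Rightarrow> ennreal" where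
  "disc_until t V A w = (\<integral>\<^sup>+s. disc_rate V A s w * indicator {s. inv_time A s w < t} s \<partial>lborel)"

lemma disc_until_measurable:
  assumes A: "pcaf X A" and N: "aug_extension N" and V: "open V"
  shows "disc_until t V A \<in> borel_measurable N"
proof -
  have [measurable]: "(\<lambda>z. disc_rate V A (snd z) (fst z)) \<in> borel_measurable (N \<Otimes>\<^sub>M lborel)"
    "(\<lambda>z. inv_time A (snd z) (fst z)) \<in> borel_measurable (N \<Otimes>\<^sub>M lborel)"
    by (rule disc_rate_measurable[OF A N V] inv_time_measurable[OF A N]; measurable)+
  have "(\<lambda>z. disc_rate V A (snd z) (fst z) * indicator {z. inv_time A (snd z) (fst z) < t} z) \<in> borel_measurable (N \<Otimes>\<^sub>M lborel)"
    by measurable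
  also have "(\<lambda>z. disc_rate V A (snd z) (fst z) * indicator {z. inv_time A (snd z) (fst z) < t} z) =
      (\<lambda>(w, s). disc_rate V A s w * indicator {s. inv_time A s w < t} s)"
    by (auto simp: fun_eq_iff indicator_def)
  finally show ?thesis unfolding disc_until_def by (rule lborel.borel_measurable_nn_integral)
qed

lemma disc_total_split:
  assumes w: "w \<in> regular_paths A" and A: "pcaf X A" and V: "open V" and t: "t < \<infinity>"
  shows "disc_total V A w = disc_until t V A w + disc t * disc_total V A (pr_shift X t w)"
proof -
  have \<Omega>: "w \<in> \<Omega>" using w by (simp add: regular_paths_def)
  have [measurable]: "(\<lambda>s. disc_rate V A s w) \<in> borel_measurable borel" "(\<lambda>s. inv_time A s w) \<in> borel_measurable borel"
    using \<Omega> by (auto intro!: disc_rate_measurable[OF A aug_extension_aug V] inv_time_measurable[OF A aug_extension_aug])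
  have "disc_total V A w = (\<integral>\<^sup>+s. disc_rate V A s w * indicator {s. inv_time A s w < t} s +
      disc_rate V A s w * indicator {s. t \<le> inv_time A s w} s \<partial>lborel)"
    unfolding disc_total_def by (intro nn_integral_cong) (auto simp: indicator_def)
  also have "\<dots> = disc_until t V A w + disc t * disc_total V A (pr_shift X t w)"
    unfolding disc_total_shift[OF w A V t] disc_until_def by (rule nn_integral_add) measurable
  finally show ?thesis .
qed

text \<open>
  A bound that is uniform in the starting point survives the shift by \<open>t\<close>; no maximal inequality
  is needed.
\<close>

lemma L1_dist_disc_until:
  assumes c: "conservative X" and d: "dual_density X Xh m p" and V: "open V"
    and A: "pcaf X A" "revuz_corr X p A \<mu>" "sets \<mu> = sets borel"
    and A': "pcaf X A'" "revuz_corr X p A' \<mu>'" "sets \<mu>' = sets borel"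
    and fin: "potential p 1 (restr \<mu> V) x < \<infinity>" "potential p 1 (restr \<mu>' V) x < \<infinity>"
    and t: "t < \<infinity>"
    and le: "\<And>y. (\<integral>\<^sup>+w. ennreal_dist (disc_total V A w) (disc_total V A' w) \<partial>P (Some y)) \<le> \<eta>"
  shows "(\<integral>\<^sup>+w. ennreal_dist (disc_until t V A w) (disc_until t V A' w) \<partial>P (Some x)) \<le> 2 * \<eta>"
proof -
  let ?M = "PC (Some x)"
  let ?D = "\<lambda>w. ennreal_dist (disc_total V A w) (disc_total V A' w)"
  have T: "stopping (\<lambda>_. t)" by (rule stopping_time_const)
  have meas: "disc_total V A \<in> borel_measurable N" "disc_total V A' \<in> borel_measurable N" if "aug_extension N" for N
    using that by (auto intro: disc_total_measurable[OF A(1) _ V] disc_total_measurable[OF A'(1) _ V])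
  note [measurable] = meas[OF aug_extension_completion] meas[OF aug_extension_aug]
  have Daug: "?D \<in> borel_measurable (aug_filt X \<infinity>)" by measurable
  have Dm [measurable]: "?D \<in> borel_measurable ?M" by measurable
  note sm = strong_markov[OF T Daug, where z="Some x"]
  have ind: "alive (\<lambda>_. t) w = (1::ennreal)" if "w \<in> space ?M" for w
    using that t by simp
  have finC: "AE w in ?M. disc_total V A w \<noteq> \<infinity>" "AE w in ?M. disc_total V A' w \<noteq> \<infinity>"
    using expectation_disc_total[OF c A(1,2) d A(3) V, of x] expectation_disc_total[OF c A'(1,2) d A'(3) V, of x] fin
    by (intro nn_integral_PInf_AE; simp add: nn_integral_completion)+
  have reg: "AE w in ?M. w \<in> regular_paths A" "AE w in ?M. w \<in> regular_paths A'"
    using AE_regular_paths[OF A(1) c] AE_regular_paths[OF A'(1) c] by (simp_all add: AE_completion_iff)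
  have "(\<integral>\<^sup>+w. ennreal_dist (disc_until t V A w) (disc_until t V A' w) \<partial>?M) \<le>
      (\<integral>\<^sup>+w. ?D w + ?D (pr_shift X t w) * alive (\<lambda>_. t) w \<partial>?M)"
  proof (rule nn_integral_mono_AE)
    show "AE w in ?M. ennreal_dist (disc_until t V A w) (disc_until t V A' w) \<le>
      ?D w + ?D (pr_shift X t w) * alive (\<lambda>_. t) w"
      using finC reg AE_space
    proof eventually_elim
      case (elim w)
      have dt: "0 < disc t" "disc t \<le> 1" using t by (auto simp: disc_def ennreal_le_1)
      from ennreal_dist_split_le[OF disc_total_split[OF elim(3) A(1) V t] _ disc_total_split[OF elim(4) A'(1) V t] _ dt]
        elim(1,2) show ?case using ind[OF elim(5)] by (simp add: less_top[symmetric])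
    qed
  qed
  also have "\<dots> = (\<integral>\<^sup>+w. ?D w \<partial>?M) + (\<integral>\<^sup>+w. ?D (pr_shift X t w) * alive (\<lambda>_. t) w \<partial>?M)"
    by (rule nn_integral_add[OF Dm sm(1)])
  also have "(\<integral>\<^sup>+w. ?D (pr_shift X t w) * alive (\<lambda>_. t) w \<partial>?M) =
      (\<integral>\<^sup>+w. (\<integral>\<^sup>+w'. ?D w' \<partial>P (pr_at X t w)) * alive (\<lambda>_. t) w \<partial>?M)"
    using sm(2)[of "\<lambda>_. 1"] by simp
  also have "\<dots> \<le> (\<integral>\<^sup>+w. \<eta> \<partial>?M)"
  \<comment> \<open>Conservativeness puts the position at time \<open>t\<close> in S, where
    \<open>le\<close> is available.\<close>
  proof (rule nn_integral_mono_AE)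
    have "AE w in ?M. \<forall>t<\<infinity>. pr_at X t w \<in> range Some"
      using c by (simp add: conservative_def AE_completion_iff)
    then show "AE w in ?M. (\<integral>\<^sup>+w'. ?D w' \<partial>P (pr_at X t w)) * alive (\<lambda>_. t) w \<le> \<eta>"
    proof eventually_elim
      case (elim w)
      then obtain y where "pr_at X t w = Some y" using t by blast
      then show ?case using le[of y] by (auto simp: indicator_def)
    qed
  qed
  also have "\<dots> = \<eta>" using prob_space.emeasure_space_1[OF prob_space_completion_law[of "Some x"]] by simp
  also have "(\<integral>\<^sup>+w. ?D w \<partial>?M) \<le> \<eta>" using le[of x] by (simp add: nn_integral_completion)
  finally show ?thesis by (simp add: nn_integral_completion mult_2 add_mono)
qed

text \<open>The levels between \<open>a s\<close> and \<open>a t\<close> are those with inverse time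
  in [s, t). There the path is still in \<open>V\<close> and the discount factor lies between
  \<open>exp (- t)\<close> and \<open>exp (- s)\<close>.\<close>

lemma disc_until_increment:
  assumes w: "w \<in> regular_paths A" and A: "pcaf X A" and V: "open V"
    and st: "0 \<le> s" "s \<le> t" "t \<le> T" and inV: "\<And>r. r < ennreal T \<Longrightarrow> pr_at X r w \<in> Some ` V"
  defines "a \<equiv> \<lambda>t. enn2real (A (ennreal t) w)" and "c \<equiv> \<lambda>t. enn2real (disc_until (ennreal t) V A w)"
  shows "disc_until (ennreal t) V A w < \<infinity>"
    and "exp (- t) * (a t - a s) \<le> c t - c s" and "c t - c s \<le> exp (- s) * (a t - a s)"
proof -
  have \<Omega>: "w \<in> \<Omega>" and cl: "clock (\<lambda>t. A t w)" using w by (auto simp: regular_paths_def)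
  have [measurable]: "(\<lambda>s. disc_rate V A s w) \<in> borel_measurable borel" "(\<lambda>s. inv_time A s w) \<in> borel_measurable borel"
    using \<Omega> by (auto intro!: disc_rate_measurable[OF A aug_extension_aug V] inv_time_measurable[OF A aug_extension_aug])
  have Aa: "A (ennreal t) w = ennreal (a t)" "0 \<le> a t" for t
    using clock_finite[OF cl, of "ennreal t"] by (auto simp: a_def)
  have amono: "a s \<le> a t" if "s \<le> t" for s t
    using clock_mono[OF cl, of "ennreal s" "ennreal t"] that Aa by (simp add: ennreal_leI ennreal_le_iff)
  have a0: "a 0 = 0" using clock_0[OF cl] by (simp add: a_def)
  define J where "J s t = (\<integral>\<^sup>+v. disc_rate V A v w * indicator {v. ennreal s \<le> inv_time A v w \<and> inv_time A v w < ennreal t} v \<partial>lborel)" for s t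
  have split: "disc_until (ennreal t) V A w = disc_until (ennreal s) V A w + J s t" if "s \<le> t" for s t
  proof -
    have "disc_until (ennreal t) V A w = (\<integral>\<^sup>+v. disc_rate V A v w * indicator {v. inv_time A v w < ennreal s} v +
        disc_rate V A v w * indicator {v. ennreal s \<le> inv_time A v w \<and> inv_time A v w < ennreal t} v \<partial>lborel)"
      unfolding disc_until_def using ennreal_leI[OF that]
      by (intro nn_integral_cong) (auto simp: indicator_def dest: order.strict_trans2)
    then show ?thesis unfolding J_def disc_until_def by (simp add: nn_integral_add)
  qed
  have Jb: "ennreal (exp (- t) * (a t - a s)) \<le> J s t \<and> J s t \<le> ennreal (exp (- s) * (a t - a s))"
    if st: "0 \<le> s" "s \<le> t" "t \<le> T" for s t
  proof -
    have rate: "disc_rate V A v w * indicator {v. ennreal s \<le> inv_time A v w \<and> inv_time A v w < ennreal t} v =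
        disc (inv_time A v w) * indicator {a s..<a t} v" for v
    proof (cases "0 \<le> v")
      case True
      have 1: "ennreal s \<le> inv_time A v w \<longleftrightarrow> a s \<le> v"
        using path_inv_le_iff[OF cl, of "ennreal s" v] True Aa by (simp add: inv_time_def)
      have 2: "inv_time A v w < ennreal t \<longleftrightarrow> v < a t"
        using path_inv_less_iff[OF cl, of "ennreal t" v] True Aa by (simp add: inv_time_def ennreal_less_iff)
      show ?thesis
      proof (cases "a s \<le> v \<and> v < a t")
        case inside: True
        then have "inv_time A v w < ennreal T" using 2 ennreal_leI[OF st(3)] by (auto intro: order.strict_trans2)
        then show ?thesis using inside 1 2 True inV by (simp add: disc_rate_def)
      qed (use 1 2 in \<open>auto simp: indicator_def\<close>)
    next
      case False
      then show ?thesis using Aa(2)[of s] by (auto simp: disc_rate_def indicator_def)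
    qed
    have dle: "ennreal (exp (- t)) * indicator {a s..<a t} v \<le> disc (inv_time A v w) * indicator {a s..<a t} v \<and>
        disc (inv_time A v w) * indicator {a s..<a t} v \<le> ennreal (exp (- s)) * indicator {a s..<a t} v" for v
    proof (cases "a s \<le> v \<and> v < a t")
      case True
      then have "0 \<le> v" using Aa(2)[of s] by linarith
      have 1: "ennreal s \<le> inv_time A v w"
        using path_inv_le_iff[OF cl, of "ennreal s" v] True Aa by (simp add: inv_time_def ennreal_leI)
      have 2: "inv_time A v w < ennreal t"
        using path_inv_less_iff[OF cl, of "ennreal t" v] True Aa \<open>0 \<le> v\<close> by (simp add: inv_time_def ennreal_less_iff)
      then obtain r where r: "inv_time A v w = ennreal r" "0 \<le> r"
        by (cases "inv_time A v w") auto
      have "s \<le> r" "r \<le> t" using 1 2 r st by (auto simp: ennreal_le_iff ennreal_less_iff)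
      then show ?thesis using True r by (auto simp: disc_def intro!: ennreal_leI)
    qed auto
    have "ennreal (exp (- t) * (a t - a s)) = (\<integral>\<^sup>+v. ennreal (exp (- t)) * indicator {a s..<a t} v \<partial>lborel)"
      using amono[OF st(2)] by (simp add: nn_integral_cmult_indicator ennreal_mult)
    also have "\<dots> \<le> J s t" unfolding J_def rate using dle by (intro nn_integral_mono) auto
    finally have 1: "ennreal (exp (- t) * (a t - a s)) \<le> J s t" .
    have "J s t \<le> (\<integral>\<^sup>+v. ennreal (exp (- s)) * indicator {a s..<a t} v \<partial>lborel)"
      unfolding J_def rate using dle by (intro nn_integral_mono) auto
    also have "\<dots> = ennreal (exp (- s) * (a t - a s))"
      using amono[OF st(2)] by (simp add: nn_integral_cmult_indicator ennreal_mult)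
    finally show ?thesis using 1 by simp
  qed
  have d0: "disc_until (ennreal 0) V A w = 0" by (simp add: disc_until_def)
  have fin: "disc_until (ennreal t) V A w < \<top>" if "0 \<le> t" "t \<le> T" for t
    using split[of 0 t] Jb[of 0 t] that by (auto simp: d0[simplified] intro: order.strict_trans1)
  show "disc_until (ennreal t) V A w < \<infinity>" using fin[of t] st by simp
  have cs: "disc_until (ennreal s) V A w = ennreal (c s)" "disc_until (ennreal t) V A w = ennreal (c t)"
    using fin[of s] fin[of t] st by (auto simp: c_def)
  have c0: "0 \<le> c s" "0 \<le> c t" by (auto simp: c_def)
  have "J s t < \<top>" using Jb[OF st] by (auto intro: order.strict_trans1)
  then obtain j where j: "J s t = ennreal j" "0 \<le> j" by (cases "J s t") auto
  have "ennreal (c t) = ennreal (c s + j)" using split[OF st(2)] cs j c0 by simp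
  then have cj: "c t - c s = j" using c0 j(2) by (subst (asm) ennreal_inj) auto
  show "exp (- t) * (a t - a s) \<le> c t - c s" and "c t - c s \<le> exp (- s) * (a t - a s)"
    using Jb[OF st] amono[OF st(2)] unfolding cj j(1) using j(2) by (auto simp: ennreal_le_iff)
qed

end

section \<open>From discounted masses to additive functionals\<close>

text \<open>Undoing the discount means integrating \<open>exp\<close> against \<open>c\<close>.
  \<open>S\<close> is the lower Riemann sum of this integral on a grid of mesh \<open>h\<close>,
  over which \<open>exp\<close> varies by the factor \<open>exp h\<close>.\<close>

lemma weighted_increments_grid:
  fixes a c :: "real \<Rightarrow> real" and h :: real
  assumes a0: "a 0 = 0" and h: "0 \<le> h" "real k * h \<le> T"
    and lo: "\<And>s t. 0 \<le> s \<Longrightarrow> s \<le> t \<Longrightarrow> t \<le> T \<Longrightarrow> exp (- t) * (a t - a s) \<le> c t - c s"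
    and up: "\<And>s t. 0 \<le> s \<Longrightarrow> s \<le> t \<Longrightarrow> t \<le> T \<Longrightarrow> c t - c s \<le> exp (- s) * (a t - a s)"
  defines "S \<equiv> \<Sum>i<k. exp (real i * h) * (c (real (Suc i) * h) - c (real i * h))"
  shows "S \<le> a (real k * h)" and "a (real k * h) \<le> exp h * S"
proof -
  let ?t = "\<lambda>i. real i * h"
  have tele: "(\<Sum>i<k. a (?t (Suc i)) - a (?t i)) = a (?t k)"
    using sum_lessThan_telescope[of "\<lambda>i. a (?t i)" k] a0 by simp
  have t: "0 \<le> ?t i" "?t i \<le> ?t (Suc i)" for i using h by (simp_all add: mult_right_mono)
  have T: "?t (Suc i) \<le> T" if "i < k" for i
    using that h mult_right_mono[of "real (Suc i)" "real k" h] by linarith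
  have "S \<le> (\<Sum>i<k. a (?t (Suc i)) - a (?t i))" unfolding S_def
  proof (rule sum_mono)
    fix i assume "i \<in> {..<k}"
    then have "exp (?t i) * (c (?t (Suc i)) - c (?t i)) \<le> exp (?t i) * (exp (- ?t i) * (a (?t (Suc i)) - a (?t i)))"
      by (intro mult_left_mono up t T) auto
    then show "exp (?t i) * (c (?t (Suc i)) - c (?t i)) \<le> a (?t (Suc i)) - a (?t i)"
      by (simp add: mult.assoc[symmetric] exp_add[symmetric])
  qed
  then show "S \<le> a (?t k)" unfolding tele .
  have "(\<Sum>i<k. a (?t (Suc i)) - a (?t i)) \<le> (\<Sum>i<k. exp h * (exp (?t i) * (c (?t (Suc i)) - c (?t i))))"
  proof (rule sum_mono)
    fix i assume "i \<in> {..<k}"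
    then have "exp (?t (Suc i)) * (exp (- ?t (Suc i)) * (a (?t (Suc i)) - a (?t i))) \<le> exp (?t (Suc i)) * (c (?t (Suc i)) - c (?t i))"
      by (intro mult_left_mono lo t T) auto
    moreover have "exp (?t (Suc i)) = exp h * exp (?t i)" by (simp add: exp_add[symmetric] distrib_right)
    ultimately show "a (?t (Suc i)) - a (?t i) \<le> exp h * (exp (?t i) * (c (?t (Suc i)) - c (?t i)))"
      by (simp add: mult.assoc[symmetric] exp_add[symmetric])
  qed
  then show "a (?t k) \<le> exp h * S" unfolding tele S_def by (simp add: sum_distrib_left)
qed

text \<open>The Riemann sums involve the discounted masses at finitely many grid points only, so
  they converge. Between grid points monotonicity of both functions and uniform continuity of the
  limit \<open>a\<close> suffice; no equicontinuity of the sequence is used.\<close>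

lemma uniform_convergence_of_weighted_increments:
  fixes a c :: "real \<Rightarrow> real" and an cn :: "nat \<Rightarrow> real \<Rightarrow> real"
  assumes T: "0 < T" and cont: "continuous_on {0..T} a" and a0: "a 0 = 0" and an0: "\<And>n. an n 0 = 0"
    and mono: "\<And>s t. 0 \<le> s \<Longrightarrow> s \<le> t \<Longrightarrow> t \<le> T \<Longrightarrow> a s \<le> a t"
    and mono': "\<And>n s t. 0 \<le> s \<Longrightarrow> s \<le> t \<Longrightarrow> t \<le> T \<Longrightarrow> an n s \<le> an n t"
    and lo: "\<And>s t. 0 \<le> s \<Longrightarrow> s \<le> t \<Longrightarrow> t \<le> T \<Longrightarrow> exp (- t) * (a t - a s) \<le> c t - c s"
    and up: "\<And>s t. 0 \<le> s \<Longrightarrow> s \<le> t \<Longrightarrow> t \<le> T \<Longrightarrow> c t - c s \<le> exp (- s) * (a t - a s)"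
    and lo': "\<And>n s t. 0 \<le> s \<Longrightarrow> s \<le> t \<Longrightarrow> t \<le> T \<Longrightarrow> exp (- t) * (an n t - an n s) \<le> cn n t - cn n s"
    and up': "\<And>n s t. 0 \<le> s \<Longrightarrow> s \<le> t \<Longrightarrow> t \<le> T \<Longrightarrow> cn n t - cn n s \<le> exp (- s) * (an n t - an n s)"
    and lim: "\<And>N i. 0 < N \<Longrightarrow> i \<le> N \<Longrightarrow> (\<lambda>n. cn n (T * real i / real N)) \<longlonglongrightarrow> c (T * real i / real N)"
    and \<epsilon>: "0 < \<epsilon>"
  shows "\<forall>\<^sub>F n in sequentially. \<forall>t\<in>{0..T}. \<bar>an n t - a t\<bar> < \<epsilon>"
proof -
  \<comment> \<open>The error is below \<open>2 * e\<close> at grid points, and passing to other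
    times costs another \<open>e\<close>.\<close>
  define e where "e = \<epsilon> / 4"
  have e: "0 < e" using \<epsilon> by (simp add: e_def)
  have "uniformly_continuous_on {0..T} a" by (rule compact_uniformly_continuous[OF cont compact_Icc])
  then obtain d where d: "0 < d" "\<And>s t. s \<in> {0..T} \<Longrightarrow> t \<in> {0..T} \<Longrightarrow> dist s t < d \<Longrightarrow> dist (a s) (a t) < e"
    using e unfolding uniformly_continuous_on_def by metis
  have Tn: "(\<lambda>N. T / real N) \<longlonglongrightarrow> 0" by (rule lim_const_over_n)
  then have "(\<lambda>N. (exp (T / real N) - 1) * (a T + 1)) \<longlonglongrightarrow> (exp 0 - 1) * (a T + 1)" by (intro tendsto_intros)
  \<comment> \<open>One condition on the mesh h serves twice: it bounds
    \<open>(exp h - 1) * a\<close> by \<open>e\<close> on the whole interval and, as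
    \<open>a T + 1 \<ge> 1\<close>, also gives \<open>exp h \<le> 2\<close>.\<close>
  then have "\<forall>\<^sub>F N in sequentially. (exp (T / real N) - 1) * (a T + 1) < min e 1"
    using e by (intro order_tendstoD(2)[of _ 0]) auto
  moreover have "\<forall>\<^sub>F N in sequentially. T / real N < d" using Tn d(1) by (rule order_tendstoD(2))
  ultimately have "\<forall>\<^sub>F N in sequentially. (exp (T / real N) - 1) * (a T + 1) < min e 1 \<and> T / real N < d \<and> 0 < N"
    using eventually_gt_at_top[of 0] by eventually_elim auto
  then obtain N where N: "(exp (T / real N) - 1) * (a T + 1) < min e 1" "T / real N < d" "0 < N"
    using eventually_happens[of _ sequentially] by auto
  define h where "h = T / real N"
  define t where "t i = real i * h" for i :: nat
  have h: "0 < h" "h < d" using T N by (simp_all add: h_def)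
  have tN: "t N = T" and tS: "t (Suc i) = t i + h" and t_nn: "0 \<le> t i" for i
    using N h by (simp_all add: t_def h_def field_simps)
  have t_le: "t i \<le> T" if "i \<le> N" for i
    using that h mult_right_mono[of "real i" "real N" h] unfolding tN[symmetric] t_def by simp
  have a_nn: "0 \<le> a T" using mono[of 0 T] a0 T by simp
  have "1 \<le> exp h" using h by simp
  have "exp h - 1 \<le> (exp h - 1) * (a T + 1)"
    using mult_left_mono[of 1 "a T + 1" "exp h - 1"] a_nn \<open>1 \<le> exp h\<close> by simp
  then have "exp h \<le> 2" using N(1) by (simp add: h_def)
  define S where "S c k = (\<Sum>i<k. exp (t i) * (c (t (Suc i)) - c (t i)))" for c :: "real \<Rightarrow> real" and k
  have S: "S c k \<le> a (t k)" "a (t k) \<le> exp h * S c k" "S (cn n) k \<le> an n (t k)" "an n (t k) \<le> exp h * S (cn n) k"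
    if "k \<le> N" for k n
    using weighted_increments_grid[of a h k T c] weighted_increments_grid[of "an n" h k T "cn n"]
      a0 an0 h t_le[OF that] lo up lo' up' unfolding S_def t_def by auto
  have lim': "(\<lambda>n. cn n (t i)) \<longlonglongrightarrow> c (t i)" if "i \<le> N" for i
    using lim[OF N(3) that] by (simp add: t_def h_def mult.commute)
  have "\<forall>\<^sub>F n in sequentially. S (cn n) k < S c k + e / 2 \<and> S c k - e / 2 < S (cn n) k" if "k \<le> N" for k
  proof -
    have "(\<lambda>n. S (cn n) k) \<longlonglongrightarrow> S c k" unfolding S_def using that by (intro tendsto_intros lim') auto
    then show ?thesis using e by (intro eventually_conj order_tendstoD(1) order_tendstoD(2)) auto
  qed
  then have "\<forall>\<^sub>F n in sequentially. \<forall>k\<in>{..N}. S (cn n) k < S c k + e / 2 \<and> S c k - e / 2 < S (cn n) k"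
    by (intro eventually_ball_finite) auto
  then show ?thesis
  proof eventually_elim
    case (elim n)
    have grid: "\<bar>an n (t k) - a (t k)\<bar> < 2 * e" if k: "k \<le> N" for k
    proof -
      have Sk: "S (cn n) k < S c k + e / 2" "S c k - e / 2 < S (cn n) k" using elim k by auto
      have ak: "a (t k) \<le> a T" using mono[of "t k" T] t_nn t_le[OF k] by auto
      have "(exp h - 1) * a (t k) \<le> (exp h - 1) * (a T + 1)"
        using ak \<open>1 \<le> exp h\<close> by (intro mult_left_mono) auto
      then have 1: "exp h * a (t k) < a (t k) + e" using N(1) by (simp add: h_def[symmetric] algebra_simps)
      have "(exp h - 1) * S c k \<le> (exp h - 1) * a (t k)" using S(1)[OF k] \<open>1 \<le> exp h\<close> by (intro mult_left_mono) auto
      then have 2: "exp h * S c k < S c k + e" using 1 by (simp add: algebra_simps)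
      have "exp h * S (cn n) k \<le> exp h * (S c k + e / 2)" using Sk by (intro mult_left_mono) auto
      moreover have "exp h * (e / 2) \<le> 2 * (e / 2)" using \<open>exp h \<le> 2\<close> e by (intro mult_right_mono) auto
      ultimately have "an n (t k) < a (t k) + 2 * e" using S(1)[OF k] S(4)[OF k, of n] 2 by (simp add: algebra_simps)
      moreover have "a (t k) - 2 * e < an n (t k)" using S(2)[OF k] S(3)[OF k, of n] Sk 2 e by linarith
      ultimately show ?thesis by linarith
    qed
    show ?case
    proof
      fix s assume s: "s \<in> {0..T}"
      obtain k where k: "k < N" "t k \<le> s" "s \<le> t (Suc k)"
      \<comment> \<open>At \<open>s = T\<close> the floor used in the other case would give the
        index \<open>N\<close>, which starts no interval of the grid.\<close>
      proof (cases "s = T")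
        case True
        then have "t (N - 1) \<le> s" "s \<le> t (Suc (N - 1))" using t_le[of "N - 1"] tN N(3) by auto
        with that[of "N - 1"] N(3) show ?thesis by auto
      next
        case False
        define k where "k = nat \<lfloor>s / h\<rfloor>"
        have *: "0 \<le> s / h" "s / h < real N"
          using s False h tN by (auto simp: divide_less_eq t_def)
        have k: "real k \<le> s / h" "s / h < real k + 1"
          using *(1) by (auto simp: k_def)
        show ?thesis
        proof (rule that)
          show "k < N" using k *(2) by linarith
          show "t k \<le> s" using k(1) h by (simp add: t_def field_simps)
          show "s \<le> t (Suc k)" using k(2) h by (simp add: t_def field_simps)
        qed
      qed
      have "an n (t k) \<le> an n s" "an n s \<le> an n (t (Suc k))" "a (t k) \<le> a s" "a s \<le> a (t (Suc k))"
        using k s t_nn t_le[of "Suc k"] by (auto intro!: mono mono')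
      moreover have "dist (a (t k)) (a (t (Suc k))) < e"
        using k t_nn t_le[of k] t_le[of "Suc k"] h by (intro d(2)) (auto simp: dist_real_def tS)
      moreover have "\<bar>an n (t k) - a (t k)\<bar> < 2 * e" "\<bar>an n (t (Suc k)) - a (t (Suc k))\<bar> < 2 * e"
        using grid k(1) by auto
      moreover have "\<epsilon> = 4 * e" by (simp add: e_def)
      ultimately show "\<bar>an n s - a s\<bar> < \<epsilon>" unfolding dist_real_def by linarith
    qed
  qed
qed

section \<open>Leaving times and the smoothness of the measures\<close>

context standard_markov
begin

text \<open>Rational times keep the defining events countable. The cemetery counts as outside
  \<open>K\<close>.\<close>

definition leave_time :: "'s set \<Rightarrow> 'w \<Rightarrow> ennreal" where
  "leave_time K w = (INF q\<in>{q\<in>\<rat>. 0 \<le> q}. if pr_at X (ennreal q) w \<in> Some ` K then \<top> else ennreal q)"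

lemma leave_time_less_iff:
  "leave_time K w < t \<longleftrightarrow> (\<exists>q\<in>{q\<in>{q\<in>\<rat>. 0 \<le> q}. ennreal q < t}. pr_at X (ennreal q) w \<notin> Some ` K)"
  unfolding leave_time_def INF_less_iff by (auto split: if_splits)

lemma leave_time_stopping_time:
  assumes K: "closed K"
  shows "stopping (leave_time K)"
proof (rule stopping_time_rightI)
  fix t :: ennreal assume t: "t < \<infinity>"
  show "Measurable.pred (aug_filt X t) (\<lambda>w. leave_time K w < t)"
    unfolding leave_time_less_iff
  proof (rule measurable_pred_countable)
    show "countable {q\<in>{q\<in>\<rat>. 0 \<le> q}. ennreal q < t}" by (rule countable_subset[OF _ countable_rat]) auto
    fix q assume q: "q \<in> {q\<in>{q\<in>\<rat>. 0 \<le> q}. ennreal q < t}"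
    then have [measurable]: "pr_at X (ennreal q) \<in> aug_filt X t \<rightarrow>\<^sub>M cem_borel" by (intro measurable_at_aug) auto
    have [measurable]: "Some ` K \<in> sets cem_borel" using K by (simp add: sets_cem_borel inj_vimage_image_eq)
    show "Measurable.pred (aug_filt X t) (\<lambda>w. pr_at X (ennreal q) w \<notin> Some ` K)" by measurable
  qed
qed

lemma leave_time_mono: "K \<subseteq> K' \<Longrightarrow> leave_time K w \<le> leave_time K' w"
  unfolding leave_time_def by (intro INF_mono) auto

text \<open>A path outside the closed set \<open>K\<close> at time \<open>t\<close> stays outside on
  a right neighbourhood, by right-continuity or because the cemetery is absorbing, and a rational
  time before the leaving time would notice it.\<close>

lemma before_leave_time:
  assumes w: "w \<in> \<Omega>" and K: "closed K" and t: "t < leave_time K w"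
  shows "pr_at X t w \<in> Some ` K"
proof (rule ccontr)
  assume *: "pr_at X t w \<notin> Some ` K"
  have "t < \<top>" using t by (auto simp: less_top[symmetric])
  show False
  proof (cases "pr_at X t w")
    case None
    obtain q where q: "q \<in> \<rat>" "0 \<le> q" "t < ennreal q" "ennreal q < leave_time K w"
      using ennreal_rat_between[OF t] .
    then have "pr_at X (ennreal q) w = None" using cemetery_absorbing[OF w None, of "ennreal q"] by simp
    then show False using q leave_time_less_iff[of K w "leave_time K w"] by auto
  next
    case (Some x)
    with * have "x \<in> - K" by auto
    from at_right_continuous[OF w _ Some _ this] \<open>t < \<top>\<close> K
    have "\<forall>\<^sub>F s in at_right t. pr_at X s w \<in> Some ` (- K)" by auto
    then obtain b where b: "b > t" "\<And>s. t < s \<Longrightarrow> s < b \<Longrightarrow> pr_at X s w \<in> Some ` (- K)"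
      using eventually_at_right[OF \<open>t < \<top>\<close>] by auto
    have "t < min b (leave_time K w)" using b(1) t by simp
    then obtain q where q: "q \<in> \<rat>" "0 \<le> q" "t < ennreal q" "ennreal q < min b (leave_time K w)"
      by (rule ennreal_rat_between)
    then have "pr_at X (ennreal q) w \<in> Some ` (- K)" using b(2) by auto
    then have "pr_at X (ennreal q) w \<notin> Some ` K" by auto
    then show False using q leave_time_less_iff[of K w "leave_time K w"] by auto
  qed
qed

text \<open>A path in the open set \<open>W\<close> at that time would remain in \<open>K\<close>
  for a while, although rational times outside \<open>K\<close> come arbitrarily close to the
  leaving time.\<close>

lemma at_leave_time:
  assumes w: "w \<in> \<Omega>" and W: "open W" "W \<subseteq> K" and fin: "leave_time K w < \<infinity>"
  shows "pr_at X (leave_time K w) w \<notin> Some ` W"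
proof
  assume "pr_at X (leave_time K w) w \<in> Some ` W"
  then obtain y where y: "pr_at X (leave_time K w) w = Some y" "y \<in> W" by auto
  have fin': "leave_time K w < \<top>" using fin by simp
  from at_right_continuous[OF w fin y(1) W(1) y(2)]
  obtain b where b: "b > leave_time K w" "\<And>s. leave_time K w < s \<Longrightarrow> s < b \<Longrightarrow> pr_at X s w \<in> Some ` W"
    using eventually_at_right[OF fin'] by auto
  obtain q where q: "q \<in> \<rat>" "0 \<le> q" "ennreal q < b" "pr_at X (ennreal q) w \<notin> Some ` K"
    using b(1) leave_time_less_iff[of K w b] by auto
  have "\<not> ennreal q < leave_time K w"
  proof
    assume "ennreal q < leave_time K w"
    moreover have "leave_time K w \<le> ennreal q"
      unfolding leave_time_def using q by (intro INF_lower2[of q]) auto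
    ultimately show False by simp
  qed
  then have "leave_time K w = ennreal q \<or> leave_time K w < ennreal q" by auto
  then have "pr_at X (ennreal q) w \<in> Some ` W" using b(2)[of "ennreal q"] q(3) y by auto
  then show False using q(4) W(2) by auto
qed

text \<open>If the limit of the leaving times were smaller than the lifetime, the positions at these
  times would converge to a point of some \<open>V j\<close>. But the n-th position lies outside
  \<open>V n\<close>, which contains \<open>V j\<close> for large n.\<close>

lemma AE_leave_times_exhaust:
  assumes V: "incseq V" "(\<Union>k. V k) = UNIV" "\<And>k. open (V k)"
  shows "AE w in P z. lifetime X w \<le> (SUP k. leave_time (closure (V k)) w)"
proof -
  let ?T = "\<lambda>k. leave_time (closure (V k))"
  have inc: "incseq (\<lambda>k. ?T k w)" for w
    using V(1) by (intro monoI leave_time_mono closure_mono) (auto simp: incseq_def)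
  have "AE w in P z. (SUP n. ?T n w) < lifetime X w \<longrightarrow>
      limitin cem_top (\<lambda>n. pr_at X (?T n w) w) (pr_at X (SUP n. ?T n w) w) sequentially"
    using std inc leave_time_stopping_time unfolding standard_process_def quasi_left_cont_def by auto
  then show ?thesis
    using AE_space
  proof eventually_elim
    case (elim w)
    then have w: "w \<in> \<Omega>" by simp
    show ?case
    proof (rule ccontr)
      assume "\<not> lifetime X w \<le> (SUP k. ?T k w)"
      then have lt: "(SUP k. ?T k w) < lifetime X w" by simp
      then have lim: "limitin cem_top (\<lambda>n. pr_at X (?T n w) w) (pr_at X (SUP n. ?T n w) w) sequentially"
        using elim by simp
      have "pr_at X (SUP n. ?T n w) w \<noteq> None"
      proof
        assume "pr_at X (SUP n. ?T n w) w = None"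
        then have "lifetime X w \<le> (SUP n. ?T n w)" unfolding lifetime_def by (intro Inf_lower) auto
        then show False using lt by simp
      qed
      then obtain x where x: "pr_at X (SUP n. ?T n w) w = Some x" by auto
      obtain j where j: "x \<in> V j" using V(2) by auto
      have "openin cem_top (Some ` V j)" using V(3) by (simp add: cem_top_def)
      then have "\<forall>\<^sub>F n in sequentially. pr_at X (?T n w) w \<in> Some ` V j"
        using lim x j unfolding limitin_def by auto
      then obtain n where n: "n \<ge> j" "pr_at X (?T n w) w \<in> Some ` V j"
        unfolding eventually_sequentially by (metis nle_le)
      have "V j \<subseteq> V n" using V(1) n(1) by (auto simp: incseq_def)
      then have "pr_at X (?T n w) w \<in> Some ` V n" using n(2) by auto
      moreover have "?T n w < \<infinity>"
      proof -
        have "?T n w \<le> (SUP k. ?T k w)" by (rule SUP_upper) simp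
        also have "\<dots> < lifetime X w" by (rule lt)
        finally show ?thesis by (auto simp: less_top[symmetric])
      qed
      ultimately show False using at_leave_time[OF w V(3) closure_subset] by blast
    qed
  qed
qed

text \<open>Leaving times refer to closed sets and the mass estimates to open ones; compactness
  allows passing from one to the other along the sequence.\<close>

lemma closure_subset_later:
  assumes V: "incseq V" "(\<Union>k. V k) = UNIV" "\<And>k. open (V k)" "\<And>k. compact (closure (V k))"
  shows "\<exists>j. closure (V k) \<subseteq> (V j :: 's set)"
proof -
  have "closure (V k) \<subseteq> \<Union>(range V)" using V(2) by simp
  from compactE_image[OF V(4), of UNIV V] V(3) this
  obtain C where C: "finite C" "closure (V k) \<subseteq> (\<Union>c\<in>C. V c)" by auto
  obtain j where j: "\<And>c. c \<in> C \<Longrightarrow> c \<le> j" using C(1) unfolding finite_nat_set_iff_bounded_le by auto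
  then have "(\<Union>c\<in>C. V c) \<subseteq> V j" using V(1) unfolding incseq_def by (intro UN_least) auto
  with C(2) show ?thesis by (intro exI[of _ j]) (rule subset_trans)
qed

lemma AE_exit_times_exhaust:
  assumes V: "incseq V" "(\<Union>k. V k) = UNIV" "\<And>k. open (V k)" "\<And>k. compact (closure (V k))"
  shows "AE w in P z. lifetime X w \<le> (SUP k. exit_time X (V k) w)"
  using AE_leave_times_exhaust[OF V(1-3), of z] AE_space
proof eventually_elim
  case (elim w)
  have "(SUP k. leave_time (closure (V k)) w) \<le> (SUP k. exit_time X (V k) w)"
  proof (rule SUP_mono)
    fix k
    obtain j where j: "closure (V k) \<subseteq> V j" using closure_subset_later[OF V] by blast
    have "leave_time (closure (V k)) w \<le> exit_time X (V j) w"
      unfolding exit_time_def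
    proof (rule Inf_greatest)
      fix t assume "t \<in> {t. t < \<infinity> \<and> pr_at X t w \<notin> Some ` V j}"
      then have "pr_at X t w \<notin> Some ` closure (V k)" using j by auto
      then show "leave_time (closure (V k)) w \<le> t"
        using before_leave_time[of w "closure (V k)" t] elim(2) by (auto simp: not_less[symmetric])
    qed
    then show "\<exists>j\<in>UNIV. leave_time (closure (V k)) w \<le> exit_time X (V j) w" by blast
  qed
  then show ?case using elim(1) by simp
qed

text \<open>The sequence \<open>V\<close> itself serves as the nest, and a set is null as soon as
  all its traces on the \<open>V k\<close> are.\<close>

lemma smooth_of_local_S00:
  assumes V: "incseq V" "(\<Union>k. V k) = UNIV" "\<And>k. open (V k)" "\<And>k. compact (closure (V k))"
    and \<mu>: "sets \<mu> = sets borel" and S: "\<And>k. restr \<mu> (V k) \<in> S00 X p"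
  shows "\<mu> \<in> smooth_measures X p"
proof -
  have Vb [measurable]: "V k \<in> sets \<mu>" for k using V(3) \<mu> by simp
  have "charges_no_semipolar X \<mu>"
    unfolding charges_no_semipolar_def
  proof (intro allI impI)
    fix E assume E: "semipolar X E"
    have "\<exists>N\<in>null_sets (restr \<mu> (V k)). E \<subseteq> N" for k
      using S[of k] E unfolding S00_def charges_no_semipolar_def null_sets_completion_iff2 by blast
    then obtain N where N: "\<And>k. N k \<in> null_sets (restr \<mu> (V k))" "\<And>k. E \<subseteq> N k" by metis
    have "N k \<inter> V k \<in> null_sets \<mu>" for k
    proof -
      have "N k \<in> sets \<mu>" "AE x in \<mu>. x \<in> N k \<longrightarrow> (indicator (V k) x :: ennreal) = 0"
        using N(1)[of k] unfolding restr_def by (auto simp: null_sets_density_iff)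
      moreover then have "AE x in \<mu>. x \<notin> N k \<inter> V k" by (auto elim!: eventually_mono simp: indicator_def split: if_splits)
      ultimately show ?thesis by (subst AE_iff_null_sets) auto
    qed
    then have "(\<Union>k. N k \<inter> V k) \<in> null_sets \<mu>" by auto
    moreover have "E \<subseteq> (\<Union>k. N k \<inter> V k)"
    proof
      fix y assume y: "y \<in> E"
      obtain k where "y \<in> V k" using V(2) by auto
      then show "y \<in> (\<Union>k. N k \<inter> V k)" using N(2)[of k] y by auto
    qed
    ultimately show "E \<in> null_sets (completion \<mu>)" unfolding null_sets_completion_iff2 by blast
  qed
  moreover have "emeasure \<mu> (V k) < \<infinity>" for k
  proof -
    have "finite_measure (restr \<mu> (V k))" using S[of k] by (simp add: S00_def)
    then have "emeasure (restr \<mu> (V k)) (V k) < \<infinity>"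
      using finite_measure.emeasure_finite[of "restr \<mu> (V k)" "V k"] by (simp add: less_top[symmetric])
    moreover have "emeasure (restr \<mu> (V k)) (V k) = emeasure \<mu> (V k)"
      unfolding restr_def by (subst emeasure_density) (auto simp: indicator_inter_arith[symmetric])
    ultimately show ?thesis by simp
  qed
  moreover have "(SUP x. potential p 1 (restr \<mu> (V k)) x) < \<infinity>" for k
    using S[of k] by (simp add: S00_def)
  ultimately show ?thesis
    using \<mu> V AE_exit_times_exhaust[OF V] unfolding smooth_measures_def
    by (intro CollectI conjI exI[of _ V]) auto
qed

end

section \<open>Convergence in probability\<close>

lemma isCont_clock_real:
  assumes "clock a"
  shows "isCont (\<lambda>r. enn2real (a (ennreal r))) r"
proof -
  have "(a \<longlongrightarrow> a (ennreal r)) (nhds (ennreal r))"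
    using clock_isCont[OF assms, of "ennreal r"] by (simp add: isCont_def tendsto_at_iff_tendsto_nhds)
  moreover have "((\<lambda>t. ennreal t) \<longlongrightarrow> ennreal r) (at r)" by (intro tendsto_intros)
  ultimately have "((\<lambda>t. a (ennreal t)) \<longlongrightarrow> a (ennreal r)) (at r)" by (rule filterlim_compose)
  then show ?thesis unfolding isCont_def
    using clock_finite[OF assms, of "ennreal r"] by (intro tendsto_enn2real) auto
qed

lemma abs_diff_clock:
  assumes "clock a" "clock b"
  shows "\<bar>enn2ereal (a (ennreal r)) - enn2ereal (b (ennreal r))\<bar> = ereal \<bar>enn2real (a (ennreal r)) - enn2real (b (ennreal r))\<bar>"
proof -
  have "a (ennreal r) < \<top>" "b (ennreal r) < \<top>"
    using clock_finite[OF assms(1), of "ennreal r"] clock_finite[OF assms(2), of "ennreal r"] by auto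
  then obtain x y where "a (ennreal r) = ennreal x" "0 \<le> x" "b (ennreal r) = ennreal y" "0 \<le> y"
    by (cases "a (ennreal r)"; cases "b (ennreal r)") auto
  then show ?thesis by (simp add: enn2ereal_ennreal)
qed

lemma less_sup_diff_clock_iff:
  assumes a: "clock a" and b: "clock b" and T: "0 \<le> T"
  shows "ereal \<epsilon> < sup_diff T a b \<longleftrightarrow> (\<exists>r\<in>{0..T}. \<epsilon> < \<bar>enn2real (a (ennreal r)) - enn2real (b (ennreal r))\<bar>)"
proof
  assume "ereal \<epsilon> < sup_diff T a b"
  then obtain t where t: "t \<le> ennreal T" "ereal \<epsilon> < \<bar>enn2ereal (a t) - enn2ereal (b t)\<bar>"
    unfolding sup_diff_def less_SUP_iff by auto
  then obtain r where r: "t = ennreal r" "0 \<le> r" by (cases t) (auto simp: top_unique)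
  then have "r \<le> T" using t(1) T by (simp add: ennreal_le_iff)
  then show "\<exists>r\<in>{0..T}. \<epsilon> < \<bar>enn2real (a (ennreal r)) - enn2real (b (ennreal r))\<bar>"
    using t(2) r by (intro bexI[of _ r]) (auto simp: abs_diff_clock[OF a b])
next
  assume "\<exists>r\<in>{0..T}. \<epsilon> < \<bar>enn2real (a (ennreal r)) - enn2real (b (ennreal r))\<bar>"
  then obtain r where "0 \<le> r" "r \<le> T" "\<epsilon> < \<bar>enn2real (a (ennreal r)) - enn2real (b (ennreal r))\<bar>" by auto
  then show "ereal \<epsilon> < sup_diff T a b"
    unfolding sup_diff_def less_SUP_iff by (intro bexI[of _ "ennreal r"]) (auto simp: abs_diff_clock[OF a b] ennreal_leI)
qed

text \<open>By continuity a strict excess persists to the right of its time and so reaches a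
  rational time, except at the end point \<open>T\<close>, which is therefore added to the index
  set.\<close>

lemma less_sup_diff_clock_iff_countable:
  assumes a: "clock a" and b: "clock b" and T: "0 \<le> T"
  shows "ereal \<epsilon> < sup_diff T a b \<longleftrightarrow>
    (\<exists>q\<in>insert T {q\<in>\<rat>. 0 \<le> q \<and> q \<le> T}. \<epsilon> < \<bar>enn2real (a (ennreal q)) - enn2real (b (ennreal q))\<bar>)"
proof
  let ?f = "\<lambda>r. \<bar>enn2real (a (ennreal r)) - enn2real (b (ennreal r))\<bar>"
  assume "ereal \<epsilon> < sup_diff T a b"
  then obtain r where r: "0 \<le> r" "r \<le> T" "\<epsilon> < ?f r"
    unfolding less_sup_diff_clock_iff[OF a b T] by auto
  show "\<exists>q\<in>insert T {q\<in>\<rat>. 0 \<le> q \<and> q \<le> T}. \<epsilon> < ?f q"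
  proof (cases "r = T")
    case True then show ?thesis using r by auto
  next
    case False
    then have "r < T" using r by simp
    have "isCont ?f r" using isCont_clock_real[OF a] isCont_clock_real[OF b] by (intro continuous_intros) auto
    then have "\<forall>\<^sub>F s in at r. \<epsilon> < ?f s" using r(3) unfolding isCont_def by (rule order_tendstoD(1))
    then have "\<forall>\<^sub>F s in at_right r. \<epsilon> < ?f s" by (simp add: eventually_at_split)
    then obtain d where d: "d > r" "\<And>s. r < s \<Longrightarrow> s < d \<Longrightarrow> \<epsilon> < ?f s"
      using eventually_at_right[OF \<open>r < T\<close>] by auto
    obtain q where "q \<in> \<rat>" "r < q" "q < min d T" using Rats_dense_in_real[of r "min d T"] d(1) \<open>r < T\<close> by auto
    then show ?thesis using d(2)[of q] r(1) by (intro bexI[of _ q]) auto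
  qed
next
  assume "\<exists>q\<in>insert T {q\<in>\<rat>. 0 \<le> q \<and> q \<le> T}. \<epsilon> < \<bar>enn2real (a (ennreal q)) - enn2real (b (ennreal q))\<bar>"
  then show "ereal \<epsilon> < sup_diff T a b" unfolding less_sup_diff_clock_iff[OF a b T] using T by auto
qed

lemma sup_diff_nonneg: "0 \<le> sup_diff T a b"
  unfolding sup_diff_def by (intro SUP_upper2[of 0]) auto

lemma sup_diff_mono: "S \<le> T \<Longrightarrow> sup_diff S a b \<le> sup_diff T a b"
  unfolding sup_diff_def by (intro SUP_subset_mono) (auto intro: order_trans ennreal_leI)

text \<open>The windows up to \<open>K\<close> are controlled by the largest of them, with weights
  of sum at most 1. The later ones contribute at most the tail of the geometric series.\<close>

lemma loc_unif_dist_le: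
  "loc_unif_dist a b \<le> real_of_ereal (min 1 (sup_diff (real (Suc K)) a b)) + (1/2) ^ Suc K"
proof -
  define f where "f k = real_of_ereal (min 1 (sup_diff (real (Suc k)) a b))" for k
  have f: "ereal (f k) = min 1 (sup_diff (real (Suc k)) a b)" for k
    using sup_diff_nonneg[of "real (Suc k)" a b] unfolding f_def
    by (intro ereal_real') (auto simp: min_def)
  have f01: "0 \<le> f k" "f k \<le> 1" for k
    using f[of k] sup_diff_nonneg[of "real (Suc k)" a b]
    by (metis ereal_less_eq(3) min.boundedI zero_ereal_def zero_less_one_ereal less_imp_le, metis ereal_less_eq(3) min.cobounded1 one_ereal_def)
  have fmono: "f k \<le> f l" if "k \<le> l" for k l
  proof -
    have "ereal (f k) \<le> ereal (f l)" unfolding f using that by (intro min.mono sup_diff_mono) auto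
    then show ?thesis by simp
  qed
  have half: "(\<lambda>k. (1/2::real) ^ Suc k) sums 1" by (rule power_half_series)
  have summ: "summable (\<lambda>k. (1/2) ^ Suc k * f k)"
    by (rule summable_comparison_test'[OF sums_summable[OF half], of 0]) (use f01 in \<open>auto simp: abs_mult mult_left_le\<close>)
  have "loc_unif_dist a b = (\<Sum>k. (1/2) ^ Suc (k + Suc K) * f (k + Suc K)) + (\<Sum>k<Suc K. (1/2) ^ Suc k * f k)"
    unfolding loc_unif_dist_def f_def[symmetric] by (rule suminf_split_initial_segment[OF summ])
  also have "(\<Sum>k. (1/2) ^ Suc (k + Suc K) * f (k + Suc K)) \<le> (\<Sum>k. (1/2) ^ Suc K * (1/2) ^ Suc k)"
  proof (rule suminf_le)
    show "(1/2) ^ Suc (k + Suc K) * f (k + Suc K) \<le> (1/2) ^ Suc K * (1/2) ^ Suc k" for k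
      using f01[of "k + Suc K"] by (simp add: power_add[symmetric] ac_simps mult_left_le)
    show "summable (\<lambda>k. (1/2) ^ Suc (k + Suc K) * f (k + Suc K))" using summ by (rule summable_ignore_initial_segment)
    show "summable (\<lambda>k. (1/2::real) ^ Suc K * (1/2) ^ Suc k)" by (intro summable_mult sums_summable[OF half])
  qed
  also have "(\<Sum>k. (1/2::real) ^ Suc K * (1/2) ^ Suc k) = (1/2) ^ Suc K"
    using sums_unique[OF sums_mult[OF half, of "(1/2) ^ Suc K"]] by simp
  also have "(\<Sum>k<Suc K. (1/2) ^ Suc k * f k) \<le> (\<Sum>k<Suc K. (1/2) ^ Suc k * f K)"
    by (intro sum_mono mult_left_mono fmono) auto
  also have "\<dots> = (\<Sum>k<Suc K. (1/2) ^ Suc k) * f K" by (simp only: sum_distrib_right)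
  also have "\<dots> \<le> 1 * f K"
  proof (rule mult_right_mono)
    have "(\<Sum>k<Suc K. (1/2::real) ^ Suc k) \<le> (\<Sum>k. (1/2) ^ Suc k)"
      by (intro sum_le_suminf sums_summable[OF half]) auto
    then show "(\<Sum>k<Suc K. (1/2::real) ^ Suc k) \<le> 1" using sums_unique[OF half] by simp
  qed (rule f01)
  finally show ?thesis by (simp add: f_def)
qed

text \<open>\<open>measure_of\<close> yields the zero measure unless its set function is a measure,
  so countable additivity of the sum is checked first.\<close>

lemma AE_add_measure:
  assumes s: "sets \<mu> = sets (borel :: 's::topological_space measure)" "sets \<nu> = sets borel"
    and ae: "AE x in add_measure \<mu> \<nu>. P x"
  shows "AE x in \<mu>. P x" and "AE x in \<nu>. P x"
proof -
  have sp: "space \<mu> = UNIV" "space \<nu> = UNIV" using s by (auto dest: sets_eq_imp_space_eq)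
  have ms: "measure_space UNIV (sets (borel :: 's measure)) (\<lambda>B. emeasure \<mu> B + emeasure \<nu> B)"
    unfolding measure_space_def
  proof (intro conjI)
    show "sigma_algebra UNIV (sets (borel :: 's measure))"
      using sets.sigma_algebra_axioms[of "borel :: 's measure"] by simp
    show "positive (sets borel) (\<lambda>B. emeasure \<mu> B + emeasure \<nu> B)" by (simp add: positive_def)
    show "countably_additive (sets borel) (\<lambda>B. emeasure \<mu> B + emeasure \<nu> B)"
      unfolding countably_additive_def
    proof (intro allI impI)
      fix F :: "nat \<Rightarrow> 's set" assume F: "range F \<subseteq> sets borel" "disjoint_family F" "\<Union>(range F) \<in> sets borel"
      have "(\<Sum>i. emeasure \<mu> (F i) + emeasure \<nu> (F i)) = (\<Sum>i. emeasure \<mu> (F i)) + (\<Sum>i. emeasure \<nu> (F i))"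
        by (rule suminf_add[symmetric]) auto
      also have "\<dots> = emeasure \<mu> (\<Union>(range F)) + emeasure \<nu> (\<Union>(range F))"
        using F s by (simp add: suminf_emeasure)
      finally show "(\<Sum>i. emeasure \<mu> (F i) + emeasure \<nu> (F i)) = emeasure \<mu> (\<Union>(range F)) + emeasure \<nu> (\<Union>(range F))" .
    qed
  qed
  have em: "emeasure (add_measure \<mu> \<nu>) B = emeasure \<mu> B + emeasure \<nu> B" if "B \<in> sets borel" for B
  proof -
    have "B \<in> sigma_sets UNIV (sets borel)" "measure_space UNIV (sigma_sets UNIV (sets borel)) (\<lambda>B. emeasure \<mu> B + emeasure \<nu> B)"
      using that ms sets.sigma_sets_eq[of "borel :: 's measure"] by simp_all
    then show ?thesis unfolding add_measure_def emeasure_measure_of_conv by simp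
  qed
  have sa: "sets (add_measure \<mu> \<nu>) = sets borel" "space (add_measure \<mu> \<nu>) = UNIV"
    unfolding add_measure_def using sets.sigma_sets_eq[of "borel :: 's measure"] by (simp_all add: space_measure_of_conv)
  obtain N where N: "N \<in> null_sets (add_measure \<mu> \<nu>)" "{x. \<not> P x} \<subseteq> N"
    using ae unfolding eventually_ae_filter sa by auto
  have "N \<in> sets borel" using null_setsD2[OF N(1)] sa by simp
  moreover then have "emeasure \<mu> N + emeasure \<nu> N = 0" using em[of N] null_setsD1[OF N(1)] by simp
  ultimately have "N \<in> null_sets \<mu>" "N \<in> null_sets \<nu>" using s by (auto intro!: null_setsI)
  then show "AE x in \<mu>. P x" "AE x in \<nu>. P x" using N(2) by (auto intro!: AE_I'[of N] simp: sp)
qed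

lemma Linf_norm_lessD:
  assumes "Linf_norm \<nu> f < ennreal \<delta>"
  shows "AE x in \<nu>. \<bar>f x\<bar> \<le> \<delta>"
proof -
  obtain C where C: "0 < C" "AE x in \<nu>. \<bar>f x\<bar> \<le> C" "ennreal C < ennreal \<delta>"
    using assms unfolding Linf_norm_def Inf_less_iff by auto
  then have "C \<le> \<delta>" by (simp add: ennreal_less_iff)
  with C(2) show ?thesis by (auto elim: eventually_mono)
qed

lemma (in finite_measure) measure_decseq_tendsto_0:
  assumes U: "\<And>n. U n \<in> sets M" "decseq U" and null: "AE x in M. x \<notin> (\<Inter>n. U n)"
  shows "(\<lambda>n. measure M (U n)) \<longlonglongrightarrow> 0"
proof -
  have "(\<Inter>n. U n) \<in> sets M" using U(1) by auto
  with null have "(\<Inter>n. U n) \<in> null_sets M" by (simp add: AE_iff_null_sets)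
  then have "measure M (\<Inter>n. U n) = 0" by (simp add: measure_def null_setsD1)
  with finite_Lim_measure_decseq[of U] U show ?thesis by auto
qed

text \<open>The sum of the functions has finite integral, hence is almost everywhere finite, and its
  terms tend to 0.\<close>

lemma AE_tendsto_0_of_summable_nn_integral:
  assumes [measurable]: "\<And>k. f k \<in> borel_measurable M" and le: "\<And>k. (\<integral>\<^sup>+x. f k x \<partial>M) \<le> ennreal ((1/2) ^ k)"
  shows "AE x in M. (\<lambda>k. f k x) \<longlonglongrightarrow> 0"
proof -
  have "(\<integral>\<^sup>+x. (\<Sum>k. f k x) \<partial>M) = (\<Sum>k. \<integral>\<^sup>+x. f k x \<partial>M)" by (rule nn_integral_suminf) measurable
  also have "\<dots> \<le> (\<Sum>k. ennreal ((1/2) ^ k))" by (intro suminf_le le) auto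
  also have "\<dots> < \<top>"
    unfolding less_top[symmetric] by (intro ennreal_suminf_neq_top summable_geometric) auto
  finally have "(\<integral>\<^sup>+x. (\<Sum>k. f k x) \<partial>M) \<noteq> \<infinity>" by simp
  then have "AE x in M. (\<Sum>k. f k x) \<noteq> \<infinity>" by (intro nn_integral_PInf_AE) measurable
  then show ?thesis
  proof eventually_elim
    case (elim x)
    have fin: "f k x \<noteq> \<top>" for k
    proof
      assume "f k x = \<top>"
      moreover have "sum (\<lambda>k. f k x) {k} \<le> (\<Sum>k. f k x)" by (rule sum_le_suminf) auto
      ultimately show False using elim by (simp add: top_unique)
    qed
    then have eq: "f k x = ennreal (enn2real (f k x))" for k by (simp add: less_top)
    have "summable (\<lambda>k. enn2real (f k x))"
      using elim eq by (intro summable_suminf_not_top) auto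
    then have "(\<lambda>k. ennreal (enn2real (f k x))) \<longlonglongrightarrow> ennreal 0"
      by (intro tendsto_ennrealI summable_LIMSEQ_zero)
    then show ?case using eq by simp
  qed
qed

section \<open>From mean convergence of masses to convergence of functionals\<close>

context standard_markov
begin

text \<open>The supremum reduces to countably many times only on regular paths, so the event is
  measurable for the completion.\<close>

lemma sup_diff_event_measurable:
  assumes c: "conservative X" and A: "pcaf X A" and B: "pcaf X B" and T: "0 \<le> T"
  shows "{w\<in>\<Omega>. ereal \<epsilon> < path_dist T A B w} \<in> sets (PC (Some x))"
proof -
  let ?Q = "insert T {q\<in>\<rat>. 0 \<le> q \<and> q \<le> T}"
  let ?E = "{w\<in>\<Omega>. \<exists>q\<in>?Q. \<epsilon> < \<bar>enn2real (A (ennreal q) w) - enn2real (B (ennreal q) w)\<bar>}"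
  have [measurable]: "A (ennreal q) \<in> borel_measurable (PC (Some x))" "B (ennreal q) \<in> borel_measurable (PC (Some x))" for q
    using measurable_aug_completion[OF pcaf_measurable_aug[OF A]] measurable_aug_completion[OF pcaf_measurable_aug[OF B]] by auto
  have "countable ?Q" by (intro countable_insert) (auto intro: countable_subset[OF _ countable_rat])
  then have "Measurable.pred (PC (Some x)) (\<lambda>w. \<exists>q\<in>?Q. \<epsilon> < \<bar>enn2real (A (ennreal q) w) - enn2real (B (ennreal q) w)\<bar>)"
    by (intro measurable_pred_countable) measurable
  then have E: "?E \<in> sets (PC (Some x))" by (simp add: pred_def)
  show ?thesis
  proof (rule sets_completion_cong_AE[OF E])
    show "AE w in P (Some x). w \<in> ?E \<longleftrightarrow> w \<in> {w\<in>\<Omega>. ereal \<epsilon> < path_dist T A B w}"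
      using AE_regular_paths[OF A c] AE_regular_paths[OF B c]
    proof eventually_elim
      case (elim w)
      then have "clock (\<lambda>t. A t w)" "clock (\<lambda>t. B t w)" by (auto simp: regular_paths_def)
      from less_sup_diff_clock_iff_countable[OF this T] show ?case by simp
    qed
  qed auto
qed

lemma sup_diff_measurable:
  assumes c: "conservative X" and A: "pcaf X A" and B: "pcaf X B" and T: "0 \<le> T"
  shows "(\<lambda>w. path_dist T A B w) \<in> borel_measurable (PC (Some x))"
proof (rule borel_measurableI_greater)
  fix y :: ereal
  show "{w \<in> space (PC (Some x)). y < path_dist T A B w} \<in> sets (PC (Some x))"
  proof (cases y)
    case (real r)
    then show ?thesis using sup_diff_event_measurable[OF c A B T] by simp
  next
    case PInf
    then have "{w \<in> space (PC (Some x)). y < path_dist T A B w} = {}" by auto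
    then show ?thesis by (metis sets.empty_sets)
  next
    case MInf
    have "y < sup_diff T a b" for a b using sup_diff_nonneg[of T a b] MInf by (auto intro: order.strict_trans2)
    then have "{w \<in> space (PC (Some x)). y < path_dist T A B w} = space (PC (Some x))" by auto
    then show ?thesis by (metis sets.top)
  qed
qed

lemma sup_diff_eventually_small:
  assumes A: "pcaf X A" "w \<in> regular_paths A" and An: "\<And>i. pcaf X (An i)" "\<And>i. w \<in> regular_paths (An i)"
    and V: "open V" and inV: "\<And>r. r < ennreal T \<Longrightarrow> pr_at X r w \<in> Some ` V" and T: "0 < T"
    and lim: "\<And>N i. 0 < N \<Longrightarrow> i \<le> N \<Longrightarrow> (\<lambda>n. ennreal_dist (disc_until (ennreal (T * real i / real N)) V (An n) w)
       (disc_until (ennreal (T * real i / real N)) V A w)) \<longlonglongrightarrow> 0"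
    and \<epsilon>: "0 < \<epsilon>"
  shows "\<forall>\<^sub>F n in sequentially. \<not> ereal \<epsilon> < path_dist T (An n) A w"
proof -
  have cl: "clock (\<lambda>t. A t w)" "\<And>i. clock (\<lambda>t. An i t w)" using A An by (auto simp: regular_paths_def)
  define a where "a t = enn2real (A (ennreal t) w)" for t
  define an where "an n t = enn2real (An n (ennreal t) w)" for n t
  define c where "c t = enn2real (disc_until (ennreal t) V A w)" for t
  define cn where "cn n t = enn2real (disc_until (ennreal t) V (An n) w)" for n t
  have mono: "enn2real (B (ennreal s)) \<le> enn2real (B (ennreal t))" if "clock B" "s \<le> t" for B s t
    using that clock_mono[of B "ennreal s" "ennreal t"] clock_finite[of B "ennreal t"]
    by (intro enn2real_mono) (auto simp: ennreal_leI)
  have "\<forall>\<^sub>F n in sequentially. \<forall>t\<in>{0..T}. \<bar>an n t - a t\<bar> < \<epsilon>"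
  proof (rule uniform_convergence_of_weighted_increments[OF T, of a an c cn])
    show "continuous_on {0..T} a"
      unfolding a_def using isCont_clock_real[OF cl(1)] by (intro continuous_at_imp_continuous_on) auto
    show "a 0 = 0" "an n 0 = 0" for n
      using clock_0[OF cl(1)] clock_0[OF cl(2)] by (simp_all add: a_def an_def)
    show "a s \<le> a t" "an n s \<le> an n t" if "s \<le> t" for n s t
      unfolding a_def an_def using that cl by (auto intro: mono)
    show "exp (- t) * (a t - a s) \<le> c t - c s" "c t - c s \<le> exp (- s) * (a t - a s)"
      if "0 \<le> s" "s \<le> t" "t \<le> T" for s t
      unfolding a_def c_def by (rule disc_until_increment[OF A(2,1) V that inV]; assumption)+
    show "exp (- t) * (an n t - an n s) \<le> cn n t - cn n s" "cn n t - cn n s \<le> exp (- s) * (an n t - an n s)"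
      if "0 \<le> s" "s \<le> t" "t \<le> T" for n s t
      unfolding an_def cn_def by (rule disc_until_increment[OF An(2,1) V that inV]; assumption)+
    show "(\<lambda>n. cn n (T * real i / real N)) \<longlonglongrightarrow> c (T * real i / real N)" if N: "0 < N" "i \<le> N" for N i
    proof -
      let ?t = "T * real i / real N"
      have t: "0 \<le> ?t" "?t \<le> T" using T N mult_left_mono[of "real i" "real N" T] by (auto simp: divide_le_eq)
      have fin: "disc_until (ennreal ?t) V A w < \<infinity>" "\<And>n. disc_until (ennreal ?t) V (An n) w < \<infinity>"
        using disc_until_increment(1)[OF A(2,1) V _ _ t(2) inV, of 0] disc_until_increment(1)[OF An(2,1) V _ _ t(2) inV, of 0] t by auto
      have eq: "ennreal_dist (disc_until (ennreal ?t) V (An n) w) (disc_until (ennreal ?t) V A w) = ennreal \<bar>cn n ?t - c ?t\<bar>" for n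
      proof -
        have "disc_until (ennreal ?t) V A w = ennreal (c ?t)" "disc_until (ennreal ?t) V (An n) w = ennreal (cn n ?t)"
          using fin by (simp_all add: c_def cn_def)
        moreover have "0 \<le> c ?t" "0 \<le> cn n ?t" by (simp_all add: c_def cn_def)
        ultimately show ?thesis by (metis ennreal_dist_ennreal)
      qed
      have "(\<lambda>n. ennreal \<bar>cn n ?t - c ?t\<bar>) \<longlonglongrightarrow> ennreal 0" using lim[OF N] by (simp add: eq)
      then have "(\<lambda>n. \<bar>cn n ?t - c ?t\<bar>) \<longlonglongrightarrow> 0" by (subst (asm) tendsto_ennreal_iff) auto
      then show ?thesis by (subst (asm) tendsto_rabs_zero_iff) (rule LIM_zero_cancel)
    qed
  qed (use \<epsilon> in auto)
  then show ?thesis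
  proof eventually_elim
    case (elim n)
    then show ?case using less_sup_diff_clock_iff[OF cl(2,1), of T \<epsilon> n] T
      by (auto simp: a_def an_def not_less less_imp_le)
  qed
qed

lemma ennreal_dist_commute: "ennreal_dist a b = ennreal_dist b a"
  by (simp add: ennreal_dist_def add.commute)

lemma leave_time_measurable: "closed K \<Longrightarrow> leave_time K \<in> borel_measurable (PC z)"
  by (rule measurable_aug_completion[OF measurable_stopping_time_aug[OF leave_time_stopping_time]])

lemma sup_diff_in_probability_before_leaving:
  assumes c: "conservative X" and A: "pcaf X A" and An: "\<And>n. pcaf X (An n)"
    and V: "open V" and K: "closed K" "K \<subseteq> V" and T: "0 < T" and \<epsilon>: "0 < \<epsilon>"
    and L1: "\<And>\<eta>. 0 < \<eta> \<Longrightarrow> \<forall>\<^sub>F n in sequentially. \<forall>t<\<infinity>.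
      (\<integral>\<^sup>+w. ennreal_dist (disc_until t V A w) (disc_until t V (An n) w) \<partial>P (Some x)) \<le> ennreal \<eta>"
  shows "(\<lambda>n. measure (PC (Some x)) {w\<in>\<Omega>. ereal \<epsilon> < path_dist T (An n) A w \<and>
      ennreal T \<le> leave_time K w}) \<longlonglongrightarrow> 0" (is "(\<lambda>n. measure ?M (?B n)) \<longlonglongrightarrow> 0")
proof (rule ccontr)
  interpret M: prob_space ?M by (rule prob_space_completion_law)
  have Bm: "?B n \<in> sets ?M" for n
  proof -
    have "{w\<in>space ?M. ennreal T \<le> leave_time K w} \<in> sets ?M"
      using leave_time_measurable[OF K(1), of "Some x"] by measurable
    moreover have "{w\<in>\<Omega>. ereal \<epsilon> < path_dist T (An n) A w} \<in> sets ?M"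
      using T by (intro sup_diff_event_measurable[OF c An A]) simp
    ultimately have "{w\<in>\<Omega>. ereal \<epsilon> < path_dist T (An n) A w} \<inter>
        {w\<in>space ?M. ennreal T \<le> leave_time K w} \<in> sets ?M" by (intro sets.Int)
    then show ?thesis by (rule back_subst[of "\<lambda>S. S \<in> sets ?M"]) auto
  qed
  assume "\<not> (\<lambda>n. measure ?M (?B n)) \<longlonglongrightarrow> 0"
  then obtain \<eta> where \<eta>: "0 < \<eta>" "\<not> (\<forall>\<^sub>F n in sequentially. dist (measure ?M (?B n)) 0 < \<eta>)"
    unfolding tendsto_iff by blast
  then have freq: "\<exists>\<^sub>F n in sequentially. \<eta> \<le> measure ?M (?B n)"
    unfolding frequently_def by (auto simp: dist_real_def not_le)
  \<comment> \<open>For each \<open>i\<close> an index with a large probability and a mean distance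
    of at most \<open>(1/2) ^ i\<close>. The resulting choice \<phi> need not be increasing, since
    only the summability of the mean distances matters.\<close>
  have ex: "\<exists>n. \<eta> \<le> measure ?M (?B n) \<and> (\<forall>t<\<infinity>.
      (\<integral>\<^sup>+w. ennreal_dist (disc_until t V A w) (disc_until t V (An n) w) \<partial>P (Some x)) \<le> ennreal ((1/2) ^ i))" for i :: nat
  proof -
    have "\<forall>\<^sub>F n in sequentially. \<forall>t<\<infinity>.
      (\<integral>\<^sup>+w. ennreal_dist (disc_until t V A w) (disc_until t V (An n) w) \<partial>P (Some x)) \<le> ennreal ((1/2) ^ i)"
      by (rule L1) simp
    from frequently_eventually_frequently[OF freq this] show ?thesis by (rule frequently_ex)
  qed
  from choice[OF allI[OF ex]] obtain \<phi> where "\<forall>i. \<eta> \<le> measure ?M (?B (\<phi> i)) \<and> (\<forall>t<\<infinity>.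
      (\<integral>\<^sup>+w. ennreal_dist (disc_until t V A w) (disc_until t V (An (\<phi> i)) w) \<partial>P (Some x)) \<le> ennreal ((1/2) ^ i))" ..
  then have \<phi>: "\<And>i. \<eta> \<le> measure ?M (?B (\<phi> i))"
    and \<phi>L: "\<And>i t. t < \<infinity> \<Longrightarrow> (\<integral>\<^sup>+w. ennreal_dist (disc_until t V A w) (disc_until t V (An (\<phi> i)) w) \<partial>P (Some x))
      \<le> ennreal ((1/2) ^ i)" by (simp_all only: )
  have "AE w in ?M. (\<lambda>i. ennreal_dist (disc_until (ennreal t) V A w) (disc_until (ennreal t) V (An (\<phi> i)) w)) \<longlonglongrightarrow> 0" for t
  proof (rule AE_tendsto_0_of_summable_nn_integral)
    show "(\<lambda>w. ennreal_dist (disc_until (ennreal t) V A w) (disc_until (ennreal t) V (An (\<phi> i)) w)) \<in> borel_measurable ?M" for i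
      by (intro ennreal_dist_measurable disc_until_measurable[OF A aug_extension_completion V]
          disc_until_measurable[OF An aug_extension_completion V])
    show "(\<integral>\<^sup>+w. ennreal_dist (disc_until (ennreal t) V A w) (disc_until (ennreal t) V (An (\<phi> i)) w) \<partial>?M) \<le> ennreal ((1/2) ^ i)" for i
      using \<phi>L[of "ennreal t" i] by (simp add: nn_integral_completion)
  qed
  \<comment> \<open>The fractions of \<open>T\<close> are countably many, so one null set suffices,
    and they contain every grid of equal mesh.\<close>
  then have lim: "AE w in ?M. \<forall>N i. (\<lambda>n. ennreal_dist (disc_until (ennreal (T * real i / real N)) V A w)
      (disc_until (ennreal (T * real i / real N)) V (An (\<phi> n)) w)) \<longlonglongrightarrow> 0"
    by (simp add: AE_all_countable)
  have reg: "AE w in ?M. w \<in> regular_paths A" "AE w in ?M. \<forall>n. w \<in> regular_paths (An n)"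
    using AE_regular_paths[OF A c] AE_regular_paths[OF An c] by (simp_all add: AE_completion_iff AE_all_countable)
  have ev: "AE w in ?M. \<forall>\<^sub>F n in sequentially. w \<notin> ?B (\<phi> n)"
    using lim reg AE_space
  proof eventually_elim
    case (elim w)
    show ?case
    proof (cases "ennreal T \<le> leave_time K w")
      case True
      have inV: "pr_at X r w \<in> Some ` V" if "r < ennreal T" for r
        using before_leave_time[of w K r] elim(4) K order.strict_trans2[OF that True] by auto
      have "\<forall>\<^sub>F n in sequentially. \<not> ereal \<epsilon> < path_dist T (An (\<phi> n)) A w"
        using elim(1,3) by (intro sup_diff_eventually_small[OF A elim(2) An _ V inV T _ \<epsilon>]) (auto simp: ennreal_dist_commute)
      then show ?thesis by (rule eventually_mono) simp
    qed simp
  qed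
  \<comment> \<open>If almost every path lies in only finitely many of the events, the tail unions
    must have probabilities tending to 0, against the lower bound \<eta>.\<close>
  define U where "U m = (\<Union>i\<in>{m..}. ?B (\<phi> i))" for m
  have Um: "U m \<in> sets ?M" for m unfolding U_def by (rule sets.countable_UN) (rule image_subsetI, rule Bm)
  have "decseq U" unfolding U_def decseq_def by fastforce
  moreover have "AE w in ?M. w \<notin> (\<Inter>m. U m)"
    using ev
  proof eventually_elim
    case (elim w)
    then obtain N where "\<forall>n\<ge>N. w \<notin> ?B (\<phi> n)" unfolding eventually_sequentially ..
    then have "w \<notin> U N" unfolding U_def by blast
    then show ?case by blast
  qed
  ultimately have "(\<lambda>m. measure ?M (U m)) \<longlonglongrightarrow> 0" by (rule M.measure_decseq_tendsto_0[OF Um])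
  moreover have "\<eta> \<le> measure ?M (U m)" for m
  proof -
    have "measure ?M (?B (\<phi> m)) \<le> measure ?M (U m)"
      using Um[of m] by (intro M.finite_measure_mono) (auto simp: U_def)
    then show ?thesis using \<phi>[of m] by linarith
  qed
  ultimately have "\<eta> \<le> 0" by (metis LIMSEQ_le_const)
  then show False using \<eta>(1) by simp
qed

text \<open>The event is split according to whether the path leaves \<open>closure (V k)\<close>
  before \<open>T\<close>. First \<open>k\<close> is fixed to make an early departure improbable,
  uniformly in \<open>n\<close>; then \<open>n\<close> tends to infinity.\<close>

lemma sup_diff_in_probability:
  assumes c: "conservative X" and A: "pcaf X A" and An: "\<And>n. pcaf X (An n)"
    and V: "incseq V" "(\<Union>k. V k) = UNIV" "\<And>k. open (V k)" "\<And>k. compact (closure (V k))"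
    and T: "0 < T" and \<epsilon>: "0 < \<epsilon>"
    and L1: "\<And>k \<eta>. 0 < \<eta> \<Longrightarrow> \<forall>\<^sub>F n in sequentially. \<forall>t<\<infinity>.
      (\<integral>\<^sup>+w. ennreal_dist (disc_until t (V k) A w) (disc_until t (V k) (An n) w) \<partial>P (Some x)) \<le> ennreal \<eta>"
  shows "prob_vanishes (P (Some x)) (\<lambda>n. {w\<in>\<Omega>. ereal \<epsilon> < path_dist T (An n) A w})"
  unfolding prob_vanishes_def
proof (intro conjI allI)
  let ?M = "PC (Some x)"
  let ?E = "\<lambda>n. {w\<in>\<Omega>. ereal \<epsilon> < path_dist T (An n) A w}"
  let ?K = "\<lambda>k. closure (V k)"
  let ?F = "\<lambda>k. {w\<in>\<Omega>. leave_time (?K k) w < ennreal T}"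
  let ?B = "\<lambda>k n. {w\<in>\<Omega>. ereal \<epsilon> < path_dist T (An n) A w \<and> ennreal T \<le> leave_time (?K k) w}"
  interpret M: prob_space ?M by (rule prob_space_completion_law)
  show Em: "?E n \<in> sets ?M" for n
    using T by (intro sup_diff_event_measurable[OF c An A]) simp
  have Fm: "?F k \<in> sets ?M" for k
  proof -
    have "{w\<in>space ?M. leave_time (?K k) w < ennreal T} \<in> sets ?M"
      using leave_time_measurable[OF closed_closure, of "V k" "Some x"] by measurable
    then show ?thesis by simp
  qed
  have Beq: "?B k n = ?E n - ?F k" for k n by (auto simp: not_less)
  have "decseq ?F"
    unfolding decseq_def
  proof (intro allI impI subsetI)
    fix k l w assume "k \<le> l" and w: "w \<in> ?F l"
    then have "V k \<subseteq> V l" using V(1) by (auto simp: incseq_def)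
    from leave_time_mono[OF closure_mono[OF this], of w] show "w \<in> ?F k"
      using w by (auto intro: order.strict_trans1)
  qed
  moreover have "AE w in ?M. w \<notin> (\<Inter>k. ?F k)"
  proof -
    have "AE w in ?M. \<forall>t<\<infinity>. pr_at X t w \<in> range Some"
      using c by (simp add: conservative_def AE_completion_iff)
    moreover have "AE w in ?M. lifetime X w \<le> (SUP k. leave_time (?K k) w)"
      using AE_leave_times_exhaust[OF V(1-3), of "Some x"] by (simp add: AE_completion_iff)
    ultimately show ?thesis
    proof eventually_elim
      case (elim w)
      have "\<infinity> \<le> lifetime X w" unfolding lifetime_def
      proof (rule Inf_greatest)
        fix t assume "t \<in> {t. pr_at X t w = None}"
        then have "\<not> t < \<infinity>" using elim(1) by force
        then show "\<infinity> \<le> t" by simp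
      qed
      then have "ennreal T < (SUP k. leave_time (?K k) w)" using elim(2)
        by (metis ennreal_less_top infinity_ennreal_def order.trans top_unique)
      then obtain k where "ennreal T < leave_time (?K k) w" unfolding less_SUP_iff by auto
      then show ?case by (auto intro!: exI[of _ k])
    qed
  qed
  ultimately have F0: "(\<lambda>k. measure ?M (?F k)) \<longlonglongrightarrow> 0" by (rule M.measure_decseq_tendsto_0[OF Fm])
  show "(\<lambda>n. measure ?M (?E n)) \<longlonglongrightarrow> 0"
  proof (rule LIMSEQ_I)
    fix e :: real assume e: "0 < e"
    then have "\<forall>\<^sub>F k in sequentially. measure ?M (?F k) < e / 2"
      using F0 by (intro order_tendstoD(2)[of _ 0]) auto
    then obtain k where k: "measure ?M (?F k) < e / 2" using eventually_happens[of _ sequentially] by auto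
    obtain j where j: "?K k \<subseteq> V j" using closure_subset_later[OF V] by blast
    have "(\<lambda>n. measure ?M (?B k n)) \<longlonglongrightarrow> 0"
      by (rule sup_diff_in_probability_before_leaving[OF c A An V(3) closed_closure j T \<epsilon> L1])
    then have "\<forall>\<^sub>F n in sequentially. measure ?M (?B k n) < e / 2"
      using e by (intro order_tendstoD(2)[of _ 0]) auto
    then obtain N where N: "\<And>n. n \<ge> N \<Longrightarrow> measure ?M (?B k n) < e / 2"
      unfolding eventually_sequentially by auto
    have "norm (measure ?M (?E n) - 0) < e" if "n \<ge> N" for n
    proof -
      have "measure ?M (?E n) \<le> measure ?M ((?E n - ?F k) \<union> ?F k)"
        using Em Fm by (intro M.finite_measure_mono) auto
      also have "\<dots> \<le> measure ?M (?E n - ?F k) + measure ?M (?F k)"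
        using Em Fm by (intro measure_subadditive) (auto simp: M.emeasure_finite simp del: emeasure_completion)
      also have "\<dots> < e" using N[OF that] k unfolding Beq by linarith
      finally show ?thesis by simp
    qed
    then show "\<exists>N. \<forall>n\<ge>N. norm (measure ?M (?E n) - 0) < e" by blast
  qed
qed

lemma loc_unif_dist_in_probability:
  assumes c: "conservative X" and A: "pcaf X A" and An: "\<And>n. pcaf X (An n)"
    and van: "\<And>\<epsilon> T. 0 < \<epsilon> \<Longrightarrow> 0 < T \<Longrightarrow> prob_vanishes (P (Some x))
      (\<lambda>n. {w\<in>\<Omega>. ereal \<epsilon> < path_dist T (An n) A w})"
    and \<epsilon>: "0 < \<epsilon>"
  shows "prob_vanishes (P (Some x)) (\<lambda>n. {w\<in>\<Omega>. \<epsilon> < loc_unif_dist (\<lambda>t. An n t w) (\<lambda>t. A t w)})"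
proof -
  let ?M = "PC (Some x)"
  interpret M: prob_space ?M by (rule prob_space_completion_law)
  let ?E = "\<lambda>n. {w\<in>\<Omega>. \<epsilon> < loc_unif_dist (\<lambda>t. An n t w) (\<lambda>t. A t w)}"
  have Em: "?E n \<in> sets ?M" for n
  proof -
    have [measurable]: "(\<lambda>w. path_dist (real (Suc k)) (An n) A w) \<in> borel_measurable ?M" for k
      by (rule sup_diff_measurable[OF c An A]) simp
    have "(\<lambda>w. loc_unif_dist (\<lambda>t. An n t w) (\<lambda>t. A t w)) \<in> borel_measurable ?M"
      unfolding loc_unif_dist_def by measurable
    then have "{w\<in>space ?M. \<epsilon> < loc_unif_dist (\<lambda>t. An n t w) (\<lambda>t. A t w)} \<in> sets ?M" by measurable
    then show ?thesis by simp
  qed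
  obtain K where K: "(1/2::real) ^ K < \<epsilon> / 2" using real_arch_pow_inv[of "\<epsilon> / 2" "1/2"] \<epsilon> by auto
  have K': "(1/2::real) ^ Suc K < \<epsilon> / 2" using K by (simp add: field_simps)
  let ?S = "\<lambda>n. {w\<in>\<Omega>. ereal (\<epsilon> / 2) < path_dist (real (Suc K)) (An n) A w}"
  have S: "prob_vanishes (P (Some x)) ?S" using \<epsilon> by (intro van) auto
  have sub: "?E n \<subseteq> ?S n" for n
  proof safe
    fix w assume *: "\<epsilon> < loc_unif_dist (\<lambda>t. An n t w) (\<lambda>t. A t w)"
    let ?s = "path_dist (real (Suc K)) (An n) A w"
    have "\<epsilon> / 2 < real_of_ereal (min 1 ?s)" using * loc_unif_dist_le[of "\<lambda>t. An n t w" "\<lambda>t. A t w" K] K' by linarith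
    then show "ereal (\<epsilon> / 2) < ?s"
      using sup_diff_nonneg[of "real (Suc K)" "\<lambda>t. An n t w" "\<lambda>t. A t w"]
      by (cases ?s) (auto simp: min_def one_ereal_def split: if_splits)
  qed
  show ?thesis unfolding prob_vanishes_def
  proof (intro conjI allI Em)
    show "(\<lambda>n. measure ?M (?E n)) \<longlonglongrightarrow> 0"
    proof (rule tendsto_sandwich[OF _ _ tendsto_const])
      show "(\<lambda>n. measure ?M (?S n)) \<longlonglongrightarrow> 0" using S by (simp add: prob_vanishes_def)
      show "\<forall>\<^sub>F n in sequentially. measure ?M (?E n) \<le> measure ?M (?S n)"
        using S sub by (intro always_eventually allI M.finite_measure_mono) (auto simp: prob_vanishes_def)
    qed simp
  qed
qed

lemma eventually_L1_close:
  assumes c: "conservative X" and d: "dual_density X Xh m p" and V: "open V"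
    and A: "pcaf X A" "revuz_corr X p A \<mu>" "sets \<mu> = sets borel" "restr \<mu> V \<in> S00 X p"
    and An: "\<And>n. pcaf X (An n)" "\<And>n. revuz_corr X p (An n) (\<mu>n n)" "\<And>n. sets (\<mu>n n) = sets borel"
      "\<And>n. restr (\<mu>n n) V \<in> S00 X p"
    and lim: "(\<lambda>n. Linf_norm (add_measure (restr (\<mu>n n) V) (restr \<mu> V))
           (\<lambda>x. enn2real (potential p 1 (restr (\<mu>n n) V) x) - enn2real (potential p 1 (restr \<mu> V) x))) \<longlonglongrightarrow> 0"
    and \<eta>: "0 < \<eta>"
  shows "\<forall>\<^sub>F n in sequentially. \<forall>t<\<infinity>.
      (\<integral>\<^sup>+w. ennreal_dist (disc_until t V A w) (disc_until t V (An n) w) \<partial>P (Some x)) \<le> ennreal \<eta>"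
proof -
  have bounded: "\<exists>b\<ge>0. \<forall>y. potential p 1 \<nu> y \<le> ennreal b" if "\<nu> \<in> S00 X p" for \<nu>
  proof -
    have "(SUP y. potential p 1 \<nu> y) < \<infinity>" using that by (simp add: S00_def)
    then obtain b where b: "(SUP y. potential p 1 \<nu> y) = ennreal b" "0 \<le> b" by (cases "SUP y. potential p 1 \<nu> y") auto
    then show ?thesis by (metis SUP_upper UNIV_I)
  qed
  obtain b where b: "0 \<le> b" "\<And>y. potential p 1 (restr \<mu> V) y \<le> ennreal b" using bounded[OF A(4)] by auto
  have fm: "finite_measure (restr \<mu> V)" "\<And>n. finite_measure (restr (\<mu>n n) V)" using A(4) An(4) by (auto simp: S00_def)
  \<comment> \<open>The second entry makes \<open>2 * (sqrt \<delta> * (1 + 4 * b))\<close> at most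
    \<eta>, the 2 coming from the restriction to bounded time intervals; the cap 1/4 is required by
    \<open>L1_dist_disc_total_uniform\<close>. As \<open>b\<close> bounds only the potential for
    \<mu>, this choice does not depend on \<open>n\<close>.\<close>
  define \<delta> where "\<delta> = min (1/4) ((\<eta> / (2 * (1 + 4 * b)))\<^sup>2)"
  have \<delta>: "0 < \<delta>" "\<delta> \<le> 1/4" using \<eta> b(1) by (auto simp: \<delta>_def)
  have "sqrt \<delta> \<le> sqrt ((\<eta> / (2 * (1 + 4 * b)))\<^sup>2)" by (intro real_sqrt_le_mono) (simp add: \<delta>_def)
  also have "\<dots> = \<eta> / (2 * (1 + 4 * b))" using \<eta> b(1) by simp
  finally have "2 * (sqrt \<delta> * (1 + 4 * b)) \<le> \<eta>" using b(1) by (simp add: field_simps)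
  then have \<delta>\<eta>: "2 * ennreal (sqrt \<delta> * (1 + 4 * b)) \<le> ennreal \<eta>"
    using b(1) \<delta> by (simp add: ennreal_mult[symmetric] ennreal_numeral[symmetric] ennreal_leI del: ennreal_numeral)
  have "\<forall>\<^sub>F n in sequentially. Linf_norm (add_measure (restr (\<mu>n n) V) (restr \<mu> V))
           (\<lambda>x. enn2real (potential p 1 (restr (\<mu>n n) V) x) - enn2real (potential p 1 (restr \<mu> V) x)) < ennreal \<delta>"
    using lim \<delta> by (intro order_tendstoD(2)[of _ 0]) auto
  then show ?thesis
  proof eventually_elim
    case (elim n)
    let ?u = "potential p 1 (restr \<mu> V)" and ?u' = "potential p 1 (restr (\<mu>n n) V)"
    obtain b' where b': "0 \<le> b'" "\<And>y. ?u' y \<le> ennreal b'" using bounded[OF An(4)] by auto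
    note ae = AE_add_measure[OF _ _ Linf_norm_lessD[OF elim]]
    have s: "sets (restr \<mu> V) = sets borel" "sets (restr (\<mu>n n) V) = sets borel" using A(3) An(3) by (simp_all add: restr_def)
    have imp: "?u y \<le> ?u' y + ennreal \<delta>" "?u' y \<le> ?u y + ennreal \<delta>" if "\<bar>enn2real (?u' y) - enn2real (?u y)\<bar> \<le> \<delta>" for y
    proof -
      have "?u y < \<top>" "?u' y < \<top>" using b(2)[of y] b'(2)[of y] by (auto intro: order.strict_trans1)
      then obtain v v' where "?u y = ennreal v" "0 \<le> v" "?u' y = ennreal v'" "0 \<le> v'"
        by (cases "?u y"; cases "?u' y") auto
      then show "?u y \<le> ?u' y + ennreal \<delta>" "?u' y \<le> ?u y + ennreal \<delta>"
        using that \<delta> by (auto simp: ennreal_plus[symmetric] simp del: ennreal_plus intro!: ennreal_leI)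
    qed
    have "AE y in restr \<mu> V. ?u y \<le> ?u' y + ennreal \<delta>" "AE y in restr (\<mu>n n) V. ?u' y \<le> ?u y + ennreal \<delta>"
      using ae(2)[OF s(2,1)] ae(1)[OF s(2,1)] by (auto elim!: eventually_mono intro: imp)
    then have "(\<integral>\<^sup>+w. ennreal_dist (disc_total V A w) (disc_total V (An n) w) \<partial>P (Some y))
        \<le> ennreal (sqrt \<delta> * (1 + 4 * b))" for y
      by (rule L1_dist_disc_total_uniform[OF c d V A(1-3) fm(1) An(1-3) fm(2) b(2,1) b'(2,1) \<delta>])
    then have "(\<integral>\<^sup>+w. ennreal_dist (disc_until t V A w) (disc_until t V (An n) w) \<partial>P (Some x))
        \<le> 2 * ennreal (sqrt \<delta> * (1 + 4 * b))" if "t < \<infinity>" for t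
      using b(2)[of x] b'(2)[of x] that
      by (intro L1_dist_disc_until[OF c d V A(1-3) An(1-3)]) (auto intro: order.strict_trans1)
    then show ?case using \<delta>\<eta> by (auto intro: order_trans)
  qed
qed

end

theorem theorem1p4:
  fixes X :: "('w, 's::{metric_space, second_countable_topology}) process"
    and Xh :: "('v, 's) process"
    and m :: "'s measure"
    and p :: "real \<Rightarrow> 's \<Rightarrow> 's \<Rightarrow> ennreal"
    and \<mu> :: "'s measure"
    and \<mu>n :: "nat \<Rightarrow> 's measure"
    and V :: "nat \<Rightarrow> 's set"
  assumes "locally_compact_space (euclidean :: 's topology)"
    and "standard_process X"
    and "standard_process Xh"
    and "dual_density X Xh m p"
    and "sets \<mu> = sets borel"
    and "\<And>n. sets (\<mu>n n) = sets borel"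
    and "incseq V" and "(\<Union>k. V k) = UNIV"
    and "\<And>k. open (V k)" and "\<And>k. compact (closure (V k))"
    and "\<And>k. restr \<mu> (V k) \<in> S00 X p"
    and "\<And>k n. restr (\<mu>n n) (V k) \<in> S00 X p"
    and "\<And>k. (\<lambda>n. Linf_norm (add_measure (restr (\<mu>n n) (V k)) (restr \<mu> (V k)))
           (\<lambda>x. enn2real (potential p 1 (restr (\<mu>n n) (V k)) x)
                 - enn2real (potential p 1 (restr \<mu> (V k)) x))) \<longlonglongrightarrow> 0"
  shows "\<mu> \<in> smooth_measures X p \<and> (\<forall>n. \<mu>n n \<in> smooth_measures X p) \<and>
    (conservative X \<longrightarrow>
      (\<forall>(A :: ennreal \<Rightarrow> 'w \<Rightarrow> ennreal) (An :: nat \<Rightarrow> ennreal \<Rightarrow> 'w \<Rightarrow> ennreal).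
        pcaf X A \<and> revuz_corr X p A \<mu> \<and>
        (\<forall>n. pcaf X (An n) \<and> revuz_corr X p (An n) (\<mu>n n)) \<longrightarrow>
          (\<forall>\<epsilon>>0. \<forall>T>0. \<forall>x. prob_vanishes (pr_law X (Some x))
             (\<lambda>n. {\<omega>\<in>space (pr_space X).
                sup_diff T (\<lambda>t. An n t \<omega>) (\<lambda>t. A t \<omega>) > ereal \<epsilon>})) \<and>
          (\<forall>\<epsilon>>0. \<forall>x. prob_vanishes (pr_law X (Some x))
             (\<lambda>n. {\<omega>\<in>space (pr_space X).
                loc_unif_dist (\<lambda>t. An n t \<omega>) (\<lambda>t. A t \<omega>) > \<epsilon>}))))"
proof -
  interpret standard_markov X by standard (rule assms(2))
  note V = assms(7-10)
  have smooth: "\<mu> \<in> smooth_measures X p" "\<mu>n n \<in> smooth_measures X p" for n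
    using smooth_of_local_S00[OF V assms(5,11)] smooth_of_local_S00[OF V assms(6,12)] by auto
  have sup: "prob_vanishes (pr_law X (Some x))
      (\<lambda>n. {\<omega>\<in>space (pr_space X). ereal \<epsilon> < sup_diff T (\<lambda>t. An n t \<omega>) (\<lambda>t. A t \<omega>)})"
    if "conservative X" "pcaf X A" "revuz_corr X p A \<mu>" "\<And>n. pcaf X (An n)" "\<And>n. revuz_corr X p (An n) (\<mu>n n)"
      "0 < \<epsilon>" "0 < T" for A :: "ennreal \<Rightarrow> 'w \<Rightarrow> ennreal" and An \<epsilon> T x
    by (rule sup_diff_in_probability[OF that(1,2,4) V that(7,6)
          eventually_L1_close[OF that(1) assms(4) V(3) that(2,3) assms(5,11) that(4,5) assms(6,12,13)]])
  have dist: "prob_vanishes (pr_law X (Some x))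
      (\<lambda>n. {\<omega>\<in>space (pr_space X). \<epsilon> < loc_unif_dist (\<lambda>t. An n t \<omega>) (\<lambda>t. A t \<omega>)})"
    if "conservative X" "pcaf X A" "revuz_corr X p A \<mu>" "\<And>n. pcaf X (An n)" "\<And>n. revuz_corr X p (An n) (\<mu>n n)"
      "0 < \<epsilon>" for A :: "ennreal \<Rightarrow> 'w \<Rightarrow> ennreal" and An \<epsilon> x
    using that by (intro loc_unif_dist_in_probability sup) auto
  show ?thesis using smooth sup dist by blast
qed

end
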